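(* Let $(\Omega,\mathcal{F},(\mathcal{F}_t)_{t\ge 0},P)$ be a filtered probability space carrying a one-dimensional $(\mathcal{F}_t)_{t\ge 0}$-Brownian motion $(B_t)_{t\ge 0}$, let $x\in\mathbb{R}$, and let $\sigma,b:\mathbb{R}\to\mathbb{R}$. Assume that $\sigma$ is Hölder continuous with exponent $\theta\in(1/2,1]$ and that $b$ is measurable and has at most linear growth. Let $(X_t)_{t\ge 0}$ be a continuous $(\mathcal{F}_t)_{t\ge 0}$-adapted real-valued solution to $$X_t = x+\int_0^t\sigma(X_s)\,\mathrm{d}B_s+\int_0^t b(X_s)\,\mathrm{d}s,\qquad t\ge 0 .$$ Then, for all $t>0$, the law of $X_t$ has a density on the set $\{y\in\mathbb{R}:\sigma(y)\neq 0\}$.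
   Context: Hölder continuous with exponent $\theta$ means that there is a constant $C$ with $|\sigma(y)-\sigma(z)|\le C|y-z|^\theta$ for all $y,z\in\mathbb{R}$. At most linear growth means $|b(y)|\le C(1+|y|)$ for all $y\in\mathbb{R}$, for some constant $C$. A probability measure $\mu$ on $\mathbb{R}$ "has a density on" a Borel set $D\subset\mathbb{R}$ if the restriction of $\mu$ to $D$ is absolutely continuous with respect to Lebesgue measure, i.e. $\mu(A\cap D)=0$ for every Borel set $A$ of Lebesgue measure $0$. Existence of the solution is not part of the claim. *)

theory Defs
  imports "HOL-Probability.Probability"
begin

text \<open>Processes and filtrations are indexed by \<^typ>\<open>real\<close>; only times \<open>t \<ge> 0\<close> are constrained or
  used. No completeness or right-continuity of the filtration is required.\<close>

definition filtered_prob_space :: "'a measure \<Rightarrow> (real \<Rightarrow> 'a measure) \<Rightarrow> bool" where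
  "filtered_prob_space M F \<longleftrightarrow>
     prob_space M \<and> (\<forall>t\<ge>0. subalgebra M (F t)) \<and>
     (\<forall>s t. 0 \<le> s \<longrightarrow> s \<le> t \<longrightarrow> subalgebra (F t) (F s))"

definition adapted :: "(real \<Rightarrow> 'a measure) \<Rightarrow> (real \<Rightarrow> 'a \<Rightarrow> real) \<Rightarrow> bool" where
  "adapted F X \<longleftrightarrow> (\<forall>t\<ge>0. X t \<in> borel_measurable (F t))"

definition continuous_paths :: "'a measure \<Rightarrow> (real \<Rightarrow> 'a \<Rightarrow> real) \<Rightarrow> bool" where
  "continuous_paths M X \<longleftrightarrow> (AE \<omega> in M. continuous_on {0..} (\<lambda>t. X t \<omega>))"

text \<open>The second argument of \<^const>\<open>normal_density\<close> is the standard deviation.\<close>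

definition brownian_motion ::
    "'a measure \<Rightarrow> (real \<Rightarrow> 'a measure) \<Rightarrow> (real \<Rightarrow> 'a \<Rightarrow> real) \<Rightarrow> bool" where
  "brownian_motion M F B \<longleftrightarrow>
     adapted F B \<and> continuous_paths M B \<and> (AE \<omega> in M. B 0 \<omega> = 0) \<and>
     (\<forall>s t. 0 \<le> s \<longrightarrow> s < t \<longrightarrow>
        distributed M lborel (\<lambda>\<omega>. B t \<omega> - B s \<omega>) (normal_density 0 (sqrt (t - s))) \<and>
        prob_space.indep_set M (sets (F s))
          (sets (vimage_algebra (space M) (\<lambda>\<omega>. B t \<omega> - B s \<omega>) borel)))"

text \<open>A simple process is given by a number of intervals \<open>m\<close>, grid points
  \<open>0 \<le> \<tau> 0 \<le> \<dots> \<le> \<tau> m\<close> and bounded \<open>F (\<tau> i)\<close>-measurable values \<open>\<xi> i\<close> on \<open>]\<tau> i, \<tau> (i+1)]\<close>.\<close>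

definition simple_process ::
    "(real \<Rightarrow> 'a measure) \<Rightarrow> nat \<Rightarrow> (nat \<Rightarrow> real) \<Rightarrow> (nat \<Rightarrow> 'a \<Rightarrow> real) \<Rightarrow> bool" where
  "simple_process F m \<tau> \<xi> \<longleftrightarrow>
     0 \<le> \<tau> 0 \<and> (\<forall>i<m. \<tau> i \<le> \<tau> (Suc i)) \<and>
     (\<forall>i<m. \<xi> i \<in> borel_measurable (F (\<tau> i)) \<and> (\<exists>C. \<forall>\<omega>\<in>space (F (\<tau> i)). \<bar>\<xi> i \<omega>\<bar> \<le> C))"

definition simple_value ::
    "nat \<Rightarrow> (nat \<Rightarrow> real) \<Rightarrow> (nat \<Rightarrow> 'a \<Rightarrow> real) \<Rightarrow> real \<Rightarrow> 'a \<Rightarrow> real" where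
  "simple_value m \<tau> \<xi> s \<omega> = (\<Sum>i<m. \<xi> i \<omega> * indicator {\<tau> i<..\<tau> (Suc i)} s)"

definition simple_integral ::
    "(real \<Rightarrow> 'a \<Rightarrow> real) \<Rightarrow> nat \<Rightarrow> (nat \<Rightarrow> real) \<Rightarrow> (nat \<Rightarrow> 'a \<Rightarrow> real) \<Rightarrow> real \<Rightarrow> 'a \<Rightarrow> real" where
  "simple_integral B m \<tau> \<xi> t \<omega> =
     (\<Sum>i<m. \<xi> i \<omega> * (B (min t (\<tau> (Suc i))) \<omega> - B (min t (\<tau> i)) \<omega>))"

text \<open>Convergence to \<open>0\<close> in probability. For measurable \<open>Y n\<close> the outer measure is just
  \<^term>\<open>emeasure M\<close>; it is used because \<^term>\<open>emeasure M\<close> is \<open>0\<close> on non-measurable sets, which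
  would make the condition vacuous there.\<close>

definition null_in_probability :: "'a measure \<Rightarrow> (nat \<Rightarrow> 'a \<Rightarrow> ennreal) \<Rightarrow> bool" where
  "null_in_probability M Y \<longleftrightarrow>
     (\<forall>\<epsilon>>0. (\<lambda>n. outer_measure_of M {\<omega> \<in> space M. ennreal \<epsilon> < Y n \<omega>}) \<longlonglongrightarrow> 0)"

text \<open>\<open>I\<close> is (a version of) the Ito integral process of \<open>H\<close> against \<open>B\<close>: there are simple processes
  \<open>S\<^sub>n\<close> such that, for each \<open>t \<ge> 0\<close>, the integrals of \<open>(S\<^sub>n - H)\<^sup>2\<close> over \<open>[0,t]\<close> tend to \<open>0\<close> in
  probability and the elementary integrals of \<open>S\<^sub>n\<close> up to time \<open>t\<close> tend to \<open>I t\<close> in probability.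
  This forces \<open>H\<close> to be almost surely square integrable on each \<open>[0,t]\<close> and determines each \<open>I t\<close>
  up to a null set.\<close>

definition has_ito_integral ::
    "'a measure \<Rightarrow> (real \<Rightarrow> 'a measure) \<Rightarrow> (real \<Rightarrow> 'a \<Rightarrow> real) \<Rightarrow>
     (real \<Rightarrow> 'a \<Rightarrow> real) \<Rightarrow> (real \<Rightarrow> 'a \<Rightarrow> real) \<Rightarrow> bool" where
  "has_ito_integral M F B H I \<longleftrightarrow>
     (AE \<omega> in M. set_borel_measurable borel {0..} (\<lambda>s. H s \<omega>)) \<and>
     (\<exists>m \<tau> \<xi>. (\<forall>n. simple_process F (m n) (\<tau> n) (\<xi> n)) \<and>
       (\<forall>t\<ge>0.
          null_in_probability M (\<lambda>n \<omega>.
            \<integral>\<^sup>+s\<in>{0..t}. ennreal ((simple_value (m n) (\<tau> n) (\<xi> n) s \<omega> - H s \<omega>)\<^sup>2) \<partial>lborel) \<and>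
          null_in_probability M (\<lambda>n \<omega>.
            ennreal \<bar>simple_integral B (m n) (\<tau> n) (\<xi> n) t \<omega> - I t \<omega>\<bar>)))"

definition continuous_sde_solution ::
    "'a measure \<Rightarrow> (real \<Rightarrow> 'a measure) \<Rightarrow> (real \<Rightarrow> 'a \<Rightarrow> real) \<Rightarrow>
     real \<Rightarrow> (real \<Rightarrow> real) \<Rightarrow> (real \<Rightarrow> real) \<Rightarrow> (real \<Rightarrow> 'a \<Rightarrow> real) \<Rightarrow> bool" where
  "continuous_sde_solution M F B x \<sigma> b X \<longleftrightarrow>
     adapted F X \<and> continuous_paths M X \<and>
     (\<exists>I. has_ito_integral M F B (\<lambda>s \<omega>. \<sigma> (X s \<omega>)) I \<and>
        (AE \<omega> in M. \<forall>t\<ge>0. X t \<omega> = x + I t \<omega> + (LINT s:{0..t}|lborel. b (X s \<omega>))))"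

definition holder_continuous :: "real \<Rightarrow> (real \<Rightarrow> real) \<Rightarrow> bool" where
  "holder_continuous \<theta> f \<longleftrightarrow> (\<exists>C. \<forall>y z. \<bar>f y - f z\<bar> \<le> C * \<bar>y - z\<bar> powr \<theta>)"

definition at_most_linear_growth :: "(real \<Rightarrow> real) \<Rightarrow> bool" where
  "at_most_linear_growth f \<longleftrightarrow> (\<exists>C. \<forall>y. \<bar>f y\<bar> \<le> C * (1 + \<bar>y\<bar>))"

text \<open>\<^term>\<open>density \<mu> (indicator D)\<close> is the measure \<open>A \<mapsto> \<mu> (A \<inter> D)\<close>.\<close>

definition has_density_on :: "real measure \<Rightarrow> real set \<Rightarrow> bool" where
  "has_density_on \<mu> D \<longleftrightarrow> absolutely_continuous lborel (density \<mu> (indicator D))"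

lemma has_density_on_iff:
  assumes "sets \<mu> = sets borel" "D \<in> sets borel"
  shows "has_density_on \<mu> D \<longleftrightarrow>
    (\<forall>A\<in>sets borel. emeasure lborel A = 0 \<longrightarrow> emeasure \<mu> (A \<inter> D) = 0)"
proof -
  have D: "D \<in> sets \<mu>" using assms by simp
  have "emeasure (density \<mu> (indicator D)) A = emeasure \<mu> (A \<inter> D)" if "A \<in> sets borel" for A
  proof -
    have A: "A \<in> sets \<mu>" using that assms by simp
    have "emeasure (density \<mu> (indicator D)) A = (\<integral>\<^sup>+y. indicator (A \<inter> D) y \<partial>\<mu>)"
      using A D by (simp add: emeasure_density indicator_inter_arith mult.commute)
    with A D show ?thesis by simp
  qed
  then show ?thesis
    using assms by (auto simp: has_density_on_def absolutely_continuous_def null_sets_def)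
qed

end

theory Submission
  imports Defs
begin

text \<open>Fix \<open>t > 0\<close> and freeze the coefficient at time \<open>t - \<epsilon>\<close>: up to a small error, \<open>X t\<close> equals the Euler
step \<open>Z = X (t - \<epsilon>) + \<sigma> (X (t - \<epsilon>)) (B t - B (t - \<epsilon>))\<close>. Conditionally on the past, \<open>Z\<close> is Gaussian
with standard deviation \<open>\<bar>\<sigma> (X (t - \<epsilon>))\<bar> \<surd>\<epsilon>\<close>, hence has a smooth law wherever \<open>\<sigma>\<close> is bounded away from
zero. The error is of order \<open>\<epsilon> powr ((1 + \<theta>) / 2)\<close> in \<open>L\<^sup>2\<close>: the integrand \<open>\<sigma> (X u) - \<sigma> (X (t - \<epsilon>))\<close> is of
order \<open>\<epsilon> powr (\<theta> / 2)\<close> because \<open>\<sigma>\<close> is Hoelder continuous and \<open>X\<close> moves by about \<open>\<surd>\<epsilon>\<close>, and the drift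
contributes only \<open>\<epsilon>\<close>. So the error is of smaller order than the width \<open>\<surd>\<epsilon>\<close> of the Gaussian.

This gap is turned into absolute continuity by a multiscale argument. Let \<open>U\<close> be open, let
\<open>box_average U h y\<close> be the fraction of \<open>{y..y + h}\<close> covered by \<open>U\<close>, and let \<open>f\<close> be a Hoelder cutoff that
vanishes where \<open>\<bar>\<sigma>\<bar> \<le> \<delta>\<close>. In \<open>E (f (X t) (box_average U h - box_average U (2 h)) (X t))\<close> three errors
appear: replacing \<open>f (X t)\<close> by \<open>f (X (t - \<epsilon>))\<close> costs \<open>\<epsilon> powr (\<theta> / 2)\<close>; replacing \<open>X t\<close> by \<open>Z\<close> costs
\<open>\<epsilon> powr ((1 + \<theta>) / 2) / h\<close>, since box averages are Lipschitz with constant \<open>1 / h\<close>; and the remaining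
Gaussian expectation is at most of order \<open>h / \<surd>\<epsilon>\<close>, because \<open>box_average U (2 h)\<close> is the mean of
\<open>box_average U h\<close> and its translate by \<open>h\<close>. For \<open>\<theta> > 1 / 2\<close> the choice \<open>\<epsilon> = h powr (3 / 2)\<close> bounds all three
by a multiple of \<open>h powr (1 / 8)\<close> (\<open>scale_step_le\<close>). Summing over \<open>h = 2\<^sup>-\<^sup>n\<close> with \<open>n > N\<close> gives
\<open>E (f (X t) 1\<^sub>U (X t)) \<le> 2\<^sup>N \<lambda>(U) + K' r\<^sup>N\<close> for some \<open>r < 1\<close>,
with \<open>K'\<close> independent of \<open>U\<close>. If \<open>A\<close> is a null set, choosing first \<open>N\<close> large and then \<open>U\<close> around \<open>A\<close> of
tiny measure shows \<open>E (f (X t) 1\<^sub>A (X t)) = 0\<close> (\<open>nondegenerate_null\<close>), and \<open>\<delta> \<rightarrow> 0\<close> finishes the proof.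

The moment estimates rest on a single inequality for Ito integrals defined by convergence in
probability (\<open>ito_killed_inequality\<close>): if \<open>a = \<integral>\<^sub>s\<^sup>t (H - \<kappa>)\<^sup>2\<close> and \<open>\<kappa>\<close> is known at time \<open>s\<close>, then
\<open>E ((I t - I s - \<kappa> (B t - B s))\<^sup>2; a < c) \<le> E (min a c)\<close>. It is proved for simple processes by switching the
integrand off once the accumulated square exceeds \<open>c\<close>, and it replaces stopping times:
with \<open>s = 0\<close> and \<open>\<kappa> = 0\<close> it makes \<open>E ((X u)\<^sup>2; a < c)\<close> finite, after which Gronwall's lemma bounds it independently of \<open>c\<close>
(\<open>second_moment_bound\<close>); with \<open>\<kappa> = \<sigma> (X s)\<close> it bounds the error of the Euler step (\<open>one_step_errors\<close>).\<close>

section \<open>Convergence in probability and Brownian increments\<close>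

lemma null_in_probability_add:
  assumes "null_in_probability M Y" "null_in_probability M Z"
  shows "null_in_probability M (\<lambda>n \<omega>. Y n \<omega> + Z n \<omega>)"
  unfolding null_in_probability_def
proof (intro allI impI)
  fix \<epsilon> :: real assume e: "0 < \<epsilon>"
  let ?A = "\<lambda>Y n. {\<omega> \<in> space M. ennreal (\<epsilon> / 2) < (Y n \<omega> :: ennreal)}"
  have *: "(\<lambda>n. outer_measure_of M (?A Y n) + outer_measure_of M (?A Z n)) \<longlonglongrightarrow> 0 + 0"
    using assms e by (intro tendsto_add) (auto simp: null_in_probability_def)
  have "outer_measure_of M {\<omega> \<in> space M. ennreal \<epsilon> < Y n \<omega> + Z n \<omega>}
      \<le> outer_measure_of M (?A Y n) + outer_measure_of M (?A Z n)" for n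
  proof -
    obtain E where E: "E \<in> sets M" "?A Y n \<subseteq> E" "outer_measure_of M (?A Y n) = emeasure M E"
      using outer_measure_of_attain[of "?A Y n" M] by blast
    obtain G where G: "G \<in> sets M" "?A Z n \<subseteq> G" "outer_measure_of M (?A Z n) = emeasure M G"
      using outer_measure_of_attain[of "?A Z n" M] by blast
    have "Y n \<omega> + Z n \<omega> \<le> ennreal \<epsilon>" if "Y n \<omega> \<le> ennreal (\<epsilon> / 2)" "Z n \<omega> \<le> ennreal (\<epsilon> / 2)" for \<omega>
    proof -
      have "Y n \<omega> + Z n \<omega> \<le> ennreal (\<epsilon> / 2) + ennreal (\<epsilon> / 2)" using that by (rule add_mono)
      also have "\<dots> = ennreal \<epsilon>" using e by (simp flip: ennreal_plus)
      finally show ?thesis .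
    qed
    then have "{\<omega> \<in> space M. ennreal \<epsilon> < Y n \<omega> + Z n \<omega>} \<subseteq> ?A Y n \<union> ?A Z n"
      by (fastforce simp: not_le[symmetric])
    also have "\<dots> \<subseteq> E \<union> G" using E G by blast
    finally have "outer_measure_of M {\<omega> \<in> space M. ennreal \<epsilon> < Y n \<omega> + Z n \<omega>} \<le> outer_measure_of M (E \<union> G)"
      by (rule outer_measure_of_mono)
    also have "\<dots> = emeasure M (E \<union> G)" using E(1) G(1) by simp
    also have "\<dots> \<le> emeasure M E + emeasure M G"
      using E G by (intro emeasure_subadditive) auto
    finally show ?thesis using E G by simp
  qed
  then show "(\<lambda>n. outer_measure_of M {\<omega> \<in> space M. ennreal \<epsilon> < Y n \<omega> + Z n \<omega>}) \<longlonglongrightarrow> 0"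
    by (intro tendsto_sandwich[OF always_eventually always_eventually tendsto_const *[unfolded add_0]]) simp_all
qed

text \<open>Along a subsequence the exceptional sets have outer measures at most \<open>2\<^sup>-\<^sup>k\<close>. They need not be
measurable, so Borel--Cantelli is applied to measurable covers of the same measure.\<close>

lemma null_in_probability_AE_subsequence:
  assumes "null_in_probability M Y"
  shows "\<exists>r :: nat \<Rightarrow> nat. AE \<omega> in M. (\<lambda>k. Y (r k) \<omega>) \<longlonglongrightarrow> 0"
proof -
  let ?A = "\<lambda>k n. {\<omega> \<in> space M. ennreal ((1/2)^k) < Y n \<omega>}"
  have "\<exists>n. outer_measure_of M (?A k n) < ennreal ((1/2)^k)" for k
  proof -
    have "(\<lambda>n. outer_measure_of M (?A k n)) \<longlonglongrightarrow> 0"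
      using assms by (auto simp: null_in_probability_def)
    then have "eventually (\<lambda>n. outer_measure_of M (?A k n) < ennreal ((1/2)^k)) sequentially"
      by (rule order_tendstoD) simp
    then show ?thesis by (auto simp: eventually_sequentially)
  qed
  then obtain r where r: "\<And>k. outer_measure_of M (?A k (r k)) < ennreal ((1/2)^k)" by metis
  have "\<exists>E\<in>sets M. ?A k (r k) \<subseteq> E \<and> outer_measure_of M (?A k (r k)) = emeasure M E" for k
    by (rule outer_measure_of_attain) auto
  then obtain E where E: "\<And>k. E k \<in> sets M" "\<And>k. ?A k (r k) \<subseteq> E k"
    "\<And>k. outer_measure_of M (?A k (r k)) = emeasure M (E k)" by metis
  have less: "emeasure M (E k) < ennreal ((1/2)^k)" for k using r E(3) by metis
  have "AE \<omega> in M. eventually (\<lambda>k. \<omega> \<in> space M - E k) sequentially"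
  proof (rule borel_cantelli_AE1)
    show fin: "emeasure M (E k) < \<infinity>" for k
      using less[of k] by (simp add: less_trans[OF _ ennreal_less_top])
    have "measure M (E k) \<le> (1/2)^k" for k
      using less[of k] fin[of k] by (simp add: measure_def enn2real_leI less_imp_le)
    then show "summable (\<lambda>k. measure M (E k))"
      by (intro summable_comparison_test'[OF summable_geometric[of "1/2::real"]]) auto
  qed (use E in auto)
  then have "AE \<omega> in M. (\<lambda>k. Y (r k) \<omega>) \<longlonglongrightarrow> 0"
  proof eventually_elim
    case (elim \<omega>)
    then have "eventually (\<lambda>k. Y (r k) \<omega> \<le> ennreal ((1/2)^k)) sequentially"
      by eventually_elim (use E(2) in \<open>fastforce simp: not_le[symmetric]\<close>)
    moreover have "(\<lambda>k. ennreal ((1/2)^k)) \<longlonglongrightarrow> 0"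
      using tendsto_ennrealI[OF LIMSEQ_power_zero[of "1/2::real"]] by simp
    ultimately show ?case
      by (rule tendsto_sandwich[OF always_eventually[OF allI[OF zero_le]] _ tendsto_const])
  qed
  then show ?thesis by (rule exI[of _ r])
qed

locale brownian_basis = prob_space M for M :: "'a measure" +
  fixes F :: "real \<Rightarrow> 'a measure" and B :: "real \<Rightarrow> 'a \<Rightarrow> real"
  assumes filtered: "filtered_prob_space M F" and bm: "brownian_motion M F B"
begin

lemma subalg: "0 \<le> t \<Longrightarrow> subalgebra M (F t)"
  using filtered by (auto simp: filtered_prob_space_def)

lemma space_F: "0 \<le> t \<Longrightarrow> space (F t) = space M"
  using subalg by (auto simp: subalgebra_def)

lemma F_measurable_M: "f \<in> measurable (F t) N \<Longrightarrow> 0 \<le> t \<Longrightarrow> f \<in> measurable M N"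
  using measurable_from_subalg[OF subalg] by blast

lemma F_measurable_mono: "f \<in> measurable (F s) N \<Longrightarrow> 0 \<le> s \<Longrightarrow> s \<le> t \<Longrightarrow> f \<in> measurable (F t) N"
  using filtered unfolding filtered_prob_space_def by (meson measurable_from_subalg)

lemma B_adapted: "0 \<le> t \<Longrightarrow> B t \<in> borel_measurable (F t)"
  using bm by (auto simp: brownian_motion_def adapted_def)

lemma B_measurable: "0 \<le> t \<Longrightarrow> B t \<in> borel_measurable M"
  using B_adapted F_measurable_M by blast

lemma increment_distributed:
  "0 \<le> s \<Longrightarrow> s < t \<Longrightarrow> distributed M lborel (\<lambda>\<omega>. B t \<omega> - B s \<omega>) (normal_density 0 (sqrt (t - s)))"
  using bm by (auto simp: brownian_motion_def)

text \<open>Independence of the past is assumed for \<open>\<sigma>\<close>-algebras; for a single random variable \<open>W\<close> it says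
that the joint law with the increment is a product, which is the form used below.\<close>

lemma increment_indep:
  assumes W: "W \<in> borel_measurable (F s)" and s: "0 \<le> s" "s < t"
  shows "indep_var borel W borel (\<lambda>\<omega>. B t \<omega> - B s \<omega>)"
proof -
  have i: "indep_set (sets (F s)) (sets (vimage_algebra (space M) (\<lambda>\<omega>. B t \<omega> - B s \<omega>) borel))"
    using bm s by (auto simp: brownian_motion_def)
  have [measurable]: "B t \<in> borel_measurable M" "B s \<in> borel_measurable M"
    using B_measurable s by auto
  have "sigma_sets (space M) {W -` A \<inter> space M | A. A \<in> sets borel} \<subseteq> sets (F s)"
    using W space_F[OF s(1)] sets.sigma_sets_subset[of "{W -` A \<inter> space M | A. A \<in> sets borel}" "F s"]
    by (auto simp: measurable_def)
  then have "indep_set (sigma_sets (space M) {W -` A \<inter> space M | A. A \<in> sets borel})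
     (sigma_sets (space M) {(\<lambda>\<omega>. B t \<omega> - B s \<omega>) -` A \<inter> space M | A. A \<in> sets borel})"
    using i unfolding indep_sets2_eq sets_vimage_algebra by blast
  then show ?thesis
    using W F_measurable_M s by (auto simp: indep_var_eq)
qed

lemma increment_integrable: "0 \<le> s \<Longrightarrow> s < t \<Longrightarrow> integrable M (\<lambda>\<omega>. B t \<omega> - B s \<omega>)"
  using integrable_normal_moment_nz_1[of "sqrt (t-s)" 0]
  by (subst distributed_integrable[OF increment_distributed, of s t "\<lambda>x. x", symmetric]) auto

lemma increment_mean: "0 \<le> s \<Longrightarrow> s < t \<Longrightarrow> expectation (\<lambda>\<omega>. B t \<omega> - B s \<omega>) = 0"
  using normal_distributed_expectation[OF _ increment_distributed] by simp

lemma increment_square_integrable: "0 \<le> s \<Longrightarrow> s < t \<Longrightarrow> integrable M (\<lambda>\<omega>. (B t \<omega> - B s \<omega>)\<^sup>2)"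
  using integrable_normal_moment[of "sqrt (t-s)" 0 2]
  by (subst distributed_integrable[OF increment_distributed, of s t "\<lambda>x. x\<^sup>2", symmetric]) auto

lemma increment_variance:
  assumes "0 \<le> s" "s < t" shows "expectation (\<lambda>\<omega>. (B t \<omega> - B s \<omega>)\<^sup>2) = t - s"
  using normal_distributed_variance[OF _ increment_distributed[OF assms]] assms
  by (simp add: increment_mean)

section \<open>The isometry for killed elementary integrals\<close>

text \<open>By induction on the grid: the cross term of the new summand with the old sum vanishes because
the increment is centred and independent of the past. Measurability is asked only on cells of positive
length: clamping a grid to a time window produces degenerate cells whose values belong to a later time.\<close>

lemma elementary_isometry:
  assumes t0: "0 \<le> \<tau> 0" and mono: "\<And>i. i < m \<Longrightarrow> \<tau> i \<le> \<tau> (Suc i)"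
    and meas: "\<And>i. i < m \<Longrightarrow> \<tau> i < \<tau> (Suc i) \<Longrightarrow> \<zeta> i \<in> borel_measurable (F (\<tau> i))"
    and bound: "\<And>i. i < m \<Longrightarrow> \<tau> i < \<tau> (Suc i) \<Longrightarrow> \<exists>C. \<forall>\<omega>\<in>space M. \<bar>\<zeta> i \<omega>\<bar> \<le> C"
    and k: "k \<le> m"
  defines "N \<equiv> \<lambda>k \<omega>. \<Sum>i<k. \<zeta> i \<omega> * (B (\<tau> (Suc i)) \<omega> - B (\<tau> i) \<omega>)"
  shows "N k \<in> borel_measurable (F (\<tau> k)) \<and> 0 \<le> \<tau> k \<and> integrable M (\<lambda>\<omega>. (N k \<omega>)\<^sup>2) \<and>
    expectation (\<lambda>\<omega>. (N k \<omega>)\<^sup>2) = (\<Sum>i<k. expectation (\<lambda>\<omega>. (\<zeta> i \<omega>)\<^sup>2) * (\<tau> (Suc i) - \<tau> i))"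
  using k
proof (induction k)
  case 0
  then show ?case using t0 by (simp add: N_def)
next
  case (Suc k)
  then have k: "k < m" and IH: "N k \<in> borel_measurable (F (\<tau> k))" "0 \<le> \<tau> k" "integrable M (\<lambda>\<omega>. (N k \<omega>)\<^sup>2)"
    "expectation (\<lambda>\<omega>. (N k \<omega>)\<^sup>2) = (\<Sum>i<k. expectation (\<lambda>\<omega>. (\<zeta> i \<omega>)\<^sup>2) * (\<tau> (Suc i) - \<tau> i))"
    by auto
  show ?case
  proof (cases "\<tau> k < \<tau> (Suc k)")
    case False
    with mono[OF k] have eq: "\<tau> (Suc k) = \<tau> k" by simp
    then have "N (Suc k) = N k" by (auto simp: N_def)
    with IH eq show ?thesis by simp
  next
    case True
    define D where "D \<omega> = B (\<tau> (Suc k)) \<omega> - B (\<tau> k) \<omega>" for \<omega>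
    define z where "z = \<zeta> k"
    have zF [measurable]: "z \<in> borel_measurable (F (\<tau> k))" using meas[OF k True] by (simp add: z_def)
    have NF [measurable]: "N k \<in> borel_measurable (F (\<tau> k))" by fact
    obtain C where C: "\<And>\<omega>. \<omega> \<in> space M \<Longrightarrow> \<bar>z \<omega>\<bar> \<le> C" using bound[OF k True] by (auto simp: z_def)
    have t: "0 \<le> \<tau> (Suc k)" using IH(2) True by simp
    have DF: "D \<in> borel_measurable (F (\<tau> (Suc k)))"
      unfolding D_def using B_adapted[OF t] F_measurable_mono[OF B_adapted[OF IH(2)] IH(2), of "\<tau> (Suc k)"] True
      by (intro borel_measurable_diff) auto
    have NM [measurable]: "N k \<in> borel_measurable M" and zM [measurable]: "z \<in> borel_measurable M"
      using F_measurable_M[OF NF IH(2)] F_measurable_M[OF zF IH(2)] by auto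
    have DM [measurable]: "D \<in> borel_measurable M" using F_measurable_M[OF DF t] .
    have Suc: "N (Suc k) = (\<lambda>\<omega>. N k \<omega> + z \<omega> * D \<omega>)" by (auto simp: N_def D_def z_def)
    have ind: "indep_var borel W borel D" if "W \<in> borel_measurable (F (\<tau> k))" for W
      unfolding D_def using increment_indep[OF that IH(2) True] .
    have D1: "integrable M D" "expectation D = 0"
      and D2: "integrable M (\<lambda>\<omega>. (D \<omega>)\<^sup>2)" "expectation (\<lambda>\<omega>. (D \<omega>)\<^sup>2) = \<tau> (Suc k) - \<tau> k"
      unfolding D_def using IH(2) True
      by (auto intro: increment_integrable increment_mean increment_square_integrable increment_variance)
    have Nint: "integrable M (N k)"
      using square_integrable_imp_integrable[OF NM IH(3)] .
    have C0: "0 \<le> C" using C not_empty by fastforce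
    have Nz: "integrable M (\<lambda>\<omega>. N k \<omega> * z \<omega>)"
    proof (rule Bochner_Integration.integrable_bound)
      show "integrable M (\<lambda>\<omega>. C * N k \<omega>)" using Nint by simp
      show "AE \<omega> in M. norm (N k \<omega> * z \<omega>) \<le> norm (C * N k \<omega>)"
      proof (rule AE_I2)
        fix \<omega> assume "\<omega> \<in> space M"
        then have "\<bar>z \<omega>\<bar> * \<bar>N k \<omega>\<bar> \<le> C * \<bar>N k \<omega>\<bar>" by (intro mult_right_mono C) auto
        then show "norm (N k \<omega> * z \<omega>) \<le> norm (C * N k \<omega>)" using C0 by (simp add: abs_mult mult.commute)
      qed
    qed measurable
    have zz: "integrable M (\<lambda>\<omega>. (z \<omega>)\<^sup>2)"
    proof (rule Bochner_Integration.integrable_bound)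
      show "integrable M (\<lambda>\<omega>. C\<^sup>2)" by simp
      show "AE \<omega> in M. norm ((z \<omega>)\<^sup>2) \<le> norm (C\<^sup>2)"
        using C C0 by (intro AE_I2) (auto intro: abs_le_square_iff[THEN iffD1])
    qed measurable
    have iNz: "indep_var borel (\<lambda>\<omega>. N k \<omega> * z \<omega>) borel D" by (rule ind) measurable
    have cross: "integrable M (\<lambda>\<omega>. N k \<omega> * z \<omega> * D \<omega>)" "expectation (\<lambda>\<omega>. N k \<omega> * z \<omega> * D \<omega>) = 0"
      using indep_var_integrable[OF iNz Nz D1(1)] indep_var_lebesgue_integral[OF iNz Nz D1(1)] D1(2) by auto
    have "indep_var borel ((\<lambda>x::real. x\<^sup>2) \<circ> z) borel ((\<lambda>x::real. x\<^sup>2) \<circ> D)"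
      by (rule indep_var_compose[OF ind]) measurable
    then have izz: "indep_var borel (\<lambda>\<omega>. (z \<omega>)\<^sup>2) borel (\<lambda>\<omega>. (D \<omega>)\<^sup>2)" by (simp add: comp_def)
    have sq: "integrable M (\<lambda>\<omega>. (z \<omega>)\<^sup>2 * (D \<omega>)\<^sup>2)"
      "expectation (\<lambda>\<omega>. (z \<omega>)\<^sup>2 * (D \<omega>)\<^sup>2) = expectation (\<lambda>\<omega>. (z \<omega>)\<^sup>2) * (\<tau> (Suc k) - \<tau> k)"
      using indep_var_integrable[OF izz zz D2(1)] indep_var_lebesgue_integral[OF izz zz D2(1)] D2(2) by auto
    have eq: "(\<lambda>\<omega>. (N (Suc k) \<omega>)\<^sup>2) = (\<lambda>\<omega>. (N k \<omega>)\<^sup>2 + 2 * (N k \<omega> * z \<omega> * D \<omega>) + (z \<omega>)\<^sup>2 * (D \<omega>)\<^sup>2)"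
      by (auto simp: Suc power2_eq_square algebra_simps)
    have "N (Suc k) \<in> borel_measurable (F (\<tau> (Suc k)))"
      unfolding Suc using DF F_measurable_mono[OF NF IH(2), of "\<tau> (Suc k)"] F_measurable_mono[OF zF IH(2), of "\<tau> (Suc k)"] True
      by (intro borel_measurable_add borel_measurable_times) auto
    moreover have "integrable M (\<lambda>\<omega>. (N (Suc k) \<omega>)\<^sup>2)"
      unfolding eq using IH(3) cross sq by auto
    moreover have "expectation (\<lambda>\<omega>. (N (Suc k) \<omega>)\<^sup>2) =
       (\<Sum>i<Suc k. expectation (\<lambda>\<omega>. (\<zeta> i \<omega>)\<^sup>2) * (\<tau> (Suc i) - \<tau> i))"
      unfolding eq using IH(3,4) cross sq by (simp add: z_def)
    ultimately show ?thesis using t by simp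
  qed
qed

text \<open>The integrand is switched off as soon as the accumulated square, the current cell included,
would exceed \<open>c\<close>. Since the current value is already known at the left end of its cell, the killed integrand is still
adapted, its accumulated square is at most \<open>min q c\<close>, and it agrees with \<open>\<zeta>\<close> where \<open>q \<le> c\<close>.
Killing also bounds each value by \<open>\<surd>(c / length)\<close>, so \<open>\<zeta>\<close> itself may be unbounded.\<close>

lemma killed_isometry:
  assumes t0: "0 \<le> \<tau> 0" and mono: "\<And>i. i < m \<Longrightarrow> \<tau> i \<le> \<tau> (Suc i)"
    and meas: "\<And>i. i < m \<Longrightarrow> \<tau> i < \<tau> (Suc i) \<Longrightarrow> \<zeta> i \<in> borel_measurable (F (\<tau> i))"
    and c: "0 \<le> c"
  defines "q \<equiv> \<lambda>\<omega>. \<Sum>i<m. (\<zeta> i \<omega>)\<^sup>2 * (\<tau> (Suc i) - \<tau> i)"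
  shows "(\<integral>\<^sup>+\<omega>. ennreal ((\<Sum>i<m. \<zeta> i \<omega> * (B (\<tau> (Suc i)) \<omega> - B (\<tau> i) \<omega>))\<^sup>2) * indicator {\<omega>. q \<omega> \<le> c} \<omega> \<partial>M)
    \<le> (\<integral>\<^sup>+\<omega>. ennreal (min (q \<omega>) c) \<partial>M)"
proof -
  define Q where "Q k \<omega> = (\<Sum>i<k. (\<zeta> i \<omega>)\<^sup>2 * (\<tau> (Suc i) - \<tau> i))" for k \<omega>
  define z where "z i \<omega> = (if Q (Suc i) \<omega> \<le> c then \<zeta> i \<omega> else 0)" for i \<omega>
  have nn: "0 \<le> \<tau> (Suc i) - \<tau> i" if "i < m" for i using mono[OF that] by simp
  have tau_mono: "\<tau> i \<le> \<tau> j" if "i \<le> j" "j \<le> m" for i j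
    using that by (induction j rule: dec_induct) (auto intro: order_trans[OF _ mono])
  have tau0: "0 \<le> \<tau> i" if "i \<le> m" for i using tau_mono[of 0 i] that t0 by simp
  have Q_mono: "Q i \<omega> \<le> Q j \<omega>" if "i \<le> j" "j \<le> m" for i j \<omega>
    unfolding Q_def using that nn by (intro sum_mono2) auto
  have Qmeas: "Q (Suc i) \<in> borel_measurable (F (\<tau> i))" if "i < m" for i
  proof -
    have "(\<lambda>\<omega>. (\<zeta> j \<omega>)\<^sup>2 * (\<tau> (Suc j) - \<tau> j)) \<in> borel_measurable (F (\<tau> i))" if "j < Suc i" for j
    proof (cases "\<tau> j < \<tau> (Suc j)")
      case True
      have "\<zeta> j \<in> borel_measurable (F (\<tau> i))"
        using that \<open>i < m\<close> True by (intro F_measurable_mono[OF meas] tau_mono tau0) auto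
      then show ?thesis by measurable
    next
      case False
      then have "\<tau> (Suc j) - \<tau> j = 0" using mono[of j] that \<open>i < m\<close> by simp
      then show ?thesis by simp
    qed
    then show ?thesis unfolding Q_def by (intro borel_measurable_sum) auto
  qed
  have zmeas: "z i \<in> borel_measurable (F (\<tau> i))" if "i < m" "\<tau> i < \<tau> (Suc i)" for i
    unfolding z_def using Qmeas[OF that(1)] meas[OF that] by measurable
  have zbound: "\<exists>C. \<forall>\<omega>\<in>space M. \<bar>z i \<omega>\<bar> \<le> C" if "i < m" "\<tau> i < \<tau> (Suc i)" for i
  proof (intro exI ballI)
    fix \<omega>
    let ?d = "\<tau> (Suc i) - \<tau> i"
    have "(z i \<omega>)\<^sup>2 * ?d \<le> c"
    proof (cases "Q (Suc i) \<omega> \<le> c")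
      case True
      have "(z i \<omega>)\<^sup>2 * ?d = (\<zeta> i \<omega>)\<^sup>2 * ?d" using True by (simp add: z_def)
      also have "\<dots> \<le> Q (Suc i) \<omega>" unfolding Q_def using that nn by (auto intro!: sum_nonneg)
      finally show ?thesis using True by simp
    qed (use c in \<open>simp add: z_def\<close>)
    then have "(z i \<omega>)\<^sup>2 \<le> c / ?d" using that by (simp add: pos_le_divide_eq)
    then show "\<bar>z i \<omega>\<bar> \<le> sqrt (c / ?d)" using real_le_rsqrt real_sqrt_le_mono by fastforce
  qed
  have zz: "(\<Sum>i<k. (z i \<omega>)\<^sup>2 * (\<tau> (Suc i) - \<tau> i)) \<le> min (Q k \<omega>) c" if "k \<le> m" for k \<omega>
    using that
  proof (induction k)
    case (Suc k)
    then have IH: "(\<Sum>i<k. (z i \<omega>)\<^sup>2 * (\<tau> (Suc i) - \<tau> i)) \<le> min (Q k \<omega>) c" by simp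
    have "Q (Suc k) \<omega> = Q k \<omega> + (\<zeta> k \<omega>)\<^sup>2 * (\<tau> (Suc k) - \<tau> k)" by (simp add: Q_def)
    moreover have "Q k \<omega> \<le> Q (Suc k) \<omega>" using Suc by (intro Q_mono) auto
    ultimately show ?case using IH by (auto simp: z_def)
  qed (use c in \<open>simp add: Q_def\<close>)
  have qQ: "q = Q m" by (rule ext) (simp add: q_def Q_def)
  let ?N = "\<lambda>\<omega>. \<Sum>i<m. z i \<omega> * (B (\<tau> (Suc i)) \<omega> - B (\<tau> i) \<omega>)"
  have iso: "integrable M (\<lambda>\<omega>. (?N \<omega>)\<^sup>2)"
    "expectation (\<lambda>\<omega>. (?N \<omega>)\<^sup>2) = (\<Sum>i<m. expectation (\<lambda>\<omega>. (z i \<omega>)\<^sup>2) * (\<tau> (Suc i) - \<tau> i))"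
    using elementary_isometry[of \<tau> m z m] t0 mono zmeas zbound by auto
  have zint: "integrable M (\<lambda>\<omega>. (z i \<omega>)\<^sup>2 * (\<tau> (Suc i) - \<tau> i))" if "i < m" for i
  proof (cases "\<tau> i < \<tau> (Suc i)")
    case True
    from zbound[OF that True] obtain C where C: "\<forall>\<omega>\<in>space M. \<bar>z i \<omega>\<bar> \<le> C" by blast
    have [measurable]: "z i \<in> borel_measurable M"
      using F_measurable_M[OF zmeas[OF that True] tau0] that by simp
    have "integrable M (\<lambda>\<omega>. (z i \<omega>)\<^sup>2)"
    proof (rule Bochner_Integration.integrable_bound)
      show "integrable M (\<lambda>\<omega>. C\<^sup>2)" by simp
      show "AE \<omega> in M. norm ((z i \<omega>)\<^sup>2) \<le> norm (C\<^sup>2)"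
        using C by (intro AE_I2) (auto intro!: abs_le_square_iff[THEN iffD1])
    qed measurable
    then show ?thesis by simp
  next
    case False
    then have "\<tau> (Suc i) - \<tau> i = 0" using mono[of i] that by simp
    then show ?thesis by simp
  qed
  have "expectation (\<lambda>\<omega>. (z i \<omega>)\<^sup>2) * (\<tau> (Suc i) - \<tau> i) = expectation (\<lambda>\<omega>. (z i \<omega>)\<^sup>2 * (\<tau> (Suc i) - \<tau> i))" for i
    by simp
  then have "expectation (\<lambda>\<omega>. (?N \<omega>)\<^sup>2) = expectation (\<lambda>\<omega>. \<Sum>i<m. (z i \<omega>)\<^sup>2 * (\<tau> (Suc i) - \<tau> i))"
    using iso(2) zint by (subst Bochner_Integration.integral_sum) auto
  then have "(\<integral>\<^sup>+\<omega>. ennreal ((?N \<omega>)\<^sup>2) \<partial>M) = (\<integral>\<^sup>+\<omega>. ennreal (\<Sum>i<m. (z i \<omega>)\<^sup>2 * (\<tau> (Suc i) - \<tau> i)) \<partial>M)"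
    using iso(1) zint nn by (subst (1 2) nn_integral_eq_integral) (auto intro!: AE_I2 sum_nonneg)
  also have "\<dots> \<le> (\<integral>\<^sup>+\<omega>. ennreal (min (q \<omega>) c) \<partial>M)"
    unfolding qQ using zz[of m] by (intro nn_integral_mono ennreal_leI) auto
  finally have le: "(\<integral>\<^sup>+\<omega>. ennreal ((?N \<omega>)\<^sup>2) \<partial>M) \<le> (\<integral>\<^sup>+\<omega>. ennreal (min (q \<omega>) c) \<partial>M)" .
  have "z i \<omega> = \<zeta> i \<omega>" if "q \<omega> \<le> c" "i < m" for i \<omega>
    using Q_mono[of "Suc i" m \<omega>] that by (auto simp: z_def qQ)
  then have "ennreal ((\<Sum>i<m. \<zeta> i \<omega> * (B (\<tau> (Suc i)) \<omega> - B (\<tau> i) \<omega>))\<^sup>2) * indicator {\<omega>. q \<omega> \<le> c} \<omega> \<le> ennreal ((?N \<omega>)\<^sup>2)" for \<omega>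
    by (auto simp: indicator_def)
  then show ?thesis by (intro order_trans[OF nn_integral_mono le])
qed

end

lemma disjoint_indicator_sum_square:
  fixes \<zeta> \<tau> :: "nat \<Rightarrow> real"
  assumes mono: "\<And>i. i < k \<Longrightarrow> \<tau> i \<le> \<tau> (Suc i)"
  shows "(\<Sum>i<k. \<zeta> i * indicator {\<tau> i<..\<tau> (Suc i)} u)\<^sup>2 = (\<Sum>i<k. (\<zeta> i)\<^sup>2 * indicator {\<tau> i<..\<tau> (Suc i)} u)"
  using mono
proof (induction k)
  case (Suc k)
  show ?case
  proof (cases "u \<in> {\<tau> k<..\<tau> (Suc k)}")
    case True
    have "\<tau> (Suc i) \<le> \<tau> k" if "i < k" for i
    proof -
      have "Suc i \<le> k" using that by simp
      then show ?thesis
        by (induction rule: dec_induct) (auto intro: order_trans[OF _ Suc.prems])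
    qed
    then have "indicator {\<tau> i<..\<tau> (Suc i)} u = (0::real)" if "i < k" for i
      using True that by (fastforce simp: indicator_def)
    then show ?thesis using True by simp
  qed (use Suc in simp)
qed simp

text \<open>The process \<open>S - \<kappa>\<close> on a time window \<open>]s, t]\<close> is again simple: its grid is that of \<open>S\<close> clamped to
\<open>[s, t]\<close>, with \<open>s\<close> and \<open>t\<close> added. The first and the last cell lie outside the original grid, where \<open>S\<close>
vanishes, and therefore carry the value \<open>- \<kappa>\<close>.\<close>

definition window_grid :: "nat \<Rightarrow> (nat \<Rightarrow> real) \<Rightarrow> real \<Rightarrow> real \<Rightarrow> nat \<Rightarrow> real" where
  "window_grid m \<tau> s t j = (if j = 0 then s else if j \<le> Suc m then max s (min t (\<tau> (j - 1))) else t)"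

definition window_value :: "nat \<Rightarrow> (nat \<Rightarrow> 'a \<Rightarrow> real) \<Rightarrow> ('a \<Rightarrow> real) \<Rightarrow> nat \<Rightarrow> 'a \<Rightarrow> real" where
  "window_value m \<xi> \<kappa> j \<omega> = (if 1 \<le> j \<and> j \<le> m then \<xi> (j - 1) \<omega> else 0) - \<kappa> \<omega>"

text \<open>One summation identity serves two purposes: \<open>\<phi>\<close> is a Brownian path to identify the stochastic
integral, and \<open>\<phi> = (\<lambda>v. of_bool (u \<le> v))\<close> to identify the value of the process at time \<open>u\<close>.\<close>

lemma window_sum:
  fixes \<phi> :: "real \<Rightarrow> real"
  assumes "s \<le> t"
  shows "(\<Sum>j<Suc (Suc m). window_value m \<xi> \<kappa> j \<omega> * (\<phi> (window_grid m \<tau> s t (Suc j)) - \<phi> (window_grid m \<tau> s t j)))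
    = (\<Sum>i<m. \<xi> i \<omega> * (\<phi> (min t (\<tau> (Suc i))) - \<phi> (min t (\<tau> i))))
    - (\<Sum>i<m. \<xi> i \<omega> * (\<phi> (min s (\<tau> (Suc i))) - \<phi> (min s (\<tau> i)))) - \<kappa> \<omega> * (\<phi> t - \<phi> s)"
proof -
  let ?g = "window_grid m \<tau> s t"
  have clamp: "\<phi> (max s (min t (\<tau> i))) = \<phi> (min t (\<tau> i)) - \<phi> (min s (\<tau> i)) + \<phi> s" for i
    using assms by (auto simp: max_def min_def)
  have "(\<Sum>j<Suc (Suc m). window_value m \<xi> \<kappa> j \<omega> * (\<phi> (?g (Suc j)) - \<phi> (?g j)))
     = (\<Sum>j<Suc (Suc m). (window_value m \<xi> \<kappa> j \<omega> + \<kappa> \<omega>) * (\<phi> (?g (Suc j)) - \<phi> (?g j)))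
       - \<kappa> \<omega> * (\<Sum>j<Suc (Suc m). \<phi> (?g (Suc j)) - \<phi> (?g j))"
    by (simp only: sum_distrib_left sum_subtractf[symmetric]) (simp add: algebra_simps)
  also have "(\<Sum>j<Suc (Suc m). \<phi> (?g (Suc j)) - \<phi> (?g j)) = \<phi> t - \<phi> s"
    by (subst sum_lessThan_telescope) (simp add: window_grid_def)
  also have "(\<Sum>j<Suc (Suc m). (window_value m \<xi> \<kappa> j \<omega> + \<kappa> \<omega>) * (\<phi> (?g (Suc j)) - \<phi> (?g j)))
     = (\<Sum>i<m. \<xi> i \<omega> * (\<phi> (max s (min t (\<tau> (Suc i)))) - \<phi> (max s (min t (\<tau> i)))))"
    by (subst sum.lessThan_Suc_shift) (simp add: window_value_def window_grid_def)
  also have "\<dots> = (\<Sum>i<m. \<xi> i \<omega> * (\<phi> (min t (\<tau> (Suc i))) - \<phi> (min t (\<tau> i))))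
    - (\<Sum>i<m. \<xi> i \<omega> * (\<phi> (min s (\<tau> (Suc i))) - \<phi> (min s (\<tau> i))))"
    unfolding clamp sum_subtractf[symmetric] by (intro sum.cong) (auto simp: algebra_simps)
  finally show ?thesis .
qed

lemma window_grid_mono:
  assumes "s \<le> t" "\<And>i. i < m \<Longrightarrow> \<tau> i \<le> \<tau> (Suc i)" "j < Suc (Suc m)"
  shows "window_grid m \<tau> s t j \<le> window_grid m \<tau> s t (Suc j)"
proof -
  consider "j = 0" | i where "j = Suc i" "i < m" | "j = Suc m" using assms(3) by (cases j) fastforce+
  then show ?thesis
  proof cases
    case (2 i)
    then show ?thesis using assms(1) assms(2)[of i] by (auto simp: window_grid_def min_def max_def)
  qed (use assms(1) in \<open>auto simp: window_grid_def\<close>)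
qed

lemma window_grid_range: "s \<le> t \<Longrightarrow> s \<le> window_grid m \<tau> s t j \<and> window_grid m \<tau> s t j \<le> t"
  by (auto simp: window_grid_def)

lemma window_square_integral:
  assumes st: "s \<le> t" and mono: "\<And>i. i < m \<Longrightarrow> \<tau> i \<le> \<tau> (Suc i)"
  shows "(\<integral>\<^sup>+u\<in>{s..t}. ennreal ((simple_value m \<tau> \<xi> u \<omega> - \<kappa> \<omega>)\<^sup>2) \<partial>lborel)
     = ennreal (\<Sum>j<Suc (Suc m). (window_value m \<xi> \<kappa> j \<omega>)\<^sup>2 * (window_grid m \<tau> s t (Suc j) - window_grid m \<tau> s t j))"
proof -
  let ?g = "window_grid m \<tau> s t" and ?v = "\<lambda>j. window_value m \<xi> \<kappa> j \<omega>"
  have gm: "?g j \<le> ?g (Suc j)" if "j < Suc (Suc m)" for j by (rule window_grid_mono[of s t m \<tau> j, OF st mono that])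
  have ind: "indicator {a<..b} u = (of_bool (u \<le> b) - of_bool (u \<le> a) :: real)" if "a \<le> b" for a b u :: real
    using that by (auto simp: indicator_def)
  have pt: "ennreal ((simple_value m \<tau> \<xi> u \<omega> - \<kappa> \<omega>)\<^sup>2) * indicator {s..t} u
      = (\<Sum>j<Suc (Suc m). ennreal ((?v j)\<^sup>2) * indicator {?g j<..?g (Suc j)} u)" if "u \<noteq> s" for u
  proof (cases "u \<in> {s..t}")
    case True
    with that have u: "s < u" "u \<le> t" by auto
    have "(\<Sum>j<Suc (Suc m). ?v j * indicator {?g j<..?g (Suc j)} u)
      = (\<Sum>j<Suc (Suc m). ?v j * (of_bool (u \<le> ?g (Suc j)) - of_bool (u \<le> ?g j)))"
      by (intro sum.cong refl) (simp only: ind[OF gm] lessThan_iff)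
    also have "\<dots> = simple_value m \<tau> \<xi> u \<omega> - \<kappa> \<omega>"
      unfolding window_sum[OF st, of m \<xi> \<kappa> \<omega> "\<lambda>x. of_bool (u \<le> x)" \<tau>] simple_value_def
      using u by (auto simp: ind[OF mono] intro!: sum.cong)
    finally have "(simple_value m \<tau> \<xi> u \<omega> - \<kappa> \<omega>)\<^sup>2 = (\<Sum>j<Suc (Suc m). (?v j)\<^sup>2 * indicator {?g j<..?g (Suc j)} u)"
      using disjoint_indicator_sum_square[of "Suc (Suc m)" ?g ?v u, OF gm] by metis
    then have "ennreal ((simple_value m \<tau> \<xi> u \<omega> - \<kappa> \<omega>)\<^sup>2)
       = (\<Sum>j<Suc (Suc m). ennreal ((?v j)\<^sup>2 * indicator {?g j<..?g (Suc j)} u))"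
      by (simp only:) (rule sum_ennreal[symmetric], simp)
    then show ?thesis using True by (simp add: ennreal_mult'' ennreal_indicator del: sum.lessThan_Suc)
  next
    case False
    then have "u \<notin> {?g j<..?g (Suc j)}" for j
      using window_grid_range[OF st, of m \<tau> j] window_grid_range[OF st, of m \<tau> "Suc j"] by auto
    then show ?thesis using False by (simp del: sum.lessThan_Suc)
  qed
  have "(\<integral>\<^sup>+u\<in>{s..t}. ennreal ((simple_value m \<tau> \<xi> u \<omega> - \<kappa> \<omega>)\<^sup>2) \<partial>lborel)
     = (\<integral>\<^sup>+u. (\<Sum>j<Suc (Suc m). ennreal ((?v j)\<^sup>2) * indicator {?g j<..?g (Suc j)} u) \<partial>lborel)"
    using AE_lborel_singleton[of s] by (intro nn_integral_cong_AE, eventually_elim) (rule pt)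
  also have "\<dots> = (\<Sum>j<Suc (Suc m). ennreal ((?v j)\<^sup>2) * ennreal (?g (Suc j) - ?g j))"
    using gm by (subst nn_integral_sum) (auto simp: nn_integral_cmult_indicator simp del: sum.lessThan_Suc)
  also have "\<dots> = (\<Sum>j<Suc (Suc m). ennreal ((?v j)\<^sup>2 * (?g (Suc j) - ?g j)))"
    using gm by (intro sum.cong) (auto simp: ennreal_mult)
  also have "\<dots> = ennreal (\<Sum>j<Suc (Suc m). (?v j)\<^sup>2 * (?g (Suc j) - ?g j))"
    using gm by (intro sum_ennreal) auto
  finally show ?thesis .
qed

lemma simple_value_measurable_time [measurable]: "(\<lambda>u. simple_value m \<tau> \<xi> u \<omega>) \<in> borel_measurable borel"
  unfolding simple_value_def by measurable

context brownian_basis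
begin

lemma simple_killed_isometry:
  assumes simple: "simple_process F m \<tau> \<xi>" and st: "0 \<le> s" "s < t" and \<kappa>: "\<kappa> \<in> borel_measurable (F s)"
    and c: "0 \<le> c"
  defines "q \<equiv> \<lambda>\<omega>. \<integral>\<^sup>+u\<in>{s..t}. ennreal ((simple_value m \<tau> \<xi> u \<omega> - \<kappa> \<omega>)\<^sup>2) \<partial>lborel"
    and "Z \<equiv> \<lambda>\<omega>. simple_integral B m \<tau> \<xi> t \<omega> - simple_integral B m \<tau> \<xi> s \<omega> - \<kappa> \<omega> * (B t \<omega> - B s \<omega>)"
  shows "q \<in> borel_measurable M" "Z \<in> borel_measurable M"
    "(\<integral>\<^sup>+\<omega>. ennreal ((Z \<omega>)\<^sup>2) * indicator {\<omega>. q \<omega> \<le> ennreal c} \<omega> \<partial>M) \<le> (\<integral>\<^sup>+\<omega>. min (q \<omega>) (ennreal c) \<partial>M)"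
proof -
  let ?g = "window_grid m \<tau> s t" and ?v = "window_value m \<xi> \<kappa>" and ?n = "Suc (Suc m)"
  have mono: "\<tau> i \<le> \<tau> (Suc i)" if "i < m" for i using simple that by (auto simp: simple_process_def)
  have tau0: "0 \<le> \<tau> i" if "i \<le> m" for i
    using that by (induction i) (use simple in \<open>auto simp: simple_process_def intro: order_trans\<close>)
  have \<xi>: "\<xi> i \<in> borel_measurable (F (\<tau> i))" if "i < m" for i using simple that by (auto simp: simple_process_def)
  have gm: "?g j \<le> ?g (Suc j)" if "j < ?n" for j by (rule window_grid_mono[of s t m \<tau> j, OF less_imp_le[OF st(2)] mono that])
  have g0: "0 \<le> ?g j" for j using window_grid_range[of s t m \<tau> j] st by simp
  have vmeas: "?v j \<in> borel_measurable (F (?g j))" if "j < ?n" "?g j < ?g (Suc j)" for j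
  proof -
    have k: "\<kappa> \<in> borel_measurable (F (?g j))"
      using window_grid_range[of s t m \<tau> j] st by (intro F_measurable_mono[OF \<kappa>]) auto
    show ?thesis
    proof (cases "1 \<le> j \<and> j \<le> m")
      case True
      then obtain i where i: "j = Suc i" "i < m" by (cases j) auto
      then have "\<tau> i \<le> ?g j" using that by (auto simp: window_grid_def max_def min_def split: if_splits)
      then have "\<xi> i \<in> borel_measurable (F (?g j))" using i tau0 by (intro F_measurable_mono[OF \<xi>]) auto
      then show ?thesis unfolding window_value_def using i k by (intro borel_measurable_diff) auto
    next
      case False
      then have "?v j = (\<lambda>\<omega>. - \<kappa> \<omega>)" by (auto simp: window_value_def)
      then show ?thesis using k by simp
    qed
  qed
  define qr where "qr \<omega> = (\<Sum>j<?n. (?v j \<omega>)\<^sup>2 * (?g (Suc j) - ?g j))" for \<omega>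
  have q: "q = (\<lambda>\<omega>. ennreal (qr \<omega>))"
    unfolding q_def qr_def by (intro ext window_square_integral less_imp_le[OF st(2)] mono)
  have qr0: "0 \<le> qr \<omega>" for \<omega> unfolding qr_def using gm by (intro sum_nonneg) auto
  have Z: "Z \<omega> = (\<Sum>j<?n. ?v j \<omega> * (B (?g (Suc j)) \<omega> - B (?g j) \<omega>))" for \<omega>
    unfolding Z_def simple_integral_def
    using window_sum[OF less_imp_le[OF st(2)], of m \<xi> \<kappa> \<omega> "\<lambda>x. B x \<omega>" \<tau>] by simp
  have term_meas: "(\<lambda>\<omega>. f (?v j \<omega>) * (h (Suc j) \<omega> - h j \<omega>)) \<in> borel_measurable M"
    if "j < ?n" "f \<in> borel_measurable borel" "\<And>j. h j \<in> borel_measurable M" "?g j = ?g (Suc j) \<Longrightarrow> h j = h (Suc j)"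
    for f :: "real \<Rightarrow> real" and h j
  proof (cases "?g j = ?g (Suc j)")
    case False
    then have [measurable]: "?v j \<in> borel_measurable M"
      using F_measurable_M[OF vmeas g0] gm[OF that(1)] that(1) by simp
    show ?thesis using that(2,3) by measurable
  qed (use that in simp)
  have "qr \<in> borel_measurable M"
    unfolding qr_def by (intro borel_measurable_sum term_meas[of _ "\<lambda>x. x\<^sup>2" "\<lambda>j _. ?g j"]) auto
  then show "q \<in> borel_measurable M" unfolding q by measurable
  show "Z \<in> borel_measurable M"
    unfolding Z by (intro borel_measurable_sum term_meas[of _ "\<lambda>x. x" "\<lambda>j. B (?g j)"]) (auto intro: B_measurable g0)
  have "(\<integral>\<^sup>+\<omega>. ennreal ((Z \<omega>)\<^sup>2) * indicator {\<omega>. qr \<omega> \<le> c} \<omega> \<partial>M) \<le> (\<integral>\<^sup>+\<omega>. ennreal (min (qr \<omega>) c) \<partial>M)"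
    unfolding Z qr_def by (intro killed_isometry g0 gm vmeas c)
  then show "(\<integral>\<^sup>+\<omega>. ennreal ((Z \<omega>)\<^sup>2) * indicator {\<omega>. q \<omega> \<le> ennreal c} \<omega> \<partial>M) \<le> (\<integral>\<^sup>+\<omega>. min (q \<omega>) (ennreal c) \<partial>M)"
    unfolding q using c qr0 by (simp add: min_def if_distrib[of ennreal] cong: if_cong)
qed

end

section \<open>From simple processes to Ito integrals\<close>

lemma square_add_le_weighted:
  fixes x y \<gamma> :: real
  assumes "0 < \<gamma>"
  shows "(x + y)\<^sup>2 \<le> (1 + \<gamma>) * x\<^sup>2 + (1 + 1 / \<gamma>) * y\<^sup>2"
proof -
  have "0 \<le> \<gamma> * (x - y / \<gamma>)\<^sup>2" using assms by simp
  also have "\<dots> = \<gamma> * x\<^sup>2 - 2 * x * y + y\<^sup>2 / \<gamma>" using assms by (simp add: field_simps power2_eq_square)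
  finally show ?thesis by (simp add: algebra_simps power2_eq_square)
qed

lemma nn_integral_square_le_weighted:
  fixes f g h :: "real \<Rightarrow> real"
  assumes [measurable]: "f \<in> borel_measurable borel" "g \<in> borel_measurable borel" "h \<in> borel_measurable borel"
    and l: "0 < \<gamma>" and "A \<in> sets borel"
  shows "(\<integral>\<^sup>+u\<in>A. ennreal ((f u - h u)\<^sup>2) \<partial>lborel) \<le>
    ennreal (1 + \<gamma>) * (\<integral>\<^sup>+u\<in>A. ennreal ((g u - h u)\<^sup>2) \<partial>lborel)
    + ennreal (1 + 1 / \<gamma>) * (\<integral>\<^sup>+u\<in>A. ennreal ((f u - g u)\<^sup>2) \<partial>lborel)"
proof -
  have [measurable]: "A \<in> sets lborel" using assms by simp
  have "ennreal ((f u - h u)\<^sup>2) \<le> ennreal (1 + \<gamma>) * ennreal ((g u - h u)\<^sup>2) + ennreal (1 + 1 / \<gamma>) * ennreal ((f u - g u)\<^sup>2)" for u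
    using l square_add_le_weighted[OF l, of "g u - h u" "f u - g u"]
    by (simp add: ennreal_leI flip: ennreal_mult ennreal_plus)
  then have "(\<integral>\<^sup>+u\<in>A. ennreal ((f u - h u)\<^sup>2) \<partial>lborel) \<le>
     (\<integral>\<^sup>+u. ennreal (1 + \<gamma>) * (ennreal ((g u - h u)\<^sup>2) * indicator A u) + ennreal (1 + 1 / \<gamma>) * (ennreal ((f u - g u)\<^sup>2) * indicator A u) \<partial>lborel)"
    by (intro nn_integral_mono) (auto split: split_indicator)
  also have "\<dots> = ennreal (1 + \<gamma>) * (\<integral>\<^sup>+u\<in>A. ennreal ((g u - h u)\<^sup>2) \<partial>lborel)
    + ennreal (1 + 1 / \<gamma>) * (\<integral>\<^sup>+u\<in>A. ennreal ((f u - g u)\<^sup>2) \<partial>lborel)"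
    by (subst nn_integral_add) (auto simp: nn_integral_cmult)
  finally show ?thesis .
qed

text \<open>Only this upper half of the continuity of \<open>L\<^sup>2\<close> norms enters the passage to the limit. The weight \<open>\<gamma>\<close>
in \<open>(x + y)\<^sup>2 \<le> (1 + \<gamma>) x\<^sup>2 + (1 + 1 / \<gamma>) y\<^sup>2\<close> is chosen small relative to the limit.\<close>

lemma eventually_square_integral_le:
  fixes f :: "nat \<Rightarrow> real \<Rightarrow> real" and g h :: "real \<Rightarrow> real"
  assumes [measurable]: "\<And>k. f k \<in> borel_measurable borel" "g \<in> borel_measurable borel" "h \<in> borel_measurable borel"
    and A: "A \<in> sets borel"
    and lim: "(\<lambda>k. \<integral>\<^sup>+u\<in>A. ennreal ((f k u - g u)\<^sup>2) \<partial>lborel) \<longlonglongrightarrow> 0"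
    and fin: "(\<integral>\<^sup>+u\<in>A. ennreal ((g u - h u)\<^sup>2) \<partial>lborel) < \<infinity>" and e: "0 < \<epsilon>"
  shows "eventually (\<lambda>k. (\<integral>\<^sup>+u\<in>A. ennreal ((f k u - h u)\<^sup>2) \<partial>lborel) \<le>
    (\<integral>\<^sup>+u\<in>A. ennreal ((g u - h u)\<^sup>2) \<partial>lborel) + ennreal \<epsilon>) sequentially"
proof -
  obtain a where a: "0 \<le> a" "(\<integral>\<^sup>+u\<in>A. ennreal ((g u - h u)\<^sup>2) \<partial>lborel) = ennreal a"
    using fin by (auto simp: less_top_ennreal)
  define \<gamma> where "\<gamma> = \<epsilon> / (2 * (a + 1))"
  have l: "0 < \<gamma>" using a e by (simp add: \<gamma>_def)
  have la: "\<gamma> * a \<le> \<epsilon> / 2" using a e by (simp add: \<gamma>_def field_simps)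
  define w where "w = 1 + 1 / \<gamma>"
  define \<eta> where "\<eta> = \<epsilon> / 2 / w"
  have "0 < w" using l by (simp add: w_def add_pos_pos)
  then have eta: "0 < \<eta>" "(1 + 1 / \<gamma>) * \<eta> = \<epsilon> / 2"
    unfolding \<eta>_def w_def[symmetric] using e by auto
  have "eventually (\<lambda>k. (\<integral>\<^sup>+u\<in>A. ennreal ((f k u - g u)\<^sup>2) \<partial>lborel) < ennreal \<eta>) sequentially"
    using lim eta by (intro order_tendstoD) auto
  then show ?thesis
  proof eventually_elim
    case (elim k)
    have "(\<integral>\<^sup>+u\<in>A. ennreal ((f k u - h u)\<^sup>2) \<partial>lborel) \<le> ennreal (1 + \<gamma>) * ennreal a
       + ennreal (1 + 1 / \<gamma>) * (\<integral>\<^sup>+u\<in>A. ennreal ((f k u - g u)\<^sup>2) \<partial>lborel)"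
      unfolding a(2)[symmetric] by (intro nn_integral_square_le_weighted l A) measurable
    also have "\<dots> \<le> ennreal (1 + \<gamma>) * ennreal a + ennreal (1 + 1 / \<gamma>) * ennreal \<eta>"
      using elim by (intro add_mono mult_left_mono) auto
    also have "\<dots> = ennreal ((1 + \<gamma>) * a + (1 + 1 / \<gamma>) * \<eta>)"
      using l a eta(1) by (simp flip: ennreal_mult ennreal_plus)
    also have "\<dots> \<le> ennreal (a + \<epsilon>)"
      using la eta(2) e by (intro ennreal_leI) (auto simp: algebra_simps)
    also have "\<dots> = ennreal a + ennreal \<epsilon>" using a e by simp
    finally show ?case using a by simp
  qed
qed

context brownian_basis
begin

text \<open>Along an almost surely convergent subsequence Fatou's lemma applies on the left and its reverse,
with the integrable bound \<open>c\<close>, on the right. The strict inequality \<open>a < c\<close> on the left is what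
guarantees that the approximations eventually satisfy \<open>q \<le> c\<close>. \<open>H'\<close> and \<open>J\<close> stand in for \<open>H\<close> and \<open>I t - I s\<close>, which
convergence in outer measure does not force to be measurable.\<close>

lemma ito_killed_inequality:
  assumes ito: "has_ito_integral M F B H I" and st: "0 \<le> s" "s < t"
    and \<kappa>: "\<kappa> \<in> borel_measurable (F s)" and c: "0 \<le> c"
    and H'[measurable]: "(\<lambda>(u, \<omega>). H' u \<omega>) \<in> borel_measurable (borel \<Otimes>\<^sub>M M)"
    and HH': "AE \<omega> in M. \<forall>u\<ge>0. H u \<omega> = H' u \<omega>"
    and J[measurable]: "J \<in> borel_measurable M" and JI: "AE \<omega> in M. J \<omega> = I t \<omega> - I s \<omega>"
  defines "a \<equiv> \<lambda>\<omega>. \<integral>\<^sup>+u\<in>{s..t}. ennreal ((H' u \<omega> - \<kappa> \<omega>)\<^sup>2) \<partial>lborel"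
  shows "(\<integral>\<^sup>+\<omega>. ennreal ((J \<omega> - \<kappa> \<omega> * (B t \<omega> - B s \<omega>))\<^sup>2) * indicator {\<omega>. a \<omega> < ennreal c} \<omega> \<partial>M)
    \<le> (\<integral>\<^sup>+\<omega>. min (a \<omega>) (ennreal c) \<partial>M)"
proof -
  obtain m \<tau> \<xi> where simple: "\<And>n. simple_process F (m n) (\<tau> n) (\<xi> n)"
    and conv: "\<And>t. 0 \<le> t \<Longrightarrow> null_in_probability M (\<lambda>n \<omega>.
            \<integral>\<^sup>+s\<in>{0..t}. ennreal ((simple_value (m n) (\<tau> n) (\<xi> n) s \<omega> - H s \<omega>)\<^sup>2) \<partial>lborel)"
       "\<And>t. 0 \<le> t \<Longrightarrow> null_in_probability M (\<lambda>n \<omega>.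
            ennreal \<bar>simple_integral B (m n) (\<tau> n) (\<xi> n) t \<omega> - I t \<omega>\<bar>)"
    using ito unfolding has_ito_integral_def by blast
  let ?S = "\<lambda>n. simple_value (m n) (\<tau> n) (\<xi> n)" and ?SI = "\<lambda>n. simple_integral B (m n) (\<tau> n) (\<xi> n)"
  have t: "0 \<le> t" using st by simp
  obtain r where "AE \<omega> in M. (\<lambda>k. (\<integral>\<^sup>+u\<in>{0..t}. ennreal ((?S (r k) u \<omega> - H u \<omega>)\<^sup>2) \<partial>lborel)
     + (ennreal \<bar>?SI (r k) t \<omega> - I t \<omega>\<bar> + ennreal \<bar>?SI (r k) s \<omega> - I s \<omega>\<bar>)) \<longlonglongrightarrow> 0"
    using null_in_probability_AE_subsequence[OF null_in_probability_add[OF conv(1)[OF t]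
          null_in_probability_add[OF conv(2)[OF t] conv(2)[OF st(1)]]]] by blast
  then have conv_AE: "AE \<omega> in M. (\<lambda>k. \<integral>\<^sup>+u\<in>{s..t}. ennreal ((?S (r k) u \<omega> - H' u \<omega>)\<^sup>2) \<partial>lborel) \<longlonglongrightarrow> 0 \<and>
     (\<lambda>k. ?SI (r k) t \<omega>) \<longlonglongrightarrow> I t \<omega> \<and> (\<lambda>k. ?SI (r k) s \<omega>) \<longlonglongrightarrow> I s \<omega>"
    using HH'
  proof eventually_elim
    case (elim \<omega>)
    have to0: "f \<longlonglongrightarrow> 0" if "\<And>k. f k \<le> (\<integral>\<^sup>+u\<in>{0..t}. ennreal ((?S (r k) u \<omega> - H u \<omega>)\<^sup>2) \<partial>lborel)
     + (ennreal \<bar>?SI (r k) t \<omega> - I t \<omega>\<bar> + ennreal \<bar>?SI (r k) s \<omega> - I s \<omega>\<bar>)" for f :: "nat \<Rightarrow> ennreal"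
      by (rule tendsto_sandwich[OF always_eventually[OF allI[OF zero_le]] always_eventually tendsto_const elim(1)])
        (use that in simp)
    have abs0: "f \<longlonglongrightarrow> l" if "(\<lambda>k. ennreal \<bar>f k - l\<bar>) \<longlonglongrightarrow> 0" for f :: "nat \<Rightarrow> real" and l
    proof -
      have "(\<lambda>k. ennreal \<bar>f k - l\<bar>) \<longlonglongrightarrow> ennreal 0" using that by simp
      then have "(\<lambda>k. \<bar>f k - l\<bar>) \<longlonglongrightarrow> 0" by (rule tendsto_ennrealD) auto
      then show ?thesis using LIM_zero_cancel tendsto_rabs_zero_iff by blast
    qed
    have "(\<integral>\<^sup>+u\<in>{s..t}. ennreal ((?S (r k) u \<omega> - H' u \<omega>)\<^sup>2) \<partial>lborel)
      \<le> (\<integral>\<^sup>+u\<in>{0..t}. ennreal ((?S (r k) u \<omega> - H u \<omega>)\<^sup>2) \<partial>lborel)" for k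
      using elim(2) st by (intro nn_integral_mono) (auto split: split_indicator)
    then show ?case
      by (intro conjI to0 abs0) (auto intro: add_increasing add_increasing2)
  qed
  define q where "q k \<omega> = (\<integral>\<^sup>+u\<in>{s..t}. ennreal ((?S (r k) u \<omega> - \<kappa> \<omega>)\<^sup>2) \<partial>lborel)" for k \<omega>
  define Z where "Z k \<omega> = ?SI (r k) t \<omega> - ?SI (r k) s \<omega> - \<kappa> \<omega> * (B t \<omega> - B s \<omega>)" for k \<omega>
  define Y where "Y \<omega> = J \<omega> - \<kappa> \<omega> * (B t \<omega> - B s \<omega>)" for \<omega>
  note ski = simple_killed_isometry[OF simple st \<kappa> c]
  have [measurable]: "q k \<in> borel_measurable M" "Z k \<in> borel_measurable M" for k
    unfolding q_def Z_def by (rule ski)+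
  have le: "(\<integral>\<^sup>+\<omega>. ennreal ((Z k \<omega>)\<^sup>2) * indicator {\<omega>. q k \<omega> \<le> ennreal c} \<omega> \<partial>M) \<le> (\<integral>\<^sup>+\<omega>. min (q k \<omega>) (ennreal c) \<partial>M)" for k
    unfolding q_def Z_def by (rule ski(3))
  have ind_meas[measurable]: "(\<lambda>\<omega>. ennreal ((Z k \<omega>)\<^sup>2) * indicator {\<omega>. q k \<omega> \<le> ennreal c} \<omega>) \<in> borel_measurable M" for k
    unfolding indicator_def by measurable
  have lim: "AE \<omega> in M. ennreal ((Y \<omega>)\<^sup>2) * indicator {\<omega>. a \<omega> < ennreal c} \<omega>
      \<le> liminf (\<lambda>k. ennreal ((Z k \<omega>)\<^sup>2) * indicator {\<omega>. q k \<omega> \<le> ennreal c} \<omega>) \<and>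
      limsup (\<lambda>k. min (q k \<omega>) (ennreal c)) \<le> min (a \<omega>) (ennreal c)"
    using conv_AE JI AE_space
  proof eventually_elim
    case (elim \<omega>)
    have [measurable]: "(\<lambda>u. H' u \<omega>) \<in> borel_measurable borel"
      using measurable_Pair1[OF H' elim(3)] by simp
    have ev: "eventually (\<lambda>k. q k \<omega> \<le> a \<omega> + ennreal \<epsilon>) sequentially" if "a \<omega> < \<infinity>" "0 < \<epsilon>" for \<epsilon>
      unfolding q_def a_def using elim(1) that by (intro eventually_square_integral_le) (auto simp: a_def)
    have "ennreal ((Y \<omega>)\<^sup>2) \<le> liminf (\<lambda>k. ennreal ((Z k \<omega>)\<^sup>2) * indicator {\<omega>. q k \<omega> \<le> ennreal c} \<omega>)" if ac: "a \<omega> < ennreal c"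
    proof -
      obtain a' where a': "0 \<le> a'" "a \<omega> = ennreal a'" using ac by (cases "a \<omega>") auto
      with ac have "a' < c" by (simp add: ennreal_less_iff)
      with ev[of "c - a'"] a' have "eventually (\<lambda>k. q k \<omega> \<le> ennreal c) sequentially"
        by (simp flip: ennreal_plus)
      then have e: "eventually (\<lambda>k. ennreal ((Z k \<omega>)\<^sup>2) = ennreal ((Z k \<omega>)\<^sup>2) * indicator {\<omega>. q k \<omega> \<le> ennreal c} \<omega>) sequentially"
        by eventually_elim simp
      have "(\<lambda>k. ennreal ((Z k \<omega>)\<^sup>2)) \<longlonglongrightarrow> ennreal ((Y \<omega>)\<^sup>2)"
        unfolding Z_def Y_def elim(2) using elim(1) by (intro tendsto_intros) auto
      then have "(\<lambda>k. ennreal ((Z k \<omega>)\<^sup>2) * indicator {\<omega>. q k \<omega> \<le> ennreal c} \<omega>) \<longlonglongrightarrow> ennreal ((Y \<omega>)\<^sup>2)"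
        by (rule Lim_transform_eventually[OF _ e])
      from lim_imp_Liminf[OF sequentially_bot this] show ?thesis by (rule eq_refl[OF sym])
    qed
    moreover have "limsup (\<lambda>k. min (q k \<omega>) (ennreal c)) \<le> min (a \<omega>) (ennreal c)"
    proof (rule ennreal_le_epsilon)
      fix e :: real assume e: "0 < e"
      show "limsup (\<lambda>k. min (q k \<omega>) (ennreal c)) \<le> min (a \<omega>) (ennreal c) + ennreal e"
      proof (cases "a \<omega> < \<infinity>")
        case True
        show ?thesis
        proof (rule Limsup_bounded)
          show "eventually (\<lambda>k. min (q k \<omega>) (ennreal c) \<le> min (a \<omega>) (ennreal c) + ennreal e) sequentially"
            using ev[OF True e]
          proof eventually_elim
            fix k assume elim: "q k \<omega> \<le> a \<omega> + ennreal e"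
            show "min (q k \<omega>) (ennreal c) \<le> min (a \<omega>) (ennreal c) + ennreal e"
            proof (cases "a \<omega> \<le> ennreal c")
              case True
              then have a: "min (a \<omega>) (ennreal c) = a \<omega>" by (rule min_absorb1)
              show ?thesis unfolding a using elim by (rule min.coboundedI1)
            next
              case False
              then have a: "min (a \<omega>) (ennreal c) = ennreal c" by (intro min_absorb2) simp
              show ?thesis unfolding a by (intro min.coboundedI2 add_increasing2) simp_all
            qed
          qed
        qed
      next
        case False
        then have "a \<omega> = \<infinity>" by (simp add: less_top[symmetric])
        then show ?thesis by (intro Limsup_bounded always_eventually allI) (auto simp: min_def intro: add_increasing2)
      qed
    qed
    ultimately show ?case by (auto simp: indicator_def)
  qed
  have "(\<integral>\<^sup>+\<omega>. ennreal ((Y \<omega>)\<^sup>2) * indicator {\<omega>. a \<omega> < ennreal c} \<omega> \<partial>M)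
     \<le> (\<integral>\<^sup>+\<omega>. liminf (\<lambda>k. ennreal ((Z k \<omega>)\<^sup>2) * indicator {\<omega>. q k \<omega> \<le> ennreal c} \<omega>) \<partial>M)"
    using lim by (intro nn_integral_mono_AE) auto
  also have "\<dots> \<le> liminf (\<lambda>k. \<integral>\<^sup>+\<omega>. ennreal ((Z k \<omega>)\<^sup>2) * indicator {\<omega>. q k \<omega> \<le> ennreal c} \<omega> \<partial>M)"
    by (rule nn_integral_liminf) measurable
  also have "\<dots> \<le> liminf (\<lambda>k. \<integral>\<^sup>+\<omega>. min (q k \<omega>) (ennreal c) \<partial>M)"
    by (intro Liminf_mono always_eventually allI le)
  also have "\<dots> \<le> limsup (\<lambda>k. \<integral>\<^sup>+\<omega>. min (q k \<omega>) (ennreal c) \<partial>M)"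
    by (intro Liminf_le_Limsup sequentially_bot)
  also have "\<dots> \<le> (\<integral>\<^sup>+\<omega>. limsup (\<lambda>k. min (q k \<omega>) (ennreal c)) \<partial>M)"
    by (rule nn_integral_limsup[where w = "\<lambda>_. ennreal c"]) (auto simp: emeasure_space_1)
  also have "\<dots> \<le> (\<integral>\<^sup>+\<omega>. min (a \<omega>) (ennreal c) \<partial>M)"
    using lim by (intro nn_integral_mono_AE) auto
  finally show ?thesis unfolding Y_def .
qed

end

section \<open>Gronwall estimates and integrals along paths\<close>

lemma nn_integral_exp_le:
  assumes "0 < k" "0 \<le> u"
  shows "(\<integral>\<^sup>+v\<in>{0..u}. ennreal (exp (k * v)) \<partial>lborel) \<le> ennreal (exp (k * u) / k)"
proof -
  have "(\<integral>\<^sup>+v. ennreal (exp (k * v)) * indicator {0..u} v \<partial>lborel) = ennreal (exp (k * u) / k - exp (k * 0) / k)"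
    using assms by (intro nn_integral_FTC_Icc) (auto intro!: derivative_eq_intros)
  then show ?thesis using assms by (auto intro!: ennreal_leI)
qed

text \<open>A bound \<open>K exp (2 C u)\<close> inserted in the integral inequality returns \<open>(A + K / 2) exp (2 C u)\<close>, so iteration
drives \<open>K\<close> down to \<open>2 A\<close>.\<close>

lemma gronwall_nn:
  fixes m :: "real \<Rightarrow> ennreal"
  assumes C: "0 < C" and A: "0 \<le> A" and K: "0 \<le> K"
    and bounded: "\<And>u. 0 \<le> u \<Longrightarrow> u \<le> T \<Longrightarrow> m u \<le> ennreal K"
    and le: "\<And>u. 0 \<le> u \<Longrightarrow> u \<le> T \<Longrightarrow> m u \<le> ennreal A + ennreal C * (\<integral>\<^sup>+v\<in>{0..u}. m v \<partial>lborel)"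
    and u: "0 \<le> u" "u \<le> T"
  shows "m u \<le> ennreal (2 * A * exp (2 * C * u))"
proof -
  have step: "m u \<le> ennreal ((2 * A + K / 2 ^ n) * exp (2 * C * u))" if "0 \<le> u" "u \<le> T" for n u
    using that
  proof (induction n arbitrary: u)
    case 0
    have "K * 1 \<le> (2 * A + K) * exp (2 * C * u)" using A K C 0 by (intro mult_mono) auto
    then show ?case using bounded[OF 0] by (auto intro: order_trans ennreal_leI)
  next
    case (Suc n)
    let ?k = "2 * A + K / 2 ^ n"
    have k: "0 \<le> ?k" using A K by simp
    have IH': "m v \<le> ennreal ?k * ennreal (exp (2 * C * v))" if "0 \<le> v" "v \<le> u" for v
      using Suc.IH[of v] Suc.prems that k by (simp add: ennreal_mult')
    have "(\<integral>\<^sup>+v\<in>{0..u}. m v \<partial>lborel) \<le> (\<integral>\<^sup>+v. ennreal ?k * (ennreal (exp (2 * C * v)) * indicator {0..u} v) \<partial>lborel)"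
      using IH' by (intro nn_integral_mono) (auto split: split_indicator)
    also have "\<dots> = ennreal ?k * (\<integral>\<^sup>+v\<in>{0..u}. ennreal (exp (2 * C * v)) \<partial>lborel)"
      by (intro nn_integral_cmult) measurable
    also have "\<dots> \<le> ennreal ?k * ennreal (exp (2 * C * u) / (2 * C))"
      using C Suc.prems by (intro mult_left_mono nn_integral_exp_le) auto
    also have "\<dots> = ennreal (?k * (exp (2 * C * u) / (2 * C)))"
      by (rule ennreal_mult'[OF k, symmetric])
    finally have "m u \<le> ennreal A + ennreal C * ennreal (?k * (exp (2 * C * u) / (2 * C)))"
      using le[OF Suc.prems] by (meson add_left_mono mult_left_mono order_trans zero_le)
    also have "\<dots> = ennreal (A + ?k / 2 * exp (2 * C * u))"
      using A C k by (simp flip: ennreal_mult ennreal_plus)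
    also have "\<dots> \<le> ennreal (A * exp (2 * C * u) + ?k / 2 * exp (2 * C * u))"
      using A C Suc.prems by (intro ennreal_leI add_right_mono mult_le_cancel_left1[THEN iffD2]) auto
    also have "A * exp (2 * C * u) + ?k / 2 * exp (2 * C * u) = (2 * A + K / 2 ^ Suc n) * exp (2 * C * u)"
      by (simp add: field_simps)
    finally show ?case .
  qed
  have "(\<lambda>n. ennreal ((2 * A + K * (1 / 2) ^ n) * exp (2 * C * u))) \<longlonglongrightarrow> ennreal ((2 * A + K * 0) * exp (2 * C * u))"
    by (intro tendsto_intros LIMSEQ_power_zero) auto
  then have "m u \<le> ennreal ((2 * A + K * 0) * exp (2 * C * u))"
  proof (rule LIMSEQ_le_const, intro exI allI impI)
    show "m u \<le> ennreal ((2 * A + K * (1 / 2) ^ n) * exp (2 * C * u))" for n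
      using step[OF u, of n] by (simp add: power_one_over)
  qed
  then show ?thesis by simp
qed

text \<open>The integral of \<open>f\<close> satisfies an inequality with a constant in place of the forcing term \<open>g\<close>,
to which the preceding lemma applies.\<close>

lemma gronwall_forced:
  fixes f g :: "real \<Rightarrow> ennreal"
  assumes [measurable]: "f \<in> borel_measurable borel" "g \<in> borel_measurable borel"
    and C: "0 < C" and K: "0 \<le> K"
    and bounded: "\<And>u. 0 \<le> u \<Longrightarrow> u \<le> T \<Longrightarrow> f u \<le> ennreal K"
    and le: "\<And>u. 0 \<le> u \<Longrightarrow> u \<le> T \<Longrightarrow> f u \<le> g u + ennreal C * (\<integral>\<^sup>+v\<in>{0..u}. f v \<partial>lborel)"
    and t: "0 \<le> t" "t \<le> T"
  shows "f t \<le> g t + ennreal (2 * C * exp (2 * C * T)) * (\<integral>\<^sup>+v\<in>{0..t}. g v \<partial>lborel)"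
proof (cases "(\<integral>\<^sup>+v\<in>{0..t}. g v \<partial>lborel) = \<infinity>")
  case True
  then show ?thesis using C by (simp add: ennreal_mult_top)
next
  case False
  then obtain A where A: "0 \<le> A" "(\<integral>\<^sup>+v\<in>{0..t}. g v \<partial>lborel) = ennreal A"
    by (cases "\<integral>\<^sup>+v\<in>{0..t}. g v \<partial>lborel") auto
  define \<Phi> where "\<Phi> u = (\<integral>\<^sup>+v\<in>{0..u}. f v \<partial>lborel)" for u
  have [measurable]: "\<Phi> \<in> borel_measurable borel" unfolding \<Phi>_def indicator_def atLeastAtMost_iff by measurable
  have T: "0 \<le> T" using t by simp
  have "\<Phi> t \<le> ennreal (2 * A * exp (2 * C * t))"
  proof (rule gronwall_nn[OF C A(1), of "K * T" t])
    show "0 \<le> K * T" using K T by simp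
    fix u assume u: "0 \<le> u" "u \<le> t"
    have "\<Phi> u \<le> (\<integral>\<^sup>+v. ennreal K * indicator {0..u} v \<partial>lborel)"
      unfolding \<Phi>_def using bounded u t by (intro nn_integral_mono) (auto split: split_indicator)
    also have "\<dots> = ennreal (K * u)" using K u by (simp add: nn_integral_cmult_indicator ennreal_mult)
    also have "\<dots> \<le> ennreal (K * T)" using K u t by (intro ennreal_leI mult_left_mono) auto
    finally show "\<Phi> u \<le> ennreal (K * T)" .
    have "\<Phi> u \<le> (\<integral>\<^sup>+v. g v * indicator {0..u} v + ennreal C * (\<Phi> v * indicator {0..u} v) \<partial>lborel)"
      unfolding \<Phi>_def using le u t by (intro nn_integral_mono) (auto split: split_indicator)
    also have "\<dots> = (\<integral>\<^sup>+v\<in>{0..u}. g v \<partial>lborel) + ennreal C * (\<integral>\<^sup>+v\<in>{0..u}. \<Phi> v \<partial>lborel)"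
      by (subst nn_integral_add) (auto simp: nn_integral_cmult)
    also have "(\<integral>\<^sup>+v\<in>{0..u}. g v \<partial>lborel) \<le> ennreal A"
      unfolding A(2)[symmetric] using u by (intro nn_integral_mono) (auto split: split_indicator)
    finally show "\<Phi> u \<le> ennreal A + ennreal C * (\<integral>\<^sup>+v\<in>{0..u}. \<Phi> v \<partial>lborel)"
      by (simp add: add_right_mono)
  qed (use t in auto)
  also have "\<dots> \<le> ennreal (2 * A * exp (2 * C * T))" using A C t by (intro ennreal_leI mult_left_mono) auto
  finally have "f t \<le> g t + ennreal C * ennreal (2 * A * exp (2 * C * T))"
    using le[OF t] unfolding \<Phi>_def by (meson add_left_mono mult_left_mono order_trans zero_le)
  also have "ennreal C * ennreal (2 * A * exp (2 * C * T)) = ennreal (2 * C * exp (2 * C * T)) * ennreal A"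
    using A C by (simp add: ac_simps flip: ennreal_mult)
  finally show ?thesis by (simp add: A(2))
qed

lemma square_set_integral_le:
  fixes g :: "real \<Rightarrow> real"
  assumes [measurable]: "g \<in> borel_measurable borel" and st: "s \<le> t"
  shows "ennreal ((LINT v:{s..t}|lborel. g v)\<^sup>2) \<le> ennreal (t - s) * (\<integral>\<^sup>+v\<in>{s..t}. ennreal ((g v)\<^sup>2) \<partial>lborel)"
proof -
  let ?f = "\<lambda>v. indicator {s..t} v *\<^sub>R g v"
  have "ennreal \<bar>LINT v:{s..t}|lborel. g v\<bar> \<le> (\<integral>\<^sup>+v. ennreal \<bar>?f v\<bar> \<partial>lborel)"
  proof (cases "integrable lborel ?f")
    case True
    then show ?thesis using integral_norm_bound_ennreal[OF True] by (simp add: set_lebesgue_integral_def)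
  next
    case False
    then show ?thesis by (simp add: set_lebesgue_integral_def not_integrable_integral_eq)
  qed
  also have "\<dots> = (\<integral>\<^sup>+v. indicator {s..t} v * ennreal \<bar>?f v\<bar> \<partial>lborel)"
    by (intro nn_integral_cong) (auto split: split_indicator)
  finally have "(ennreal \<bar>LINT v:{s..t}|lborel. g v\<bar>)\<^sup>2 \<le> (\<integral>\<^sup>+v. indicator {s..t} v * ennreal \<bar>?f v\<bar> \<partial>lborel)\<^sup>2"
    by (intro power_mono) auto
  also have "\<dots> \<le> (\<integral>\<^sup>+v. (indicator {s..t} v)\<^sup>2 \<partial>lborel) * (\<integral>\<^sup>+v. (ennreal \<bar>?f v\<bar>)\<^sup>2 \<partial>lborel)"
    by (rule Cauchy_Schwarz_nn_integral) measurable
  also have "(\<integral>\<^sup>+v. (indicator {s..t} v)\<^sup>2 \<partial>lborel) = (\<integral>\<^sup>+v. indicator {s..t} v \<partial>(lborel :: real measure))"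
    by (intro nn_integral_cong) (auto split: split_indicator)
  also have "\<dots> = ennreal (t - s)" using st by simp
  also have "(\<integral>\<^sup>+v. (ennreal \<bar>?f v\<bar>)\<^sup>2 \<partial>lborel) = (\<integral>\<^sup>+v\<in>{s..t}. ennreal ((g v)\<^sup>2) \<partial>lborel)"
    by (intro nn_integral_cong) (auto split: split_indicator simp: ennreal_power)
  finally show ?thesis by (simp add: ennreal_power)
qed

lemma continuous_nn_integral_Icc:
  fixes f :: "real \<Rightarrow> real"
  assumes "continuous_on UNIV f" "\<And>v. 0 \<le> f v"
  shows "(\<integral>\<^sup>+v\<in>{a..b}. ennreal (f v) \<partial>lborel) = ennreal (integral {a..b} f)"
proof -
  have c: "continuous_on {a..b} f" using assms(1) continuous_on_subset by blast
  have "(\<integral>\<^sup>+v\<in>{a..b}. ennreal (f v) \<partial>lborel) = (\<integral>\<^sup>+v. ennreal (f v * indicator {a..b} v) \<partial>lborel)"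
    using assms(2) by (simp add: nn_integral_set_ennreal)
  also have "\<dots> = ennreal (LINT v:{a..b}|lborel. f v)"
    unfolding set_lebesgue_integral_def using borel_integrable_atLeastAtMost'[OF c] assms(2)
    by (subst nn_integral_eq_integral) (auto simp: set_integrable_def mult.commute)
  also have "\<dots> = ennreal (integral {a..b} f)"
    using set_borel_integral_eq_integral(2)[OF borel_integrable_atLeastAtMost'[OF c]] by simp
  finally show ?thesis .
qed

text \<open>Killing an integral at level \<open>c\<close> loses nothing below that level: either \<open>c\<close> is not reached by time \<open>u\<close>, or the
integral up to the first time at which it is reached is already at least \<open>c\<close>.\<close>

lemma min_le_killed_nn_integral:
  fixes f :: "real \<Rightarrow> real"
  assumes f: "continuous_on UNIV f" "\<And>v. 0 \<le> f v" and c: "0 < c"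
  defines "a \<equiv> \<lambda>u. \<integral>\<^sup>+v\<in>{0..u}. ennreal (f v) \<partial>lborel"
  shows "min (a u) (ennreal c) \<le> (\<integral>\<^sup>+v\<in>{0..u}. ennreal (f v) * indicator {v. a v < ennreal c} v \<partial>lborel)"
proof -
  have a_eq: "a w = (\<integral>\<^sup>+v\<in>{0..w}. ennreal (f v) \<partial>lborel)" for w by (simp add: a_def)
  show ?thesis
  proof (cases "a u < ennreal c")
    case True
    have "a v \<le> a u" if "v \<le> u" for v
      unfolding a_def using that by (intro nn_integral_mono) (auto split: split_indicator)
    then have "a v < ennreal c" if "v \<le> u" for v using True that by (meson le_less_trans)
    then have "a u \<le> (\<integral>\<^sup>+v\<in>{0..u}. ennreal (f v) * indicator {v. a v < ennreal c} v \<partial>lborel)"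
      unfolding a_eq[of u] by (intro nn_integral_mono) (auto split: split_indicator)
    then show ?thesis by (rule min.coboundedI1)
  next
    case False
    define A where "A v = integral {0..v} f" for v
    have a: "a v = ennreal (A v)" for v unfolding a_def A_def by (rule continuous_nn_integral_Icc[OF f])
    have A0: "0 \<le> A v" for v unfolding A_def using f(2) by (intro integral_nonneg) (auto intro: integrable_continuous_interval continuous_on_subset[OF f(1)])
    have u: "0 \<le> u" using False c by (rule_tac ccontr) (simp add: a_def)
    have cont: "continuous_on {0..u} A" unfolding A_def
      by (intro indefinite_integral_continuous_1 integrable_continuous_interval continuous_on_subset[OF f(1)]) auto
    let ?S = "{v \<in> {0..u}. c \<le> A v}"
    have "compact ?S"
      using continuous_closed_preimage[OF cont closed_atLeastAtMost closed_atLeast[of c]]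
      by (intro compact_eq_bounded_closed[THEN iffD2] conjI bounded_subset[OF bounded_closed_interval[of 0 u]])
         (auto simp: vimage_def Int_def conj_commute)
    moreover have "u \<in> ?S" using False u A0 c by (auto simp: a ennreal_less_iff not_less)
    ultimately obtain w where w: "w \<in> ?S" "\<And>v. v \<in> ?S \<Longrightarrow> w \<le> v"
      using compact_attains_inf[of ?S] by blast
    have "ennreal c \<le> a w" using w(1) by (auto simp: a intro: ennreal_leI)
    also have "a w \<le> (\<integral>\<^sup>+v\<in>{0..u}. ennreal (f v) * indicator {v. a v < ennreal c} v \<partial>lborel)"
      unfolding a_eq[of w]
    proof (intro nn_integral_mono_AE)
      show "AE v in lborel. ennreal (f v) * indicator {0..w} v
          \<le> ennreal (f v) * indicator {v. a v < ennreal c} v * indicator {0..u} v"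
        using AE_lborel_singleton[of w]
      proof eventually_elim
        case (elim v)
        show ?case
        proof (cases "v \<in> {0..w}")
          case True
          with elim have "v \<in> {0..u}" "v < w" using w(1) by auto
          then have "A v < c" using w(2)[of v] by force
          then have "a v < ennreal c" using A0 by (simp add: a ennreal_less_iff)
          then show ?thesis using \<open>v \<in> {0..u}\<close> True by simp
        qed simp
      qed
    qed
    finally show ?thesis by (rule min.coboundedI2)
  qed
qed

section \<open>Solutions with continuous paths\<close>

lemma nn_integral_le_of_killed:
  assumes [measurable]: "f \<in> borel_measurable M" "a \<in> borel_measurable M"
    and fin: "\<And>\<omega>. \<omega> \<in> space M \<Longrightarrow> a \<omega> < (\<infinity> :: ennreal)"
    and le: "\<And>n :: nat. (\<integral>\<^sup>+\<omega>. f \<omega> * indicator {\<omega>. a \<omega> < ennreal (real (Suc n))} \<omega> \<partial>M) \<le> C"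
  shows "(\<integral>\<^sup>+\<omega>. f \<omega> \<partial>M) \<le> C"
proof -
  let ?g = "\<lambda>n \<omega>. f \<omega> * indicator {\<omega>. a \<omega> < ennreal (real (Suc n))} \<omega>"
  have [measurable]: "?g n \<in> borel_measurable M" for n unfolding indicator_def by measurable
  have "f \<omega> \<le> liminf (\<lambda>n. ?g n \<omega>)" if "\<omega> \<in> space M" for \<omega>
  proof -
    from fin[OF that] obtain r where r: "0 \<le> r" "a \<omega> = ennreal r" by (cases "a \<omega>") auto
    obtain k where k: "r < real k" using reals_Archimedean2 by blast
    show ?thesis
    proof (rule Liminf_bounded)
      show "eventually (\<lambda>n. f \<omega> \<le> ?g n \<omega>) sequentially"
        using eventually_ge_at_top[of k]
      proof eventually_elim
        case (elim n)
        have "r < real (Suc n)" using elim k by simp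
        then have "a \<omega> < ennreal (real (Suc n))" unfolding r(2) by (intro ennreal_lessI) auto
        then show ?case by (simp del: of_nat_Suc)
      qed
    qed
  qed
  then have "(\<integral>\<^sup>+\<omega>. f \<omega> \<partial>M) \<le> (\<integral>\<^sup>+\<omega>. liminf (\<lambda>n. ?g n \<omega>) \<partial>M)" by (intro nn_integral_mono) auto
  also have "\<dots> \<le> liminf (\<lambda>n. \<integral>\<^sup>+\<omega>. ?g n \<omega> \<partial>M)" by (rule nn_integral_liminf) measurable
  also have "\<dots> \<le> liminf (\<lambda>n :: nat. C)" using le by (intro Liminf_mono always_eventually) auto
  finally show ?thesis by (simp add: Liminf_const)
qed

lemma continuous_on_of_holder:
  fixes \<sigma> :: "real \<Rightarrow> real"
  assumes holder: "\<And>y z. \<bar>\<sigma> y - \<sigma> z\<bar> \<le> L * \<bar>y - z\<bar> powr \<theta>" and \<theta>: "0 < \<theta>"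
  shows "continuous_on UNIV \<sigma>"
  unfolding continuous_on_def
proof (intro ballI)
  fix z :: real
  have "((\<lambda>y. \<bar>y - z\<bar>) \<longlongrightarrow> \<bar>z - z\<bar>) (at z)" by (intro tendsto_intros)
  then have "((\<lambda>y. \<bar>y - z\<bar> powr \<theta>) \<longlongrightarrow> 0) (at z)"
    using \<theta> by (intro tendsto_zero_powrI[OF _ tendsto_const]) auto
  then have "((\<lambda>y. L * \<bar>y - z\<bar> powr \<theta>) \<longlongrightarrow> L * 0) (at z)" by (intro tendsto_mult tendsto_const)
  then have "((\<lambda>y. L * \<bar>y - z\<bar> powr \<theta>) \<longlongrightarrow> 0) (at z)" by simp
  moreover have "eventually (\<lambda>y. norm (\<sigma> y - \<sigma> z) \<le> L * \<bar>y - z\<bar> powr \<theta>) (at z)" using holder by simp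
  ultimately have "((\<lambda>y. \<sigma> y - \<sigma> z) \<longlongrightarrow> 0) (at z)" by (rule Lim_null_comparison[rotated])
  then show "(\<sigma> \<longlongrightarrow> \<sigma> z) (at z)" by (rule LIM_zero_cancel)
qed

text \<open>Paths are approximated by their values at the times \<open>\<lfloor>n u\<rfloor> / n\<close>, so that at each stage only countably
many of the random variables \<open>Y v\<close> are involved.\<close>

lemma continuous_paths_joint_measurable:
  fixes Y :: "real \<Rightarrow> 'a \<Rightarrow> real"
  assumes Y_cont: "\<And>\<omega>. \<omega> \<in> space M \<Longrightarrow> continuous_on UNIV (\<lambda>u. Y u \<omega>)"
    and Y_meas: "\<And>u. Y u \<in> borel_measurable M"
  shows "(\<lambda>(u, \<omega>). Y u \<omega>) \<in> borel_measurable (borel \<Otimes>\<^sub>M M)"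
proof (rule borel_measurable_LIMSEQ_real)
  let ?f = "\<lambda>n (u::real). real_of_int \<lfloor>real (Suc n) * u\<rfloor> / real (Suc n)"
  show "(\<lambda>n. Y (?f n (fst p)) (snd p)) \<longlonglongrightarrow> (case p of (u, \<omega>) \<Rightarrow> Y u \<omega>)" if "p \<in> space (borel \<Otimes>\<^sub>M M)" for p
  proof -
    from that obtain u \<omega> where p: "p = (u, \<omega>)" "\<omega> \<in> space M" by (auto simp: space_pair_measure)
    have "\<bar>?f n u - u\<bar> \<le> 1 / real (Suc n)" for n
    proof -
      have "\<bar>real_of_int \<lfloor>real (Suc n) * u\<rfloor> - real (Suc n) * u\<bar> \<le> 1" by linarith
      then have "\<bar>real_of_int \<lfloor>real (Suc n) * u\<rfloor> - real (Suc n) * u\<bar> / real (Suc n) \<le> 1 / real (Suc n)"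
        by (intro divide_right_mono) auto
      moreover have "?f n u - u = (real_of_int \<lfloor>real (Suc n) * u\<rfloor> - real (Suc n) * u) / real (Suc n)"
        by (simp add: diff_divide_distrib del: of_nat_Suc)
      ultimately show ?thesis by (simp add: abs_divide del: of_nat_Suc)
    qed
    then have "(\<lambda>n. ?f n u - u) \<longlonglongrightarrow> 0"
      by (intro Lim_null_comparison[OF always_eventually LIMSEQ_Suc[OF lim_1_over_n]]) (auto simp del: of_nat_Suc)
    then have "(\<lambda>n. ?f n u) \<longlonglongrightarrow> u" by (rule LIM_zero_cancel)
    moreover have "isCont (\<lambda>u. Y u \<omega>) u" using Y_cont[OF p(2)] by (simp add: continuous_on_eq_continuous_at)
    ultimately show ?thesis using p by (auto intro: isCont_tendsto_compose)
  qed
  fix n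
  have "(\<lambda>p. Y (real_of_int i / real (Suc n)) (snd p)) \<in> borel_measurable (borel \<Otimes>\<^sub>M M)" for i :: int
    using Y_meas by measurable
  then show "(\<lambda>p. Y (?f n (fst p)) (snd p)) \<in> borel_measurable (borel \<Otimes>\<^sub>M M)"
    by (rule measurable_compose_countable[where g = "\<lambda>p. \<lfloor>real (Suc n) * fst p\<rfloor>"]) measurable
qed

text \<open>What is kept of the equation. \<open>Y\<close> is the solution with every path continuous on the whole line, which
may cost adaptedness on a null set; hence the detour through a version \<open>W\<close>. The stochastic integral
is present only through the inequality \<open>energy\<close>, applied to \<open>Y t - Y s\<close> minus the drift.\<close>

locale regular_sde = brownian_basis M F B for M :: "'a measure" and F B +
  fixes Y :: "real \<Rightarrow> 'a \<Rightarrow> real" and \<sigma> b :: "real \<Rightarrow> real" and x \<theta> L D :: real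
  assumes Y_cont: "\<And>\<omega>. \<omega> \<in> space M \<Longrightarrow> continuous_on UNIV (\<lambda>u. Y u \<omega>)"
    and Y_meas: "\<And>u. Y u \<in> borel_measurable M"
    and Y_adapted: "\<And>u. 0 \<le> u \<Longrightarrow> \<exists>W\<in>borel_measurable (F u). AE \<omega> in M. W \<omega> = Y u \<omega>"
    and Y_0: "AE \<omega> in M. Y 0 \<omega> = x"
    and \<theta>: "1 / 2 < \<theta>" "\<theta> \<le> 1"
    and holder: "\<And>y z. \<bar>\<sigma> y - \<sigma> z\<bar> \<le> L * \<bar>y - z\<bar> powr \<theta>" and L: "0 < L"
    and b_meas [measurable]: "b \<in> borel_measurable borel"
    and D: "0 < D"
    and \<sigma>_growth: "\<And>y. (\<sigma> y)\<^sup>2 \<le> D * (1 + y\<^sup>2)" and b_growth: "\<And>y. (b y)\<^sup>2 \<le> D * (1 + y\<^sup>2)"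
    and energy: "\<And>s t \<kappa> c. 0 \<le> s \<Longrightarrow> s < t \<Longrightarrow> \<kappa> \<in> borel_measurable (F s) \<Longrightarrow> 0 \<le> c \<Longrightarrow>
      (\<integral>\<^sup>+\<omega>. ennreal ((Y t \<omega> - Y s \<omega> - (LINT u:{s..t}|lborel. b (Y u \<omega>)) - \<kappa> \<omega> * (B t \<omega> - B s \<omega>))\<^sup>2)
          * indicator {\<omega>. (\<integral>\<^sup>+u\<in>{s..t}. ennreal ((\<sigma> (Y u \<omega>) - \<kappa> \<omega>)\<^sup>2) \<partial>lborel) < ennreal c} \<omega> \<partial>M)
      \<le> (\<integral>\<^sup>+\<omega>. min (\<integral>\<^sup>+u\<in>{s..t}. ennreal ((\<sigma> (Y u \<omega>) - \<kappa> \<omega>)\<^sup>2) \<partial>lborel) (ennreal c) \<partial>M)"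
begin

lemma \<sigma>_cont: "continuous_on UNIV \<sigma>"
  using holder \<theta> by (intro continuous_on_of_holder[of \<sigma> L \<theta>]) auto

lemma \<sigma>_measurable [measurable]: "\<sigma> \<in> borel_measurable borel"
  using \<sigma>_cont by (rule borel_measurable_continuous_onI)

lemma Y_joint_measurable: "(\<lambda>(u, \<omega>). Y u \<omega>) \<in> borel_measurable (borel \<Otimes>\<^sub>M M)"
  by (rule continuous_paths_joint_measurable[OF Y_cont Y_meas])

lemma Y_measurable [measurable (raw)]:
  "f \<in> borel_measurable N \<Longrightarrow> g \<in> measurable N M \<Longrightarrow> (\<lambda>p. Y (f p) (g p)) \<in> borel_measurable N"
  using measurable_compose[OF measurable_Pair Y_joint_measurable, of f N g] by simp

lemma Y_path_measurable: "\<omega> \<in> space M \<Longrightarrow> (\<lambda>u. Y u \<omega>) \<in> borel_measurable borel"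
  using Y_cont by (rule borel_measurable_continuous_onI)

lemma nn_integral_swap:
  fixes f :: "real \<Rightarrow> 'a \<Rightarrow> ennreal"
  assumes [measurable]: "(\<lambda>(u, \<omega>). f u \<omega>) \<in> borel_measurable (borel \<Otimes>\<^sub>M M)"
  shows "(\<integral>\<^sup>+\<omega>. (\<integral>\<^sup>+u. f u \<omega> \<partial>lborel) \<partial>M) = (\<integral>\<^sup>+u. (\<integral>\<^sup>+\<omega>. f u \<omega> \<partial>M) \<partial>lborel)"
proof -
  interpret P: pair_sigma_finite "lborel :: real measure" M by unfold_locales
  show ?thesis using P.Fubini'[of f] by simp
qed

definition drift :: "real \<Rightarrow> real \<Rightarrow> 'a \<Rightarrow> real" where
  "drift s t \<omega> = (LINT u:{s..t}|lborel. b (Y u \<omega>))"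

definition martingale_part :: "real \<Rightarrow> real \<Rightarrow> 'a \<Rightarrow> real" where
  "martingale_part s t \<omega> = Y t \<omega> - Y s \<omega> - drift s t \<omega>"

text \<open>The quadratic variation over \<open>[s, t]\<close> of the martingale part minus \<open>\<kappa> (B - B s)\<close>.\<close>

definition variation :: "real \<Rightarrow> real \<Rightarrow> ('a \<Rightarrow> real) \<Rightarrow> 'a \<Rightarrow> ennreal" where
  "variation s t \<kappa> \<omega> = (\<integral>\<^sup>+u\<in>{s..t}. ennreal ((\<sigma> (Y u \<omega>) - \<kappa> \<omega>)\<^sup>2) \<partial>lborel)"

lemma drift_measurable [measurable (raw)]:
  assumes [measurable]: "f \<in> borel_measurable N" "h \<in> borel_measurable N" "g \<in> measurable N M"
  shows "(\<lambda>p. drift (h p) (f p) (g p)) \<in> borel_measurable N"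
  unfolding drift_def set_lebesgue_integral_def indicator_def atLeastAtMost_iff by measurable

lemma martingale_part_measurable [measurable (raw)]:
  assumes [measurable]: "f \<in> borel_measurable N" "h \<in> borel_measurable N" "g \<in> measurable N M"
  shows "(\<lambda>p. martingale_part (h p) (f p) (g p)) \<in> borel_measurable N"
  unfolding martingale_part_def by measurable

lemma variation_measurable [measurable (raw)]:
  assumes [measurable]: "f \<in> borel_measurable N" "h \<in> borel_measurable N" "g \<in> measurable N M" "\<kappa> \<in> borel_measurable M"
  shows "(\<lambda>p. variation (h p) (f p) \<kappa> (g p)) \<in> borel_measurable N"
  unfolding variation_def indicator_def atLeastAtMost_iff by measurable

lemma variation_finite: "\<omega> \<in> space M \<Longrightarrow> variation s t \<kappa> \<omega> < \<infinity>"
proof -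
  assume w: "\<omega> \<in> space M"
  have "continuous_on UNIV (\<lambda>u. \<sigma> (Y u \<omega>))"
    by (rule continuous_on_compose2[OF \<sigma>_cont Y_cont[OF w]]) auto
  then have "continuous_on UNIV (\<lambda>u. (\<sigma> (Y u \<omega>) - \<kappa> \<omega>)\<^sup>2)" by (intro continuous_intros)
  then show ?thesis unfolding variation_def by (subst continuous_nn_integral_Icc) auto
qed

lemma variation_mono: "t \<le> t' \<Longrightarrow> variation s t \<kappa> \<omega> \<le> variation s t' \<kappa> \<omega>"
  unfolding variation_def by (intro nn_integral_mono) (auto split: split_indicator)

lemma drift_square_le:
  assumes "\<omega> \<in> space M" "s \<le> t"
  shows "ennreal ((drift s t \<omega>)\<^sup>2) \<le> ennreal (t - s) * (\<integral>\<^sup>+u\<in>{s..t}. ennreal (D * (1 + (Y u \<omega>)\<^sup>2)) \<partial>lborel)"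
proof -
  have [measurable]: "(\<lambda>u. Y u \<omega>) \<in> borel_measurable borel" by (rule Y_path_measurable) fact
  have "ennreal ((drift s t \<omega>)\<^sup>2) \<le> ennreal (t - s) * (\<integral>\<^sup>+u\<in>{s..t}. ennreal ((b (Y u \<omega>))\<^sup>2) \<partial>lborel)"
    unfolding drift_def using assms(2) by (intro square_set_integral_le) measurable
  also have "\<dots> \<le> ennreal (t - s) * (\<integral>\<^sup>+u\<in>{s..t}. ennreal (D * (1 + (Y u \<omega>)\<^sup>2)) \<partial>lborel)"
    by (intro mult_left_mono nn_integral_mono mult_right_mono ennreal_leI b_growth) auto
  finally show ?thesis .
qed

lemma killed_energy:
  assumes "0 \<le> s" "s \<le> t" "\<kappa> \<in> borel_measurable (F s)" "0 \<le> c"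
  shows "(\<integral>\<^sup>+\<omega>. ennreal ((martingale_part s t \<omega> - \<kappa> \<omega> * (B t \<omega> - B s \<omega>))\<^sup>2) * indicator {\<omega>. variation s t \<kappa> \<omega> < ennreal c} \<omega> \<partial>M)
      \<le> (\<integral>\<^sup>+\<omega>. min (variation s t \<kappa> \<omega>) (ennreal c) \<partial>M)"
proof (cases "s < t")
  case True
  then show ?thesis
    using energy[OF assms(1) True assms(3,4)] by (simp add: martingale_part_def variation_def drift_def)
next
  case False
  with assms have "s = t" by simp
  then have "martingale_part s t \<omega> = 0" if "\<omega> \<in> space M" for \<omega>
    using drift_square_le[OF that, of s t] by (simp add: martingale_part_def ennreal_eq_0_iff)
  then have "(\<integral>\<^sup>+\<omega>. ennreal ((martingale_part s t \<omega> - \<kappa> \<omega> * (B t \<omega> - B s \<omega>))\<^sup>2) * indicator {\<omega>. variation s t \<kappa> \<omega> < ennreal c} \<omega> \<partial>M) = (\<integral>\<^sup>+\<omega>. 0 \<partial>M)"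
    using \<open>s = t\<close> by (intro nn_integral_cong) auto
  then show ?thesis by simp
qed

lemma martingale_energy:
  assumes "0 \<le> s" "s \<le> t" "\<kappa> \<in> borel_measurable (F s)"
  shows "(\<integral>\<^sup>+\<omega>. ennreal ((martingale_part s t \<omega> - \<kappa> \<omega> * (B t \<omega> - B s \<omega>))\<^sup>2) \<partial>M) \<le> (\<integral>\<^sup>+\<omega>. variation s t \<kappa> \<omega> \<partial>M)"
proof (rule nn_integral_le_of_killed[where a = "variation s t \<kappa>"])
  have [measurable]: "\<kappa> \<in> borel_measurable M" "B s \<in> borel_measurable M" "B t \<in> borel_measurable M"
    using assms F_measurable_M B_measurable by auto
  show "(\<lambda>\<omega>. ennreal ((martingale_part s t \<omega> - \<kappa> \<omega> * (B t \<omega> - B s \<omega>))\<^sup>2)) \<in> borel_measurable M"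
    "variation s t \<kappa> \<in> borel_measurable M"
    by measurable
  show "(\<integral>\<^sup>+\<omega>. ennreal ((martingale_part s t \<omega> - \<kappa> \<omega> * (B t \<omega> - B s \<omega>))\<^sup>2)
      * indicator {\<omega>. variation s t \<kappa> \<omega> < ennreal (real (Suc n))} \<omega> \<partial>M) \<le> (\<integral>\<^sup>+\<omega>. variation s t \<kappa> \<omega> \<partial>M)" for n
    using killed_energy[OF assms, of "real (Suc n)"] by (rule order_trans) (auto intro!: nn_integral_mono)
qed (rule variation_finite)

section \<open>Second moments\<close>

lemma Y_square_le_forced:
  assumes w: "\<omega> \<in> space M" "Y 0 \<omega> = x" and u: "0 \<le> u" "u \<le> T"
  shows "ennreal ((Y u \<omega>)\<^sup>2) \<le> (ennreal (3 * x\<^sup>2 + 3 * T\<^sup>2 * D) + 3 * ennreal ((martingale_part 0 u \<omega>)\<^sup>2))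
    + ennreal (3 * T * D) * (\<integral>\<^sup>+v\<in>{0..u}. ennreal ((Y v \<omega>)\<^sup>2) \<partial>lborel)"
proof -
  have [measurable]: "(\<lambda>u. Y u \<omega>) \<in> borel_measurable borel" by (rule Y_path_measurable) fact
  have T: "0 \<le> T" using u by simp
  have sq3: "(p + q + r)\<^sup>2 \<le> 3 * p\<^sup>2 + 3 * q\<^sup>2 + 3 * r\<^sup>2" for p q r :: real
  proof -
    have "0 \<le> (p - q)\<^sup>2 + (q - r)\<^sup>2 + (p - r)\<^sup>2" by simp
    then show ?thesis by (simp add: power2_eq_square algebra_simps)
  qed
  have "Y u \<omega> = x + martingale_part 0 u \<omega> + drift 0 u \<omega>" using w by (simp add: martingale_part_def)
  then have "(Y u \<omega>)\<^sup>2 \<le> 3 * x\<^sup>2 + 3 * (martingale_part 0 u \<omega>)\<^sup>2 + 3 * (drift 0 u \<omega>)\<^sup>2" using sq3 by metis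
  then have "ennreal ((Y u \<omega>)\<^sup>2) \<le> ennreal (3 * x\<^sup>2 + 3 * (martingale_part 0 u \<omega>)\<^sup>2 + 3 * (drift 0 u \<omega>)\<^sup>2)"
    by (rule ennreal_leI)
  also have "\<dots> = ennreal (3 * x\<^sup>2) + 3 * ennreal ((martingale_part 0 u \<omega>)\<^sup>2) + 3 * ennreal ((drift 0 u \<omega>)\<^sup>2)"
    by (simp add: ennreal_mult)
  also have "ennreal ((drift 0 u \<omega>)\<^sup>2) \<le> ennreal (T * D * T) + ennreal (T * D) * (\<integral>\<^sup>+v\<in>{0..u}. ennreal ((Y v \<omega>)\<^sup>2) \<partial>lborel)"
  proof -
    have "ennreal ((drift 0 u \<omega>)\<^sup>2) \<le> ennreal (u - 0) * (\<integral>\<^sup>+v\<in>{0..u}. ennreal (D * (1 + (Y v \<omega>)\<^sup>2)) \<partial>lborel)"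
      by (rule drift_square_le[OF w(1) u(1)])
    also have "\<dots> \<le> ennreal T * (\<integral>\<^sup>+v\<in>{0..u}. ennreal (D * (1 + (Y v \<omega>)\<^sup>2)) \<partial>lborel)"
      using u by (intro mult_right_mono ennreal_leI) auto
    also have "(\<integral>\<^sup>+v\<in>{0..u}. ennreal (D * (1 + (Y v \<omega>)\<^sup>2)) \<partial>lborel)
       = (\<integral>\<^sup>+v. ennreal D * indicator {0..u} v + ennreal D * (ennreal ((Y v \<omega>)\<^sup>2) * indicator {0..u} v) \<partial>lborel)"
      using D by (intro nn_integral_cong) (auto split: split_indicator simp: algebra_simps ennreal_mult)
    also have "\<dots> = ennreal D * ennreal u + ennreal D * (\<integral>\<^sup>+v\<in>{0..u}. ennreal ((Y v \<omega>)\<^sup>2) \<partial>lborel)"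
      using u by (subst nn_integral_add) (auto simp: nn_integral_cmult)
    also have "\<dots> \<le> ennreal D * ennreal T + ennreal D * (\<integral>\<^sup>+v\<in>{0..u}. ennreal ((Y v \<omega>)\<^sup>2) \<partial>lborel)"
      using u by (intro add_right_mono mult_left_mono ennreal_leI) auto
    finally show ?thesis
      using T D by (simp add: distrib_left mult.assoc[symmetric] ennreal_mult mult_left_mono)
  qed
  finally have "ennreal ((Y u \<omega>)\<^sup>2) \<le> ennreal (3 * x\<^sup>2) + 3 * ennreal ((martingale_part 0 u \<omega>)\<^sup>2)
     + 3 * (ennreal (T * D * T) + ennreal (T * D) * (\<integral>\<^sup>+v\<in>{0..u}. ennreal ((Y v \<omega>)\<^sup>2) \<partial>lborel))"
    by (simp add: add_left_mono mult_left_mono)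
  also have "\<dots> = (ennreal (3 * x\<^sup>2 + 3 * T\<^sup>2 * D) + 3 * ennreal ((martingale_part 0 u \<omega>)\<^sup>2))
    + ennreal (3 * T * D) * (\<integral>\<^sup>+v\<in>{0..u}. ennreal ((Y v \<omega>)\<^sup>2) \<partial>lborel)"
    using T D by (simp add: distrib_left ennreal_mult power2_eq_square ac_simps)
  finally show ?thesis .
qed

text \<open>Linear growth of \<open>b\<close> lets the drift be absorbed path by path, so that \<open>Y\<close> is controlled by its martingale
part alone. This is done before taking expectations because only the martingale part is known to have a
finite killed second moment.\<close>

lemma Y_square_le_martingale:
  assumes T: "0 < T"
  obtains C where "0 \<le> C" "AE \<omega> in M. \<forall>u\<in>{0..T}. ennreal ((Y u \<omega>)\<^sup>2) \<le>
      (ennreal (3 * x\<^sup>2 + 3 * T\<^sup>2 * D) + 3 * ennreal ((martingale_part 0 u \<omega>)\<^sup>2))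
      + ennreal C * (\<integral>\<^sup>+v\<in>{0..u}. ennreal (3 * x\<^sup>2 + 3 * T\<^sup>2 * D) + 3 * ennreal ((martingale_part 0 v \<omega>)\<^sup>2) \<partial>lborel)"
proof
  let ?A = "ennreal (3 * x\<^sup>2 + 3 * T\<^sup>2 * D)"
  let ?G = "\<lambda>u \<omega>. \<integral>\<^sup>+v\<in>{0..u}. ?A + 3 * ennreal ((martingale_part 0 v \<omega>)\<^sup>2) \<partial>lborel"
  let ?C = "3 * T * D"
  show "0 \<le> 2 * ?C * exp (2 * ?C * T)" using T D by simp
  show "AE \<omega> in M. \<forall>u\<in>{0..T}. ennreal ((Y u \<omega>)\<^sup>2) \<le>
      (?A + 3 * ennreal ((martingale_part 0 u \<omega>)\<^sup>2))
      + ennreal (2 * ?C * exp (2 * ?C * T)) * ?G u \<omega>"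
    using Y_0 AE_space
  proof eventually_elim
    case (elim \<omega>)
    have [measurable]: "(\<lambda>u. Y u \<omega>) \<in> borel_measurable borel" by (rule Y_path_measurable) fact
    have [measurable]: "(\<lambda>u. martingale_part 0 u \<omega>) \<in> borel_measurable borel"
      by (rule martingale_part_measurable) (use elim in auto)
    have "continuous_on {0..T} (\<lambda>u. (Y u \<omega>)\<^sup>2)"
      using Y_cont[OF elim(2)] by (intro continuous_intros) (auto intro: continuous_on_subset)
    then have "bounded ((\<lambda>u. (Y u \<omega>)\<^sup>2) ` {0..T})"
      by (intro compact_imp_bounded compact_continuous_image) auto
    then obtain K where K: "\<forall>u\<in>{0..T}. (Y u \<omega>)\<^sup>2 \<le> K" by (auto simp: bounded_iff)
    have K0: "0 \<le> K" using bspec[OF K, of 0] T by (auto intro: order_trans[OF zero_le_power2])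
    show ?case
    proof
      fix u assume "u \<in> {0..T}"
      then have u: "0 \<le> u" "u \<le> T" by auto
      show "ennreal ((Y u \<omega>)\<^sup>2) \<le> (?A + 3 * ennreal ((martingale_part 0 u \<omega>)\<^sup>2))
        + ennreal (2 * ?C * exp (2 * ?C * T)) * ?G u \<omega>"
      proof (rule gronwall_forced[OF _ _ _ K0 _ _ u])
        show "0 < ?C" using T D by simp
        show "ennreal ((Y u \<omega>)\<^sup>2) \<le> ennreal K" if "0 \<le> u" "u \<le> T" for u
          using K that by (intro ennreal_leI) auto
        show "ennreal ((Y u \<omega>)\<^sup>2) \<le> ?A + 3 * ennreal ((martingale_part 0 u \<omega>)\<^sup>2)
          + ennreal ?C * (\<integral>\<^sup>+v\<in>{0..u}. ennreal ((Y v \<omega>)\<^sup>2) \<partial>lborel)" if "0 \<le> u" "u \<le> T" for u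
          by (rule Y_square_le_forced[OF elim(2,1) that])
      qed measurable
    qed
  qed
qed

text \<open>With \<open>m u = E ((Y u)\<^sup>2; a u < c)\<close>, the killed energy inequality bounds \<open>m u\<close> by a constant plus a multiple of
\<open>E (min (a u) c)\<close>. This is at most \<open>c\<close>, hence finite, and it is also at most
\<open>\<integral>\<^sub>0\<^sup>u E (\<sigma> (Y v)\<^sup>2; a v < c) dv\<close>, which linear growth bounds by a multiple of \<open>\<integral>\<^sub>0\<^sup>u (1 + m v) dv\<close>. Gronwall's lemma gives a bound
on \<open>m\<close> that does not depend on \<open>c\<close>, and \<open>c\<close> tends to infinity.\<close>

lemma second_moment_bound:
  assumes T: "0 < T"
  obtains C where "0 \<le> C" "\<And>u. 0 \<le> u \<Longrightarrow> u \<le> T \<Longrightarrow> (\<integral>\<^sup>+\<omega>. ennreal ((Y u \<omega>)\<^sup>2) \<partial>M) \<le> ennreal C"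
proof -
  define A where "A = 3 * x\<^sup>2 + 3 * T\<^sup>2 * D"
  have A: "0 \<le> A" using D by (simp add: A_def)
  obtain C1 where C1: "0 \<le> C1" "AE \<omega> in M. \<forall>u\<in>{0..T}. ennreal ((Y u \<omega>)\<^sup>2) \<le>
      (ennreal A + 3 * ennreal ((martingale_part 0 u \<omega>)\<^sup>2))
      + ennreal C1 * (\<integral>\<^sup>+v\<in>{0..u}. ennreal A + 3 * ennreal ((martingale_part 0 v \<omega>)\<^sup>2) \<partial>lborel)"
    using Y_square_le_martingale[OF T] unfolding A_def by blast
  define R where "R = 1 + C1 * T"
  have R: "0 < R" using C1 T by (simp add: R_def add_pos_nonneg)
  define a where "a u \<omega> = variation 0 u (\<lambda>_. 0) \<omega>" for u \<omega>
  have [measurable (raw)]: "(\<lambda>p. a (f p) (g p)) \<in> borel_measurable N"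
    if [measurable]: "f \<in> borel_measurable N" "g \<in> measurable N M" for f g and N :: "'c measure"
    unfolding a_def by measurable
  have a_mono: "a v \<omega> \<le> a u \<omega>" if "v \<le> u" for u v \<omega> unfolding a_def by (rule variation_mono[OF that])
  define C where "C = 2 * (R * (A + 3 * D * T)) * exp (2 * (R * (3 * D)) * T)"
  have killed: "(\<integral>\<^sup>+\<omega>. ennreal ((Y u \<omega>)\<^sup>2) * indicator {\<omega>. a u \<omega> < ennreal c} \<omega> \<partial>M) \<le> ennreal C"
    if u: "0 \<le> u" "u \<le> T" and c: "0 < c" for c u
  proof -
    define k where "k u \<omega> = (of_bool (a u \<omega> < ennreal c) :: ennreal)" for u \<omega>
    have [measurable (raw)]: "(\<lambda>p. k (f p) (g p)) \<in> borel_measurable N"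
      if [measurable]: "f \<in> borel_measurable N" "g \<in> measurable N M" for f g and N :: "'c measure"
      unfolding k_def by measurable
    have k_mono: "k u \<omega> \<le> k v \<omega>" if "v \<le> u" for u v \<omega>
      using a_mono[OF that, of \<omega>] by (auto simp: k_def)
    have k1: "k u \<omega> \<le> 1" for u \<omega> by (simp add: k_def)
    define m where "m u = (\<integral>\<^sup>+\<omega>. ennreal ((Y u \<omega>)\<^sup>2) * k u \<omega> \<partial>M)" for u
    define G where "G v \<omega> = ennreal A + 3 * (ennreal ((martingale_part 0 v \<omega>)\<^sup>2) * k v \<omega>)" for v \<omega>
    have [measurable (raw)]: "(\<lambda>p. G (f p) (g p)) \<in> borel_measurable N"
      if [measurable]: "f \<in> borel_measurable N" "g \<in> measurable N M" for f g and N :: "'c measure"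
      unfolding G_def by measurable
    define E where "E u = (\<integral>\<^sup>+\<omega>. min (a u \<omega>) (ennreal c) \<partial>M)" for u
    have E_mono: "E v \<le> E u" if "v \<le> u" for u v
      unfolding E_def using a_mono[OF that] by (intro nn_integral_mono min.mono) auto
    have G_le: "(\<integral>\<^sup>+\<omega>. G v \<omega> \<partial>M) \<le> ennreal A + 3 * E v" if v: "0 \<le> v" for v
    proof -
      have "(\<integral>\<^sup>+\<omega>. G v \<omega> \<partial>M) = ennreal A + 3 * (\<integral>\<^sup>+\<omega>. ennreal ((martingale_part 0 v \<omega>)\<^sup>2) * k v \<omega> \<partial>M)"
        unfolding G_def by (subst nn_integral_add) (auto simp: nn_integral_cmult emeasure_space_1)
      also have "(\<integral>\<^sup>+\<omega>. ennreal ((martingale_part 0 v \<omega>)\<^sup>2) * k v \<omega> \<partial>M) \<le> E v"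
        using killed_energy[of 0 v "\<lambda>_. 0" c] v c
        by (simp add: E_def a_def k_def indicator_def)
      finally show ?thesis by (simp add: add_left_mono mult_left_mono)
    qed
    have m_le: "m u \<le> ennreal R * (ennreal A + 3 * E u)" if u: "0 \<le> u" "u \<le> T" for u
    proof -
      have "m u \<le> (\<integral>\<^sup>+\<omega>. G u \<omega> + ennreal C1 * (\<integral>\<^sup>+v\<in>{0..u}. G v \<omega> \<partial>lborel) \<partial>M)"
        unfolding m_def
      proof (intro nn_integral_mono_AE)
        show "AE \<omega> in M. ennreal ((Y u \<omega>)\<^sup>2) * k u \<omega> \<le> G u \<omega> + ennreal C1 * (\<integral>\<^sup>+v\<in>{0..u}. G v \<omega> \<partial>lborel)"
          using C1(2)
        proof eventually_elim
          case (elim \<omega>)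
          show ?case
          proof (cases "a u \<omega> < ennreal c")
            case True
            then have kv: "k v \<omega> = 1" if "v \<le> u" for v using a_mono[OF that, of \<omega>] by (auto simp: k_def)
            have eq: "(\<integral>\<^sup>+v\<in>{0..u}. ennreal A + 3 * ennreal ((martingale_part 0 v \<omega>)\<^sup>2) \<partial>lborel) = (\<integral>\<^sup>+v\<in>{0..u}. G v \<omega> \<partial>lborel)"
              by (intro nn_integral_cong) (auto simp: G_def kv split: split_indicator)
            have Gu: "G u \<omega> = ennreal A + 3 * ennreal ((martingale_part 0 u \<omega>)\<^sup>2)" by (simp add: G_def kv)
            have "ennreal ((Y u \<omega>)\<^sup>2) \<le> G u \<omega> + ennreal C1 * (\<integral>\<^sup>+v\<in>{0..u}. G v \<omega> \<partial>lborel)"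
              unfolding Gu eq[symmetric] using u by (intro bspec[OF elim]) auto
            then show ?thesis by (simp add: kv)
          qed (simp add: k_def)
        qed
      qed
      also have "\<dots> = (\<integral>\<^sup>+\<omega>. G u \<omega> \<partial>M) + ennreal C1 * (\<integral>\<^sup>+\<omega>. (\<integral>\<^sup>+v\<in>{0..u}. G v \<omega> \<partial>lborel) \<partial>M)"
        unfolding indicator_def atLeastAtMost_iff by (subst nn_integral_add) (auto simp: nn_integral_cmult)
      also have "(\<integral>\<^sup>+\<omega>. (\<integral>\<^sup>+v\<in>{0..u}. G v \<omega> \<partial>lborel) \<partial>M) = (\<integral>\<^sup>+v\<in>{0..u}. (\<integral>\<^sup>+\<omega>. G v \<omega> \<partial>M) \<partial>lborel)"
        by (subst nn_integral_swap) (auto simp: nn_integral_multc)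
      also have "\<dots> \<le> (\<integral>\<^sup>+v. (ennreal A + 3 * E u) * indicator {0..u} v \<partial>lborel)"
        by (intro nn_integral_mono)
          (auto split: split_indicator intro!: order_trans[OF G_le] add_left_mono mult_left_mono E_mono)
      also have "\<dots> = (ennreal A + 3 * E u) * ennreal u" using u by (simp add: nn_integral_cmult_indicator)
      also have "\<dots> \<le> (ennreal A + 3 * E u) * ennreal T" using u by (intro mult_left_mono ennreal_leI) auto
      also have "(\<integral>\<^sup>+\<omega>. G u \<omega> \<partial>M) \<le> ennreal A + 3 * E u" by (rule G_le[OF u(1)])
      finally have "m u \<le> (ennreal A + 3 * E u) + ennreal C1 * ((ennreal A + 3 * E u) * ennreal T)"
        by (simp add: add_mono mult_left_mono)
      also have "\<dots> = ennreal R * (ennreal A + 3 * E u)"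
        unfolding R_def using C1(1) T by (simp add: distrib_right ennreal_mult ac_simps)
      finally show ?thesis .
    qed
    have E_le: "E u \<le> ennreal (D * T) + ennreal D * (\<integral>\<^sup>+v\<in>{0..u}. m v \<partial>lborel)" if u: "0 \<le> u" "u \<le> T" for u
    proof -
      have "E u \<le> (\<integral>\<^sup>+\<omega>. (\<integral>\<^sup>+v\<in>{0..u}. ennreal ((\<sigma> (Y v \<omega>))\<^sup>2) * k v \<omega> \<partial>lborel) \<partial>M)"
        unfolding E_def
      proof (intro nn_integral_mono)
        fix \<omega> assume w: "\<omega> \<in> space M"
        have "continuous_on UNIV (\<lambda>u. \<sigma> (Y u \<omega>))"
          by (rule continuous_on_compose2[OF \<sigma>_cont Y_cont[OF w]]) auto
        then have "continuous_on UNIV (\<lambda>u. (\<sigma> (Y u \<omega>))\<^sup>2)" by (intro continuous_intros)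
        from min_le_killed_nn_integral[OF this _ c, of u]
        show "min (a u \<omega>) (ennreal c) \<le> (\<integral>\<^sup>+v\<in>{0..u}. ennreal ((\<sigma> (Y v \<omega>))\<^sup>2) * k v \<omega> \<partial>lborel)"
          by (simp add: a_def variation_def k_def indicator_def)
      qed
      also have "\<dots> = (\<integral>\<^sup>+v\<in>{0..u}. (\<integral>\<^sup>+\<omega>. ennreal ((\<sigma> (Y v \<omega>))\<^sup>2) * k v \<omega> \<partial>M) \<partial>lborel)"
        by (subst nn_integral_swap) (auto simp: nn_integral_multc)
      also have "\<dots> \<le> (\<integral>\<^sup>+v\<in>{0..u}. ennreal D + ennreal D * m v \<partial>lborel)"
      proof (intro nn_integral_mono mult_right_mono)
        fix v
        have "ennreal ((\<sigma> (Y v \<omega>))\<^sup>2) * k v \<omega> \<le> ennreal D + ennreal D * (ennreal ((Y v \<omega>)\<^sup>2) * k v \<omega>)" for \<omega>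
        proof -
          have "ennreal ((\<sigma> (Y v \<omega>))\<^sup>2) \<le> ennreal D + ennreal D * ennreal ((Y v \<omega>)\<^sup>2)"
            using \<sigma>_growth[of "Y v \<omega>"] D by (simp add: distrib_left ennreal_leI flip: ennreal_mult ennreal_plus)
          then show ?thesis by (auto simp: k_def)
        qed
        then have "(\<integral>\<^sup>+\<omega>. ennreal ((\<sigma> (Y v \<omega>))\<^sup>2) * k v \<omega> \<partial>M) \<le> (\<integral>\<^sup>+\<omega>. ennreal D + ennreal D * (ennreal ((Y v \<omega>)\<^sup>2) * k v \<omega>) \<partial>M)"
          by (intro nn_integral_mono) auto
        also have "\<dots> = ennreal D + ennreal D * m v"
          unfolding m_def by (subst nn_integral_add) (auto simp: nn_integral_cmult emeasure_space_1)
        finally show "(\<integral>\<^sup>+\<omega>. ennreal ((\<sigma> (Y v \<omega>))\<^sup>2) * k v \<omega> \<partial>M) \<le> ennreal D + ennreal D * m v" .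
      qed auto
      also have "\<dots> = ennreal D * ennreal u + ennreal D * (\<integral>\<^sup>+v\<in>{0..u}. m v \<partial>lborel)"
      proof -
        have [measurable]: "m \<in> borel_measurable borel" unfolding m_def by measurable
        have "(\<integral>\<^sup>+v\<in>{0..u}. ennreal D + ennreal D * m v \<partial>lborel)
           = (\<integral>\<^sup>+v. ennreal D * indicator {0..u} v + ennreal D * (m v * indicator {0..u} v) \<partial>lborel)"
          by (intro nn_integral_cong) (auto split: split_indicator)
        also have "\<dots> = ennreal D * ennreal u + ennreal D * (\<integral>\<^sup>+v\<in>{0..u}. m v \<partial>lborel)"
          using u by (subst nn_integral_add) (auto simp: nn_integral_cmult)
        finally show ?thesis .
      qed
      also have "\<dots> \<le> ennreal D * ennreal T + ennreal D * (\<integral>\<^sup>+v\<in>{0..u}. m v \<partial>lborel)"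
        using u by (intro add_right_mono mult_left_mono ennreal_leI) auto
      finally show ?thesis using D T by (simp add: ennreal_mult)
    qed
    have "m u \<le> ennreal (2 * (R * (A + 3 * D * T)) * exp (2 * (R * (3 * D)) * u))"
    proof (rule gronwall_nn[where K = "R * (A + 3 * c)" and T = T])
      show "0 < R * (3 * D)" "0 \<le> R * (A + 3 * D * T)" "0 \<le> R * (A + 3 * c)"
        using R D A T c by (auto intro!: mult_nonneg_nonneg add_nonneg_nonneg)
      fix u assume u: "0 \<le> u" "u \<le> T"
      have "E u \<le> (\<integral>\<^sup>+\<omega>. ennreal c \<partial>M)" unfolding E_def by (intro nn_integral_mono) auto
      then have Ec: "E u \<le> ennreal c" by (simp add: emeasure_space_1)
      have "m u \<le> ennreal R * (ennreal A + 3 * E u)" by (rule m_le[OF u])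
      also have "\<dots> \<le> ennreal R * (ennreal A + 3 * ennreal c)"
        by (intro mult_left_mono add_left_mono Ec) auto
      also have "\<dots> = ennreal (R * (A + 3 * c))" using R A c by (simp add: ennreal_mult)
      finally show "m u \<le> ennreal (R * (A + 3 * c))" .
      have "m u \<le> ennreal R * (ennreal A + 3 * E u)" by (rule m_le[OF u])
      also have "\<dots> \<le> ennreal R * (ennreal A + 3 * (ennreal (D * T) + ennreal D * (\<integral>\<^sup>+v\<in>{0..u}. m v \<partial>lborel)))"
        by (intro mult_left_mono add_left_mono E_le[OF u]) auto
      also have "\<dots> = ennreal (R * (A + 3 * D * T)) + ennreal (R * (3 * D)) * (\<integral>\<^sup>+v\<in>{0..u}. m v \<partial>lborel)"
        using R A D T by (simp add: ennreal_mult distrib_left ac_simps)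
      finally show "m u \<le> ennreal (R * (A + 3 * D * T)) + ennreal (R * (3 * D)) * (\<integral>\<^sup>+v\<in>{0..u}. m v \<partial>lborel)" .
    qed (use u in auto)
    also have "\<dots> \<le> ennreal C"
      unfolding C_def using R D A T u by (intro ennreal_leI mult_left_mono) auto
    finally show ?thesis by (simp add: m_def k_def indicator_def)
  qed
  have "(\<integral>\<^sup>+\<omega>. ennreal ((Y u \<omega>)\<^sup>2) \<partial>M) \<le> ennreal C" if u: "0 \<le> u" "u \<le> T" for u
  proof (rule nn_integral_le_of_killed[where a = "a u"])
    show "(\<integral>\<^sup>+\<omega>. ennreal ((Y u \<omega>)\<^sup>2) * indicator {\<omega>. a u \<omega> < ennreal (real (Suc n))} \<omega> \<partial>M) \<le> ennreal C" for n
      by (rule killed[OF u]) simp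
    show "\<omega> \<in> space M \<Longrightarrow> a u \<omega> < \<infinity>" for \<omega> unfolding a_def by (rule variation_finite)
  qed (use Y_meas in measurable)
  moreover have "0 \<le> C" using R D A T by (simp add: C_def)
  ultimately show thesis using that by blast
qed

end

section \<open>The error of one Euler step\<close>

lemma powr_le_add_one:
  fixes w \<theta> :: real
  assumes "0 \<le> w" "0 \<le> \<theta>" "\<theta> \<le> 1"
  shows "w powr \<theta> \<le> 1 + w"
proof (cases "w \<le> 1")
  case True
  then have "w powr \<theta> \<le> 1" using assms by (intro powr_le1) auto
  then show ?thesis using assms by simp
next
  case False
  then have "w powr \<theta> \<le> w powr 1" using assms by (intro powr_mono) auto
  then show ?thesis using False by simp
qed

text \<open>Replaces Jensen's inequality: with \<open>\<epsilon>\<close> of the order of \<open>E y\<^sup>2\<close>, taking expectations gives the correct power of \<open>\<epsilon>\<close>.\<close>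

lemma square_powr_le:
  fixes y \<epsilon> \<theta> :: real
  assumes "0 < \<epsilon>" "0 \<le> \<theta>" "\<theta> \<le> 1"
  shows "(\<bar>y\<bar> powr \<theta>)\<^sup>2 \<le> \<epsilon> powr \<theta> * (1 + y\<^sup>2 / \<epsilon>)"
proof -
  have "(\<bar>y\<bar> powr \<theta>)\<^sup>2 = (\<bar>y\<bar>\<^sup>2) powr \<theta>"
    by (simp only: power2_eq_square powr_mult abs_ge_zero)
  also have "\<dots> = (\<epsilon> * (y\<^sup>2 / \<epsilon>)) powr \<theta>" using assms by simp
  also have "\<dots> = \<epsilon> powr \<theta> * (y\<^sup>2 / \<epsilon>) powr \<theta>" by (rule powr_mult)
  also have "\<dots> \<le> \<epsilon> powr \<theta> * (1 + y\<^sup>2 / \<epsilon>)" using assms by (intro mult_left_mono powr_le_add_one) auto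
  finally show ?thesis .
qed

context regular_sde
begin

lemma growth_integral_le:
  assumes C: "0 \<le> C" "\<And>u. 0 \<le> u \<Longrightarrow> u \<le> T \<Longrightarrow> (\<integral>\<^sup>+\<omega>. ennreal ((Y u \<omega>)\<^sup>2) \<partial>M) \<le> ennreal C"
    and st: "0 \<le> s" "s \<le> t" "t \<le> T"
  shows "(\<integral>\<^sup>+\<omega>. (\<integral>\<^sup>+u\<in>{s..t}. ennreal (D * (1 + (Y u \<omega>)\<^sup>2)) \<partial>lborel) \<partial>M) \<le> ennreal (D * (1 + C) * (t - s))"
proof -
  have "(\<integral>\<^sup>+\<omega>. (\<integral>\<^sup>+u\<in>{s..t}. ennreal (D * (1 + (Y u \<omega>)\<^sup>2)) \<partial>lborel) \<partial>M)
     = (\<integral>\<^sup>+u\<in>{s..t}. (\<integral>\<^sup>+\<omega>. ennreal (D * (1 + (Y u \<omega>)\<^sup>2)) \<partial>M) \<partial>lborel)"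
    by (subst nn_integral_swap) (auto simp: nn_integral_multc)
  also have "\<dots> \<le> (\<integral>\<^sup>+u. ennreal (D * (1 + C)) * indicator {s..t} u \<partial>lborel)"
  proof (intro nn_integral_mono)
    fix u
    show "(\<integral>\<^sup>+\<omega>. ennreal (D * (1 + (Y u \<omega>)\<^sup>2)) \<partial>M) * indicator {s..t} u \<le> ennreal (D * (1 + C)) * indicator {s..t} u"
    proof (cases "u \<in> {s..t}")
      case True
      have "(\<integral>\<^sup>+\<omega>. ennreal (D * (1 + (Y u \<omega>)\<^sup>2)) \<partial>M) = (\<integral>\<^sup>+\<omega>. ennreal D * (1 + ennreal ((Y u \<omega>)\<^sup>2)) \<partial>M)"
        using D by (intro nn_integral_cong) (simp add: ennreal_mult)
      also have "\<dots> = ennreal D * (1 + (\<integral>\<^sup>+\<omega>. ennreal ((Y u \<omega>)\<^sup>2) \<partial>M))"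
        by (simp add: nn_integral_cmult nn_integral_add emeasure_space_1)
      also have "\<dots> \<le> ennreal D * (1 + ennreal C)"
        using C(2)[of u] True st by (intro mult_left_mono add_left_mono) auto
      also have "\<dots> = ennreal (D * (1 + C))" using D C by (simp add: ennreal_mult)
      finally show ?thesis using True by simp
    qed simp
  qed
  also have "\<dots> = ennreal (D * (1 + C) * (t - s))"
    using st D C by (simp add: nn_integral_cmult_indicator ennreal_mult)
  finally show ?thesis .
qed

lemma drift_second_moment:
  assumes C: "0 \<le> C" "\<And>u. 0 \<le> u \<Longrightarrow> u \<le> T \<Longrightarrow> (\<integral>\<^sup>+\<omega>. ennreal ((Y u \<omega>)\<^sup>2) \<partial>M) \<le> ennreal C"
    and st: "0 \<le> s" "s \<le> t" "t \<le> T"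
  shows "(\<integral>\<^sup>+\<omega>. ennreal ((drift s t \<omega>)\<^sup>2) \<partial>M) \<le> ennreal (D * (1 + C) * (t - s)\<^sup>2)"
proof -
  have "(\<integral>\<^sup>+\<omega>. ennreal ((drift s t \<omega>)\<^sup>2) \<partial>M)
     \<le> (\<integral>\<^sup>+\<omega>. ennreal (t - s) * (\<integral>\<^sup>+u\<in>{s..t}. ennreal (D * (1 + (Y u \<omega>)\<^sup>2)) \<partial>lborel) \<partial>M)"
    using st by (intro nn_integral_mono drift_square_le)
  also have "\<dots> = ennreal (t - s) * (\<integral>\<^sup>+\<omega>. (\<integral>\<^sup>+u\<in>{s..t}. ennreal (D * (1 + (Y u \<omega>)\<^sup>2)) \<partial>lborel) \<partial>M)"
    by (intro nn_integral_cmult) measurable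
  also have "\<dots> \<le> ennreal (t - s) * ennreal (D * (1 + C) * (t - s))"
    by (intro mult_left_mono growth_integral_le[OF C st]) auto
  also have "\<dots> = ennreal (D * (1 + C) * (t - s)\<^sup>2)"
    using st C D by (simp add: power2_eq_square ac_simps flip: ennreal_mult)
  finally show ?thesis .
qed

lemma square_moment_split:
  assumes [measurable]: "Z \<in> borel_measurable M"
    and 1: "(\<integral>\<^sup>+\<omega>. ennreal ((martingale_part s t \<omega> - Z \<omega>)\<^sup>2) \<partial>M) \<le> ennreal p"
    and 2: "(\<integral>\<^sup>+\<omega>. ennreal ((drift s t \<omega>)\<^sup>2) \<partial>M) \<le> ennreal q" and pq: "0 \<le> p" "0 \<le> q"
  shows "(\<integral>\<^sup>+\<omega>. ennreal ((Y t \<omega> - Y s \<omega> - Z \<omega>)\<^sup>2) \<partial>M) \<le> ennreal (2 * p + 2 * q)"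
proof -
  have "ennreal ((Y t \<omega> - Y s \<omega> - Z \<omega>)\<^sup>2) \<le> 2 * ennreal ((martingale_part s t \<omega> - Z \<omega>)\<^sup>2) + 2 * ennreal ((drift s t \<omega>)\<^sup>2)" for \<omega>
  proof -
    have eq: "Y t \<omega> - Y s \<omega> - Z \<omega> = (martingale_part s t \<omega> - Z \<omega>) + drift s t \<omega>" by (simp add: martingale_part_def)
    have "(Y t \<omega> - Y s \<omega> - Z \<omega>)\<^sup>2 \<le> (1 + 1) * (martingale_part s t \<omega> - Z \<omega>)\<^sup>2 + (1 + 1 / 1) * (drift s t \<omega>)\<^sup>2"
      unfolding eq by (rule square_add_le_weighted) simp
    then have "(Y t \<omega> - Y s \<omega> - Z \<omega>)\<^sup>2 \<le> 2 * (martingale_part s t \<omega> - Z \<omega>)\<^sup>2 + 2 * (drift s t \<omega>)\<^sup>2" by simp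
    then have "ennreal ((Y t \<omega> - Y s \<omega> - Z \<omega>)\<^sup>2) \<le> ennreal (2 * (martingale_part s t \<omega> - Z \<omega>)\<^sup>2 + 2 * (drift s t \<omega>)\<^sup>2)"
      by (rule ennreal_leI)
    then show ?thesis by (simp add: ennreal_mult)
  qed
  then have "(\<integral>\<^sup>+\<omega>. ennreal ((Y t \<omega> - Y s \<omega> - Z \<omega>)\<^sup>2) \<partial>M)
     \<le> (\<integral>\<^sup>+\<omega>. 2 * ennreal ((martingale_part s t \<omega> - Z \<omega>)\<^sup>2) + 2 * ennreal ((drift s t \<omega>)\<^sup>2) \<partial>M)"
    by (intro nn_integral_mono) auto
  also have "\<dots> = 2 * (\<integral>\<^sup>+\<omega>. ennreal ((martingale_part s t \<omega> - Z \<omega>)\<^sup>2) \<partial>M) + 2 * (\<integral>\<^sup>+\<omega>. ennreal ((drift s t \<omega>)\<^sup>2) \<partial>M)"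
    by (subst nn_integral_add) (auto simp: nn_integral_cmult)
  also have "\<dots> \<le> 2 * ennreal p + 2 * ennreal q"
    by (intro add_mono mult_left_mono 1 2) auto
  also have "\<dots> = ennreal (2 * p + 2 * q)" using pq by (simp add: ennreal_mult)
  finally show ?thesis .
qed

text \<open>The increment bound is the energy inequality with \<open>\<kappa> = 0\<close>. For the Euler step, \<open>\<kappa> = \<sigma> (Y s)\<close> turns the
integrand into \<open>\<sigma> (Y u) - \<sigma> (Y s)\<close>, whose square is of order \<open>(t - s) powr \<theta>\<close> in expectation by Hoelder continuity
and the increment bound; integration over time adds one power of \<open>t - s\<close>. The drift contributes \<open>(t - s)\<^sup>2\<close>,
which is smaller as \<open>\<theta> \<le> 1\<close>.\<close>

lemma one_step_errors:
  assumes T: "0 < T"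
  obtains C where "0 \<le> C"
    "\<And>s t. 0 \<le> s \<Longrightarrow> s \<le> t \<Longrightarrow> t \<le> T \<Longrightarrow> (\<integral>\<^sup>+\<omega>. ennreal ((Y t \<omega> - Y s \<omega>)\<^sup>2) \<partial>M) \<le> ennreal (C * (t - s))"
    "\<And>s t W. 0 \<le> s \<Longrightarrow> s < t \<Longrightarrow> t \<le> T \<Longrightarrow> t - s \<le> 1 \<Longrightarrow> W \<in> borel_measurable (F s) \<Longrightarrow> AE \<omega> in M. W \<omega> = Y s \<omega> \<Longrightarrow>
       (\<integral>\<^sup>+\<omega>. ennreal ((Y t \<omega> - Y s \<omega> - \<sigma> (W \<omega>) * (B t \<omega> - B s \<omega>))\<^sup>2) \<partial>M) \<le> ennreal (C * (t - s) powr (1 + \<theta>))"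
proof -
  obtain C where C: "0 \<le> C" "\<And>u. 0 \<le> u \<Longrightarrow> u \<le> T \<Longrightarrow> (\<integral>\<^sup>+\<omega>. ennreal ((Y u \<omega>)\<^sup>2) \<partial>M) \<le> ennreal C"
    using second_moment_bound[OF T] by blast
  define P where "P = D * (1 + C)"
  have P: "0 \<le> P" using C D by (simp add: P_def)
  define C1 where "C1 = 2 * P * (1 + T)"
  have C1: "0 \<le> C1" using P T by (simp add: C1_def)
  have incr: "(\<integral>\<^sup>+\<omega>. ennreal ((Y t \<omega> - Y s \<omega>)\<^sup>2) \<partial>M) \<le> ennreal (C1 * (t - s))"
    if st: "0 \<le> s" "s \<le> t" "t \<le> T" for s t
  proof -
    have "(\<integral>\<^sup>+\<omega>. ennreal ((martingale_part s t \<omega> - 0)\<^sup>2) \<partial>M) \<le> (\<integral>\<^sup>+\<omega>. variation s t (\<lambda>_. 0) \<omega> \<partial>M)"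
      using martingale_energy[of s t "\<lambda>_. 0"] st by simp
    also have "\<dots> \<le> (\<integral>\<^sup>+\<omega>. (\<integral>\<^sup>+u\<in>{s..t}. ennreal (D * (1 + (Y u \<omega>)\<^sup>2)) \<partial>lborel) \<partial>M)"
      unfolding variation_def by (intro nn_integral_mono mult_right_mono ennreal_leI) (auto simp: \<sigma>_growth)
    also have "\<dots> \<le> ennreal (P * (t - s))" unfolding P_def by (rule growth_integral_le[OF C st])
    finally have "(\<integral>\<^sup>+\<omega>. ennreal ((Y t \<omega> - Y s \<omega> - 0)\<^sup>2) \<partial>M) \<le> ennreal (2 * (P * (t - s)) + 2 * (P * (t - s)\<^sup>2))"
      using drift_second_moment[OF C st] st P unfolding P_def[symmetric] by (intro square_moment_split) auto
    also have "\<dots> \<le> ennreal (C1 * (t - s))"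
    proof (rule ennreal_leI)
      have "P * ((t - s) * (t - s)) \<le> P * (T * (t - s))" using P st by (intro mult_left_mono mult_right_mono) auto
      then show "2 * (P * (t - s)) + 2 * (P * (t - s)\<^sup>2) \<le> C1 * (t - s)"
        by (simp add: C1_def power2_eq_square algebra_simps)
    qed
    finally show ?thesis by simp
  qed
  define C2 where "C2 = 2 * L\<^sup>2 * (1 + C1) + 2 * P"
  have C2: "0 \<le> C2" using C1 P by (simp add: C2_def)
  have euler: "(\<integral>\<^sup>+\<omega>. ennreal ((Y t \<omega> - Y s \<omega> - \<sigma> (W \<omega>) * (B t \<omega> - B s \<omega>))\<^sup>2) \<partial>M) \<le> ennreal (C2 * (t - s) powr (1 + \<theta>))"
    if st: "0 \<le> s" "s < t" "t \<le> T" "t - s \<le> 1" and W: "W \<in> borel_measurable (F s)" "AE \<omega> in M. W \<omega> = Y s \<omega>" for s t W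
  proof -
    define \<epsilon> where "\<epsilon> = t - s"
    have e: "0 < \<epsilon>" "\<epsilon> \<le> 1" using st by (auto simp: \<epsilon>_def)
    have [measurable]: "W \<in> borel_measurable M" "B s \<in> borel_measurable M" "B t \<in> borel_measurable M"
      using F_measurable_M[OF W(1)] st B_measurable by auto
    have \<kappa>: "(\<lambda>\<omega>. \<sigma> (W \<omega>)) \<in> borel_measurable (F s)" using W(1) by measurable
    have "(\<integral>\<^sup>+\<omega>. ennreal ((martingale_part s t \<omega> - \<sigma> (W \<omega>) * (B t \<omega> - B s \<omega>))\<^sup>2) \<partial>M)
       \<le> (\<integral>\<^sup>+\<omega>. variation s t (\<lambda>\<omega>. \<sigma> (W \<omega>)) \<omega> \<partial>M)"
      using martingale_energy[OF _ _ \<kappa>, of t] st by simp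
    also have "\<dots> \<le> (\<integral>\<^sup>+\<omega>. (\<integral>\<^sup>+u\<in>{s..t}. ennreal (L\<^sup>2 * \<epsilon> powr \<theta>) * (1 + ennreal (1 / \<epsilon>) * ennreal ((Y u \<omega> - Y s \<omega>)\<^sup>2)) \<partial>lborel) \<partial>M)"
      using W(2)
    proof (intro nn_integral_mono_AE, eventually_elim)
      case (elim \<omega>)
      show ?case unfolding variation_def elim
      proof (intro nn_integral_mono mult_right_mono)
        fix u
        have "(\<sigma> (Y u \<omega>) - \<sigma> (Y s \<omega>))\<^sup>2 = \<bar>\<sigma> (Y u \<omega>) - \<sigma> (Y s \<omega>)\<bar>\<^sup>2" by simp
        also have "\<dots> \<le> (L * \<bar>Y u \<omega> - Y s \<omega>\<bar> powr \<theta>)\<^sup>2" by (intro power_mono holder) auto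
        also have "\<dots> = L\<^sup>2 * (\<bar>Y u \<omega> - Y s \<omega>\<bar> powr \<theta>)\<^sup>2" by (simp add: power_mult_distrib)
        also have "\<dots> \<le> L\<^sup>2 * (\<epsilon> powr \<theta> * (1 + (Y u \<omega> - Y s \<omega>)\<^sup>2 / \<epsilon>))"
          using e \<theta> by (intro mult_left_mono square_powr_le) auto
        finally have "ennreal ((\<sigma> (Y u \<omega>) - \<sigma> (Y s \<omega>))\<^sup>2) \<le> ennreal (L\<^sup>2 * \<epsilon> powr \<theta> * (1 + 1 / \<epsilon> * (Y u \<omega> - Y s \<omega>)\<^sup>2))"
          by (intro ennreal_leI) (simp add: mult.assoc)
        also have "\<dots> = ennreal (L\<^sup>2 * \<epsilon> powr \<theta>) * (1 + ennreal (1 / \<epsilon>) * ennreal ((Y u \<omega> - Y s \<omega>)\<^sup>2))"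
        proof -
          have "ennreal (1 + 1 / \<epsilon> * (Y u \<omega> - Y s \<omega>)\<^sup>2) = 1 + ennreal (1 / \<epsilon>) * ennreal ((Y u \<omega> - Y s \<omega>)\<^sup>2)"
            using e by (subst ennreal_plus) (auto simp: ennreal_mult simp del: times_divide_eq_left)
          then show ?thesis using e by (subst ennreal_mult) auto
        qed
        finally show "ennreal ((\<sigma> (Y u \<omega>) - \<sigma> (Y s \<omega>))\<^sup>2) \<le> ennreal (L\<^sup>2 * \<epsilon> powr \<theta>) * (1 + ennreal (1 / \<epsilon>) * ennreal ((Y u \<omega> - Y s \<omega>)\<^sup>2))" .
      qed auto
    qed
    also have "\<dots> = (\<integral>\<^sup>+u\<in>{s..t}. (\<integral>\<^sup>+\<omega>. ennreal (L\<^sup>2 * \<epsilon> powr \<theta>) * (1 + ennreal (1 / \<epsilon>) * ennreal ((Y u \<omega> - Y s \<omega>)\<^sup>2)) \<partial>M) \<partial>lborel)"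
      by (subst nn_integral_swap) (auto simp: nn_integral_multc)
    also have "\<dots> \<le> (\<integral>\<^sup>+u. ennreal (L\<^sup>2 * \<epsilon> powr \<theta> * (1 + C1)) * indicator {s..t} u \<partial>lborel)"
    proof (intro nn_integral_mono)
      fix u
      show "(\<integral>\<^sup>+\<omega>. ennreal (L\<^sup>2 * \<epsilon> powr \<theta>) * (1 + ennreal (1 / \<epsilon>) * ennreal ((Y u \<omega> - Y s \<omega>)\<^sup>2)) \<partial>M) * indicator {s..t} u
        \<le> ennreal (L\<^sup>2 * \<epsilon> powr \<theta> * (1 + C1)) * indicator {s..t} u"
      proof (cases "u \<in> {s..t}")
        case True
        have "(\<integral>\<^sup>+\<omega>. ennreal (L\<^sup>2 * \<epsilon> powr \<theta>) * (1 + ennreal (1 / \<epsilon>) * ennreal ((Y u \<omega> - Y s \<omega>)\<^sup>2)) \<partial>M)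
           = ennreal (L\<^sup>2 * \<epsilon> powr \<theta>) * (1 + ennreal (1 / \<epsilon>) * (\<integral>\<^sup>+\<omega>. ennreal ((Y u \<omega> - Y s \<omega>)\<^sup>2) \<partial>M))"
          by (simp add: nn_integral_cmult nn_integral_add emeasure_space_1)
        also have "\<dots> \<le> ennreal (L\<^sup>2 * \<epsilon> powr \<theta>) * (1 + ennreal (1 / \<epsilon>) * ennreal (C1 * (u - s)))"
          using True st by (intro mult_left_mono add_left_mono incr) auto
        also have "\<dots> \<le> ennreal (L\<^sup>2 * \<epsilon> powr \<theta>) * (1 + ennreal (1 / \<epsilon>) * ennreal (C1 * \<epsilon>))"
          using True C1 by (intro mult_left_mono add_left_mono ennreal_leI) (auto simp: \<epsilon>_def)
        also have "ennreal (1 / \<epsilon>) * ennreal (C1 * \<epsilon>) = ennreal C1"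
          using e C1 by (simp flip: ennreal_mult)
        also have "ennreal (L\<^sup>2 * \<epsilon> powr \<theta>) * (1 + ennreal C1) = ennreal (L\<^sup>2 * \<epsilon> powr \<theta> * (1 + C1))"
          using C1 by (simp add: ennreal_mult)
        finally show ?thesis using True by simp
      qed simp
    qed
    also have "\<dots> = ennreal (L\<^sup>2 * \<epsilon> powr \<theta> * (1 + C1)) * ennreal \<epsilon>"
      using st by (simp add: nn_integral_cmult_indicator \<epsilon>_def)
    also have "\<dots> = ennreal (L\<^sup>2 * (1 + C1) * \<epsilon> powr (1 + \<theta>))"
      using e C1 by (simp add: powr_add ac_simps flip: ennreal_mult)
    finally have mart: "(\<integral>\<^sup>+\<omega>. ennreal ((martingale_part s t \<omega> - \<sigma> (W \<omega>) * (B t \<omega> - B s \<omega>))\<^sup>2) \<partial>M)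
      \<le> ennreal (L\<^sup>2 * (1 + C1) * \<epsilon> powr (1 + \<theta>))" .
    have drft: "(\<integral>\<^sup>+\<omega>. ennreal ((drift s t \<omega>)\<^sup>2) \<partial>M) \<le> ennreal (P * \<epsilon>\<^sup>2)"
      unfolding P_def \<epsilon>_def using C st by (intro drift_second_moment[where T = T]) auto
    have "(\<integral>\<^sup>+\<omega>. ennreal ((Y t \<omega> - Y s \<omega> - \<sigma> (W \<omega>) * (B t \<omega> - B s \<omega>))\<^sup>2) \<partial>M)
      \<le> ennreal (2 * (L\<^sup>2 * (1 + C1) * \<epsilon> powr (1 + \<theta>)) + 2 * (P * \<epsilon>\<^sup>2))"
      by (rule square_moment_split[OF _ mart drft]) (use P C1 in auto)
    also have "\<dots> \<le> ennreal (C2 * \<epsilon> powr (1 + \<theta>))"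
    proof (rule ennreal_leI)
      have "\<epsilon>\<^sup>2 = \<epsilon> powr 2" using e by (simp add: powr_numeral)
      also have "\<dots> \<le> \<epsilon> powr (1 + \<theta>)" using e \<theta> by (intro powr_mono') auto
      finally have "P * \<epsilon>\<^sup>2 \<le> P * \<epsilon> powr (1 + \<theta>)" using P by (intro mult_left_mono)
      then show "2 * (L\<^sup>2 * (1 + C1) * \<epsilon> powr (1 + \<theta>)) + 2 * (P * \<epsilon>\<^sup>2) \<le> C2 * \<epsilon> powr (1 + \<theta>)"
        by (simp add: C2_def algebra_simps)
    qed
    finally show ?thesis by (simp add: \<epsilon>_def)
  qed
  show thesis
  proof (rule that[of "max C1 C2"])
    show "0 \<le> max C1 C2" using C1 by simp
    show "(\<integral>\<^sup>+\<omega>. ennreal ((Y t \<omega> - Y s \<omega>)\<^sup>2) \<partial>M) \<le> ennreal (max C1 C2 * (t - s))"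
      if "0 \<le> s" "s \<le> t" "t \<le> T" for s t
      using that by (intro order_trans[OF incr[OF that]] ennreal_leI mult_right_mono) auto
    show "(\<integral>\<^sup>+\<omega>. ennreal ((Y t \<omega> - Y s \<omega> - \<sigma> (W \<omega>) * (B t \<omega> - B s \<omega>))\<^sup>2) \<partial>M) \<le> ennreal (max C1 C2 * (t - s) powr (1 + \<theta>))"
      if "0 \<le> s" "s < t" "t \<le> T" "t - s \<le> 1" "W \<in> borel_measurable (F s)" "AE \<omega> in M. W \<omega> = Y s \<omega>" for s t W
      using that by (intro order_trans[OF euler[OF that]] ennreal_leI mult_right_mono) auto
  qed
qed

end

section \<open>Gaussian smoothing and box averages\<close>

lemma normal_density_mono_abs:
  assumes "0 < s" "\<bar>y\<bar> \<le> \<bar>z\<bar>"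
  shows "normal_density 0 s z \<le> normal_density 0 s y"
proof -
  have "y\<^sup>2 \<le> z\<^sup>2" using assms(2) by (simp add: abs_le_square_iff)
  then have "- z\<^sup>2 / (2 * s\<^sup>2) \<le> - y\<^sup>2 / (2 * s\<^sup>2)" using assms(1) by (intro divide_right_mono) auto
  then show ?thesis unfolding normal_density_def by (intro mult_left_mono) auto
qed

lemma normal_density_le: "0 < s \<Longrightarrow> normal_density 0 s z \<le> 1 / s"
proof -
  assume s: "0 < s"
  have "normal_density 0 s z \<le> normal_density 0 s 0" using s by (intro normal_density_mono_abs) auto
  also have "\<dots> = 1 / sqrt (2 * pi * s\<^sup>2)" by (simp add: normal_density_def)
  also have "\<dots> \<le> 1 / s"
  proof -
    have "s\<^sup>2 * 1 \<le> s\<^sup>2 * (2 * pi)" using pi_ge_two by (intro mult_left_mono) auto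
    then have "s \<le> sqrt (2 * pi * s\<^sup>2)" by (intro real_le_rsqrt) (simp add: mult.commute)
    then show ?thesis using s by (intro divide_left_mono) (auto intro: mult_pos_pos)
  qed
  finally show ?thesis .
qed

lemma integrable_normal_times_bounded:
  fixes \<psi> :: "real \<Rightarrow> real"
  assumes "0 < s" and [measurable]: "\<psi> \<in> borel_measurable borel" and "\<And>z. \<bar>\<psi> z\<bar> \<le> c"
  shows "integrable lborel (\<lambda>z. normal_density 0 s z * \<psi> z)"
proof (rule Bochner_Integration.integrable_bound)
  show "integrable lborel (\<lambda>z. c * normal_density 0 s z)" using assms(1) by simp
  show "AE z in lborel. norm (normal_density 0 s z * \<psi> z) \<le> norm (c * normal_density 0 s z)"
  proof (rule AE_I2)
    fix z
    have "normal_density 0 s z * \<bar>\<psi> z\<bar> \<le> normal_density 0 s z * \<bar>c\<bar>"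
      using assms(3)[of z] by (intro mult_left_mono) auto
    then show "norm (normal_density 0 s z * \<psi> z) \<le> norm (c * normal_density 0 s z)"
      by (simp add: abs_mult mult.commute)
  qed
qed measurable

text \<open>The centred normal density dominates its translate by \<open>d\<close> exactly to the left of \<open>d / 2\<close>. So the extremal \<open>\<psi>\<close>
is the indicator of that half line, for which the difference is the mass of an interval of length \<open>d\<close>.\<close>

lemma normal_shift_le_nonneg:
  fixes \<psi> :: "real \<Rightarrow> real"
  assumes s: "0 < s" and [measurable]: "\<psi> \<in> borel_measurable borel"
    and \<psi>: "\<And>z. 0 \<le> \<psi> z" "\<And>z. \<psi> z \<le> 1" and d: "0 \<le> d"
  shows "(\<integral>z. normal_density 0 s z * \<psi> z \<partial>lborel) - (\<integral>z. normal_density 0 s z * \<psi> (z + d) \<partial>lborel) \<le> d / s"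
proof -
  let ?g = "normal_density 0 s"
  have int: "integrable lborel (\<lambda>z. ?g z * \<eta> z)"
    if "\<eta> \<in> borel_measurable borel" "\<And>z. 0 \<le> \<eta> z" "\<And>z. \<eta> z \<le> 1" for \<eta> :: "real \<Rightarrow> real"
    using that by (intro integrable_normal_times_bounded[OF s, of _ 1]) (auto simp: abs_le_iff order_trans[of _ 0])
  have shift: "integrable lborel (\<lambda>z. ?g (z - d) * \<eta> z)"
    "(\<integral>z. ?g (z - d) * \<eta> z \<partial>lborel) = (\<integral>z. ?g z * \<eta> (z + d) \<partial>lborel)"
    if "\<eta> \<in> borel_measurable borel" "\<And>z. 0 \<le> \<eta> z" "\<And>z. \<eta> z \<le> 1" for \<eta> :: "real \<Rightarrow> real"
  proof -
    have "integrable lborel (\<lambda>z. ?g z * \<eta> (z + d))"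
      using that by (intro int measurable_compose[OF _ that(1)]) auto
    from lborel_integrable_real_affine[OF this, of 1 "- d"]
    show "integrable lborel (\<lambda>z. ?g (z - d) * \<eta> z)" by (simp add: algebra_simps)
    show "(\<integral>z. ?g (z - d) * \<eta> z \<partial>lborel) = (\<integral>z. ?g z * \<eta> (z + d) \<partial>lborel)"
      by (subst lborel_integral_real_affine[of 1 _ d]) (auto simp: algebra_simps)
  qed
  let ?i = "\<lambda>a z. indicator {..a} z :: real"
  have "(\<integral>z. ?g z * \<psi> z \<partial>lborel) - (\<integral>z. ?g z * \<psi> (z + d) \<partial>lborel) = (\<integral>z. ?g z * \<psi> z - ?g (z - d) * \<psi> z \<partial>lborel)"
    using int[of \<psi>] shift[of \<psi>] \<psi> by (simp add: Bochner_Integration.integral_diff)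
  also have "\<dots> \<le> (\<integral>z. ?g z * ?i (d / 2) z - ?g (z - d) * ?i (d / 2) z \<partial>lborel)"
  proof (rule integral_mono)
    show "integrable lborel (\<lambda>z. ?g z * \<psi> z - ?g (z - d) * \<psi> z)"
      "integrable lborel (\<lambda>z. ?g z * ?i (d / 2) z - ?g (z - d) * ?i (d / 2) z)"
      using \<psi> by (auto intro!: Bochner_Integration.integrable_diff int shift)
    fix z
    show "?g z * \<psi> z - ?g (z - d) * \<psi> z \<le> ?g z * ?i (d / 2) z - ?g (z - d) * ?i (d / 2) z"
    proof (cases "z \<le> d / 2")
      case True
      then have "?g (z - d) \<le> ?g z" using s d by (intro normal_density_mono_abs) auto
      then have "(?g z - ?g (z - d)) * \<psi> z \<le> (?g z - ?g (z - d)) * 1" using \<psi> by (intro mult_left_mono) auto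
      then show ?thesis using True by (simp add: algebra_simps)
    next
      case False
      then have "?g z \<le> ?g (z - d)" using s d by (intro normal_density_mono_abs) auto
      then have "(?g z - ?g (z - d)) * \<psi> z \<le> 0" using \<psi> by (intro mult_nonpos_nonneg) auto
      then show ?thesis using False by (simp add: algebra_simps)
    qed
  qed
  also have "\<dots> = (\<integral>z. ?g z * ?i (d / 2) z \<partial>lborel) - (\<integral>z. ?g (z - d) * ?i (d / 2) z \<partial>lborel)"
    by (intro Bochner_Integration.integral_diff int shift) auto
  also have "(\<integral>z. ?g (z - d) * ?i (d / 2) z \<partial>lborel) = (\<integral>z. ?g z * ?i (- d / 2) z \<partial>lborel)"
    by (subst shift(2)) (auto intro!: Bochner_Integration.integral_cong simp: indicator_def)
  also have "(\<integral>z. ?g z * ?i (d / 2) z \<partial>lborel) - \<dots> = (\<integral>z. ?g z * ?i (d / 2) z - ?g z * ?i (- d / 2) z \<partial>lborel)"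
    by (intro Bochner_Integration.integral_diff[symmetric] int) auto
  also have "\<dots> \<le> (\<integral>z. 1 / s * indicator {- d / 2..d / 2} z \<partial>lborel)"
  proof (rule integral_mono)
    show "integrable lborel (\<lambda>z. ?g z * ?i (d / 2) z - ?g z * ?i (- d / 2) z)"
      by (intro Bochner_Integration.integrable_diff int) auto
    show "?g z * ?i (d / 2) z - ?g z * ?i (- d / 2) z \<le> 1 / s * indicator {- d / 2..d / 2} z" for z
      using normal_density_le[OF s, of z] s d by (auto simp: indicator_def)
  qed (use d in \<open>auto intro!: integrable_mult_right\<close>)
  also have "\<dots> = d / s" using d by simp
  finally show ?thesis .
qed

lemma normal_shift_le:
  fixes \<psi> :: "real \<Rightarrow> real"
  assumes s: "0 < s" and [measurable]: "\<psi> \<in> borel_measurable borel"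
    and \<psi>: "\<And>z. 0 \<le> \<psi> z" "\<And>z. \<psi> z \<le> 1"
  shows "(\<integral>z. normal_density 0 s z * \<psi> z \<partial>lborel) - (\<integral>z. normal_density 0 s z * \<psi> (z + d) \<partial>lborel) \<le> \<bar>d\<bar> / s"
proof (cases "0 \<le> d")
  case True
  then show ?thesis using normal_shift_le_nonneg[OF assms(1,2) \<psi>, of d] by simp
next
  case False
  have refl: "(\<integral>z. normal_density 0 s z * \<eta> z \<partial>lborel) = (\<integral>z. normal_density 0 s z * \<eta> (- z) \<partial>lborel)" for \<eta> :: "real \<Rightarrow> real"
    by (subst lborel_integral_real_affine[of "-1" _ 0]) (auto simp: normal_density_def)
  have "(\<integral>z. normal_density 0 s z * \<psi> (- z) \<partial>lborel) - (\<integral>z. normal_density 0 s z * \<psi> (- (z + - d)) \<partial>lborel) \<le> (- d) / s"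
    using False \<psi> by (intro normal_shift_le_nonneg[OF s, of "\<lambda>z. \<psi> (- z)" "- d"]) auto
  moreover have "(\<integral>z. normal_density 0 s z * \<psi> (- (z + - d)) \<partial>lborel) = (\<integral>z. normal_density 0 s z * \<psi> (z + d) \<partial>lborel)"
    using refl[of "\<lambda>z. \<psi> (z + d)"] by simp
  ultimately show ?thesis using refl[of \<psi>] False by simp
qed

text \<open>A smoothing of the indicator of \<open>U\<close> at scale \<open>h\<close>. One-sided boxes are used because doubling \<open>h\<close> then averages two
translates, so that consecutive scales differ only by a translation.\<close>

definition box_average :: "real set \<Rightarrow> real \<Rightarrow> real \<Rightarrow> real" where
  "box_average U h y = measure lborel (U \<inter> {y..y + h}) / h"

lemma Icc_fmeasurable: "{y..z :: real} \<in> fmeasurable lborel"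
  by (simp add: fmeasurable_def emeasure_lborel_Icc_eq)

context
  fixes U :: "real set" and h :: real
  assumes U: "open U" and h: "0 < h"
begin

lemma box_piece_fmeasurable: "U \<inter> {y..z} \<in> fmeasurable lborel"
  using fmeasurable_Int_fmeasurable[OF Icc_fmeasurable[of y z], of U] U by (simp add: Int_commute)

lemma box_average_nonneg: "0 \<le> box_average U h y"
  using h by (simp add: box_average_def)

lemma box_average_le_one: "box_average U h y \<le> 1"
proof -
  have "measure lborel (U \<inter> {y..y + h}) \<le> measure lborel {y..y + h}"
    using U by (intro measure_mono_fmeasurable Icc_fmeasurable) auto
  then show ?thesis using h by (simp add: box_average_def)
qed

lemma box_average_le_measure: "U \<in> fmeasurable lborel \<Longrightarrow> box_average U h y \<le> measure lborel U / h"
  unfolding box_average_def using h box_piece_fmeasurable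
  by (intro divide_right_mono measure_mono_fmeasurable) (auto simp: fmeasurable_def)

lemma box_average_lipschitz: "\<bar>box_average U h y - box_average U h z\<bar> \<le> \<bar>y - z\<bar> / h"
proof -
  have le: "\<bar>measure lborel (U \<inter> {y..y + h}) - measure lborel (U \<inter> {z..z + h})\<bar> \<le> z - y" if "y \<le> z" for y z
  proof -
    have cover: "measure lborel (U \<inter> {p..p + h}) \<le> measure lborel (U \<inter> {p'..p' + h}) + (z - y)"
      if "U \<inter> {p..p + h} \<subseteq> U \<inter> {p'..p' + h} \<union> {w..w + (z - y)}" for p p' w
    proof -
      have "measure lborel (U \<inter> {p..p + h}) \<le> measure lborel (U \<inter> {p'..p' + h} \<union> {w..w + (z - y)})"
        using U by (intro measure_mono_fmeasurable that fmeasurable.Un box_piece_fmeasurable Icc_fmeasurable) auto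
      also have "\<dots> \<le> measure lborel (U \<inter> {p'..p' + h}) + measure lborel {w..w + (z - y)}"
        using U by (intro measure_Un_le) auto
      finally show ?thesis using \<open>y \<le> z\<close> by simp
    qed
    have 1: "U \<inter> {y..y + h} \<subseteq> U \<inter> {z..z + h} \<union> {y..y + (z - y)}" using that by auto
    have 2: "U \<inter> {z..z + h} \<subseteq> U \<inter> {y..y + h} \<union> {y + h..(y + h) + (z - y)}" using that by auto
    show ?thesis using cover[OF 1] cover[OF 2] by (simp add: abs_le_iff)
  qed
  have "\<bar>measure lborel (U \<inter> {y..y + h}) - measure lborel (U \<inter> {z..z + h})\<bar> \<le> \<bar>y - z\<bar>"
    using le[of y z] le[of z y] by (cases "y \<le> z") auto
  then have "\<bar>measure lborel (U \<inter> {y..y + h}) - measure lborel (U \<inter> {z..z + h})\<bar> / h \<le> \<bar>y - z\<bar> / h"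
    using h by (intro divide_right_mono) auto
  then show ?thesis using h by (simp add: box_average_def abs_divide flip: diff_divide_distrib)
qed

lemma box_average_measurable: "box_average U h \<in> borel_measurable borel"
proof -
  have "(1 / h)-lipschitz_on UNIV (box_average U h)"
    using h box_average_lipschitz by (intro lipschitz_onI) (auto simp: dist_real_def)
  then show ?thesis by (intro borel_measurable_continuous_onI lipschitz_on_continuous_on)
qed

lemma box_average_double: "box_average U (2 * h) y = (box_average U h y + box_average U h (y + h)) / 2"
proof -
  have eq: "U \<inter> {y..y + 2 * h} = (U \<inter> {y..y + h}) \<union> (U \<inter> {y + h..y + h + h})" using h by auto
  have "measure lborel (U \<inter> {y..y + 2 * h}) = measure lborel (U \<inter> {y..y + h}) + measure lborel (U \<inter> {y + h..y + h + h})"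
    unfolding eq
  proof (rule measure_Un_AE)
    show "AE x in lborel. x \<notin> U \<inter> {y..y + h} \<or> x \<notin> U \<inter> {y + h..y + h + h}"
      using AE_lborel_singleton[of "y + h"] by eventually_elim auto
  qed (use box_piece_fmeasurable in auto)
  then show ?thesis by (simp add: box_average_def add_divide_distrib)
qed

end

lemma box_average_eventually_one:
  assumes "open U" "y \<in> U" and H: "H \<longlonglongrightarrow> (0 :: real)" "\<And>n :: nat. 0 < H n"
  shows "eventually (\<lambda>n. box_average U (H n) y = 1) sequentially"
proof -
  obtain e where e: "0 < e" "ball y e \<subseteq> U" using assms openE by blast
  have "eventually (\<lambda>n. H n < e) sequentially" using H e by (intro order_tendstoD) auto
  then show ?thesis
  proof eventually_elim
    case (elim n)
    have "{y..y + H n} \<subseteq> ball y e" using elim H(2)[of n] by (auto simp: dist_real_def)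
    then have "U \<inter> {y..y + H n} = {y..y + H n}" using e by auto
    then show ?case using H(2)[of n] by (simp add: box_average_def)
  qed
qed

context brownian_basis
begin

text \<open>Conditioning on the past, in the form of Fubini's theorem for the product law of \<open>W\<close> and the increment.\<close>

lemma expectation_increment_le:
  fixes \<Psi> :: "real \<Rightarrow> real \<Rightarrow> real"
  assumes W: "W \<in> borel_measurable (F s)" and st: "0 \<le> s" "s < t"
    and [measurable]: "(\<lambda>(w, z). \<Psi> w z) \<in> borel_measurable (borel \<Otimes>\<^sub>M borel)"
    and bound: "\<And>w z. \<bar>\<Psi> w z\<bar> \<le> C"
    and le: "\<And>w. (\<integral>z. normal_density 0 (sqrt (t - s)) z * \<Psi> w z \<partial>lborel) \<le> c"
  shows "expectation (\<lambda>\<omega>. \<Psi> (W \<omega>) (B t \<omega> - B s \<omega>)) \<le> c"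
proof -
  define \<Delta> where "\<Delta> \<omega> = B t \<omega> - B s \<omega>" for \<omega>
  have [measurable]: "B s \<in> borel_measurable M" "B t \<in> borel_measurable M" "W \<in> borel_measurable M"
    using B_measurable st F_measurable_M[OF W st(1)] by auto
  have [measurable]: "\<Delta> \<in> borel_measurable M" unfolding \<Delta>_def by measurable
  interpret PW: prob_space "distr M borel W" by (rule prob_space_distr) measurable
  interpret PD: prob_space "distr M borel \<Delta>" by (rule prob_space_distr) measurable
  interpret P: pair_prob_space "distr M borel W" "distr M borel \<Delta>" ..
  have joint: "distr M (borel \<Otimes>\<^sub>M borel) (\<lambda>\<omega>. (W \<omega>, \<Delta> \<omega>)) = distr M borel W \<Otimes>\<^sub>M distr M borel \<Delta>"
    using increment_indep[OF W st] unfolding indep_var_distribution_eq \<Delta>_def by simp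
  have int: "integrable (distr M borel W \<Otimes>\<^sub>M distr M borel \<Delta>) (\<lambda>(w, z). \<Psi> w z)"
    using bound by (intro P.P.integrable_const_bound[where B = C]) auto
  have "expectation (\<lambda>\<omega>. \<Psi> (W \<omega>) (\<Delta> \<omega>)) = (\<integral>p. (\<lambda>(w, z). \<Psi> w z) p \<partial>distr M (borel \<Otimes>\<^sub>M borel) (\<lambda>\<omega>. (W \<omega>, \<Delta> \<omega>)))"
    by (subst integral_distr) auto
  also have "\<dots> = (\<integral>w. (\<integral>z. \<Psi> w z \<partial>distr M borel \<Delta>) \<partial>distr M borel W)"
    unfolding joint using P.integral_fst'[OF int] by simp
  also have "\<dots> \<le> (\<integral>w. c \<partial>distr M borel W)"
  proof (rule integral_mono)
    show "integrable (distr M borel W) (\<lambda>w. \<integral>z. \<Psi> w z \<partial>distr M borel \<Delta>)"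
      using P.integrable_fst'[OF int] by simp
    fix w
    have [measurable]: "\<Psi> w \<in> borel_measurable borel" by measurable
    have "(\<integral>z. \<Psi> w z \<partial>distr M borel \<Delta>) = expectation (\<lambda>\<omega>. \<Psi> w (\<Delta> \<omega>))"
      by (subst integral_distr) auto
    also have "\<dots> = (\<integral>z. normal_density 0 (sqrt (t - s)) z * \<Psi> w z \<partial>lborel)"
      unfolding \<Delta>_def using distributed_integral[OF increment_distributed[OF st], of "\<Psi> w"] by simp
    finally show "(\<integral>z. \<Psi> w z \<partial>distr M borel \<Delta>) \<le> c" using le by simp
  qed simp
  also have "\<dots> = c" using PW.prob_space by simp
  finally show ?thesis unfolding \<Delta>_def .
qed

end

section \<open>Comparing consecutive scales\<close>

lemma (in prob_space) integrable_of_square_moment: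
  assumes [measurable]: "f \<in> borel_measurable M" and "(\<integral>\<^sup>+\<omega>. ennreal ((f \<omega>)\<^sup>2) \<partial>M) \<le> ennreal C" and "0 \<le> C"
  shows "integrable M (\<lambda>\<omega>. (f \<omega>)\<^sup>2)" "expectation (\<lambda>\<omega>. (f \<omega>)\<^sup>2) \<le> C"
proof -
  have "(\<integral>\<^sup>+\<omega>. ennreal ((f \<omega>)\<^sup>2) \<partial>M) < \<infinity>" using assms(2) by (auto simp: le_less_trans)
  then show i: "integrable M (\<lambda>\<omega>. (f \<omega>)\<^sup>2)" by (intro integrableI_nonneg) auto
  have "ennreal (expectation (\<lambda>\<omega>. (f \<omega>)\<^sup>2)) \<le> ennreal C"
    using nn_integral_eq_integral[OF i] assms(2) by simp
  then show "expectation (\<lambda>\<omega>. (f \<omega>)\<^sup>2) \<le> C" using assms(3) by (simp add: ennreal_le_iff)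
qed

lemma powr_le_scaled_square:
  fixes y \<epsilon> p :: real
  assumes "0 < \<epsilon>" "0 \<le> p" "p \<le> 1"
  shows "\<bar>y\<bar> powr p \<le> \<epsilon> powr (p / 2) * (1 + y\<^sup>2 / \<epsilon>)"
proof -
  have "\<bar>y\<bar> = sqrt \<epsilon> * (\<bar>y\<bar> / sqrt \<epsilon>)" using assms by simp
  then have "\<bar>y\<bar> powr p = (sqrt \<epsilon> * (\<bar>y\<bar> / sqrt \<epsilon>)) powr p" by (rule arg_cong)
  also have "\<dots> = sqrt \<epsilon> powr p * (\<bar>y\<bar> / sqrt \<epsilon>) powr p" by (rule powr_mult)
  also have "sqrt \<epsilon> powr p = \<epsilon> powr (p / 2)"
    using assms by (simp add: powr_half_sqrt[symmetric] powr_powr mult.commute)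
  also have "(\<bar>y\<bar> / sqrt \<epsilon>) powr p \<le> 1 + y\<^sup>2 / \<epsilon>"
  proof (cases "\<bar>y\<bar> / sqrt \<epsilon> \<le> 1")
    case True
    then have "(\<bar>y\<bar> / sqrt \<epsilon>) powr p \<le> 1" using assms by (intro powr_le1) auto
    moreover have "0 \<le> y\<^sup>2 / \<epsilon>" using assms by simp
    ultimately show ?thesis by linarith
  next
    case False
    then have "(\<bar>y\<bar> / sqrt \<epsilon>) powr p \<le> (\<bar>y\<bar> / sqrt \<epsilon>) powr 2" using assms by (intro powr_mono) auto
    also have "\<dots> = (\<bar>y\<bar> / sqrt \<epsilon>)\<^sup>2" using assms by (intro powr_numeral) auto
    also have "\<dots> = y\<^sup>2 / \<epsilon>" using assms by (simp add: power_divide)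
    finally show ?thesis by simp
  qed
  finally show ?thesis using assms by (simp add: mult_left_mono)
qed

context regular_sde
begin

text \<open>A cutoff that vanishes for \<open>\<bar>\<sigma> y\<bar> \<le> \<delta>\<close> and equals one for \<open>\<bar>\<sigma> y\<bar> \<ge> 2 \<delta>\<close>. It has to be Hoelder continuous,
unlike an indicator, because its argument is moved from time \<open>t\<close> to an earlier time.\<close>

definition nondegenerate :: "real \<Rightarrow> real \<Rightarrow> real" where
  "nondegenerate \<delta> y = min 1 (max 0 (\<bar>\<sigma> y\<bar> / \<delta> - 1))"

lemma nondegenerate_range: "0 \<le> nondegenerate \<delta> y" "nondegenerate \<delta> y \<le> 1"
  by (auto simp: nondegenerate_def)

lemma nondegenerate_measurable [measurable]: "nondegenerate \<delta> \<in> borel_measurable borel"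
  unfolding nondegenerate_def by measurable

lemma nondegenerate_support: "0 < \<delta> \<Longrightarrow> nondegenerate \<delta> y \<noteq> 0 \<Longrightarrow> \<delta> \<le> \<bar>\<sigma> y\<bar>"
  by (auto simp: nondegenerate_def max_def min_def field_simps split: if_splits)

lemma nondegenerate_eq_one: "0 < \<delta> \<Longrightarrow> 2 * \<delta> \<le> \<bar>\<sigma> y\<bar> \<Longrightarrow> nondegenerate \<delta> y = 1"
  by (auto simp: nondegenerate_def max_def min_def field_simps)

lemma nondegenerate_holder:
  assumes "0 < \<delta>"
  shows "\<bar>nondegenerate \<delta> y - nondegenerate \<delta> z\<bar> \<le> L / \<delta> * \<bar>y - z\<bar> powr \<theta>"
proof -
  have "\<bar>nondegenerate \<delta> y - nondegenerate \<delta> z\<bar> \<le> \<bar>\<bar>\<sigma> y\<bar> / \<delta> - \<bar>\<sigma> z\<bar> / \<delta>\<bar>"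
    unfolding nondegenerate_def by linarith
  also have "\<dots> = \<bar>\<bar>\<sigma> y\<bar> - \<bar>\<sigma> z\<bar>\<bar> / \<delta>"
    using assms by (simp add: abs_divide flip: diff_divide_distrib)
  also have "\<dots> \<le> \<bar>\<sigma> y - \<sigma> z\<bar> / \<delta>" using assms by (intro divide_right_mono) auto
  also have "\<dots> \<le> (L * \<bar>y - z\<bar> powr \<theta>) / \<delta>" using assms by (intro divide_right_mono holder) auto
  finally show ?thesis by simp
qed

text \<open>A translation of the box average by \<open>h\<close> amounts to a translation of the Gaussian increment by \<open>h / \<sigma> (W \<omega>)\<close>, and
\<open>\<bar>\<sigma> (W \<omega>)\<bar> \<ge> \<delta>\<close> on the support of the cutoff.\<close>

lemma gaussian_step_le:
  assumes U: "open U" and h: "0 < h" and d: "0 < \<delta>" and st: "0 \<le> s" "s < t"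
    and W: "W \<in> borel_measurable (F s)"
  shows "expectation (\<lambda>\<omega>. nondegenerate \<delta> (W \<omega>) *
      (box_average U h (W \<omega> + \<sigma> (W \<omega>) * (B t \<omega> - B s \<omega>)) - box_average U (2 * h) (W \<omega> + \<sigma> (W \<omega>) * (B t \<omega> - B s \<omega>))))
    \<le> h / (\<delta> * sqrt (t - s))"
proof -
  let ?A = "box_average U h"
  have [measurable]: "?A \<in> borel_measurable borel" by (rule box_average_measurable[OF U h])
  define \<Psi> where "\<Psi> w z = nondegenerate \<delta> w * ((?A (w + \<sigma> w * z) - ?A (w + \<sigma> w * z + h)) / 2)" for w z
  have rng: "0 \<le> ?A y" "?A y \<le> 1" for y
    using box_average_nonneg[OF U h] box_average_le_one[OF U h] by auto
  have "expectation (\<lambda>\<omega>. \<Psi> (W \<omega>) (B t \<omega> - B s \<omega>)) \<le> h / (\<delta> * sqrt (t - s))"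
  proof (rule expectation_increment_le[OF W st, where C = 1])
    show "(\<lambda>(w, z). \<Psi> w z) \<in> borel_measurable (borel \<Otimes>\<^sub>M borel)" unfolding \<Psi>_def by measurable
    show "\<bar>\<Psi> w z\<bar> \<le> 1" for w z
    proof -
      have "\<bar>(?A (w + \<sigma> w * z) - ?A (w + \<sigma> w * z + h)) / 2\<bar> \<le> 1"
        using rng[of "w + \<sigma> w * z"] rng[of "w + \<sigma> w * z + h"] by (simp add: abs_le_iff)
      then have "\<bar>nondegenerate \<delta> w\<bar> * \<bar>(?A (w + \<sigma> w * z) - ?A (w + \<sigma> w * z + h)) / 2\<bar> \<le> 1 * 1"
        using nondegenerate_range[of \<delta> w] by (intro mult_mono) auto
      then show ?thesis unfolding \<Psi>_def abs_mult by simp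
    qed
    fix w
    let ?g = "normal_density 0 (sqrt (t - s))"
    show "(\<integral>z. ?g z * \<Psi> w z \<partial>lborel) \<le> h / (\<delta> * sqrt (t - s))"
    proof (cases "nondegenerate \<delta> w = 0")
      case True
      then show ?thesis using h d st by (simp add: \<Psi>_def)
    next
      case False
      from nondegenerate_support[OF d False] have sw: "\<delta> \<le> \<bar>\<sigma> w\<bar>" "\<sigma> w \<noteq> 0" using d by auto
      define \<psi> where "\<psi> z = ?A (w + \<sigma> w * z)" for z
      have [measurable]: "\<psi> \<in> borel_measurable borel" unfolding \<psi>_def by measurable
      have \<psi>: "0 \<le> \<psi> z" "\<psi> z \<le> 1" "\<bar>\<psi> z\<bar> \<le> 1" for z using rng[of "w + \<sigma> w * z"] by (auto simp: \<psi>_def)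
      have int: "integrable lborel (\<lambda>z. ?g z * \<psi> z)" "integrable lborel (\<lambda>z. ?g z * \<psi> (z + h / \<sigma> w))"
        using st \<psi> by (auto intro!: integrable_normal_times_bounded[of _ _ 1])
      have shift: "w + \<sigma> w * z + h = w + \<sigma> w * (z + h / \<sigma> w)" for z using sw by (simp add: distrib_left)
      have factor: "g * (n * ((p - q) / 2)) = n / 2 * (g * p - g * q)" for g n p q :: real by (simp add: field_simps)
      have "(\<integral>z. ?g z * \<Psi> w z \<partial>lborel) = (\<integral>z. nondegenerate \<delta> w / 2 * (?g z * \<psi> z - ?g z * \<psi> (z + h / \<sigma> w)) \<partial>lborel)"
        unfolding \<Psi>_def \<psi>_def shift by (intro Bochner_Integration.integral_cong refl factor)
      also have "\<dots> = nondegenerate \<delta> w / 2 * ((\<integral>z. ?g z * \<psi> z \<partial>lborel) - (\<integral>z. ?g z * \<psi> (z + h / \<sigma> w) \<partial>lborel))"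
        using int by simp
      also have "\<dots> \<le> nondegenerate \<delta> w / 2 * (\<bar>h / \<sigma> w\<bar> / sqrt (t - s))"
        using st \<psi> nondegenerate_range[of \<delta> w] by (intro mult_left_mono normal_shift_le) auto
      also have "\<dots> \<le> 1 * (\<bar>h / \<sigma> w\<bar> / sqrt (t - s))"
        using st nondegenerate_range[of \<delta> w] by (intro mult_right_mono) auto
      also have "\<dots> \<le> h / (\<delta> * sqrt (t - s))"
        using sw d h st by (auto simp: abs_divide intro!: divide_left_mono mult_right_mono mult_pos_pos)
      finally show ?thesis .
    qed
  qed
  moreover have "\<Psi> (W \<omega>) (B t \<omega> - B s \<omega>) = nondegenerate \<delta> (W \<omega>) *
      (?A (W \<omega> + \<sigma> (W \<omega>) * (B t \<omega> - B s \<omega>)) - box_average U (2 * h) (W \<omega> + \<sigma> (W \<omega>) * (B t \<omega> - B s \<omega>)))" for \<omega>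
    unfolding \<Psi>_def box_average_double[OF U h] by (simp add: field_simps)
  ultimately show ?thesis by simp
qed

lemma scale_step_le:
  assumes t: "0 < t" and d: "0 < \<delta>"
  obtains K where "0 \<le> K" "\<And>U h. open U \<Longrightarrow> 0 < h \<Longrightarrow> h \<le> 1 \<Longrightarrow> h \<le> t \<Longrightarrow>
     expectation (\<lambda>\<omega>. nondegenerate \<delta> (Y t \<omega>) * (box_average U h (Y t \<omega>) - box_average U (2 * h) (Y t \<omega>))) \<le> K * h powr (1 / 8)"
proof -
  obtain C where C: "0 \<le> C"
    "\<And>s r. 0 \<le> s \<Longrightarrow> s \<le> r \<Longrightarrow> r \<le> t \<Longrightarrow> (\<integral>\<^sup>+\<omega>. ennreal ((Y r \<omega> - Y s \<omega>)\<^sup>2) \<partial>M) \<le> ennreal (C * (r - s))"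
    "\<And>s r W. 0 \<le> s \<Longrightarrow> s < r \<Longrightarrow> r \<le> t \<Longrightarrow> r - s \<le> 1 \<Longrightarrow> W \<in> borel_measurable (F s) \<Longrightarrow> AE \<omega> in M. W \<omega> = Y s \<omega> \<Longrightarrow>
       (\<integral>\<^sup>+\<omega>. ennreal ((Y r \<omega> - Y s \<omega> - \<sigma> (W \<omega>) * (B r \<omega> - B s \<omega>))\<^sup>2) \<partial>M) \<le> ennreal (C * (r - s) powr (1 + \<theta>))"
    using one_step_errors[OF t] by blast
  define K where "K = L / \<delta> * (1 + C) + 2 * (1 + C) + 1 / \<delta>"
  have "expectation (\<lambda>\<omega>. nondegenerate \<delta> (Y t \<omega>) * (box_average U h (Y t \<omega>) - box_average U (2 * h) (Y t \<omega>))) \<le> K * h powr (1 / 8)"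
    if U: "open U" and h: "0 < h" "h \<le> 1" "h \<le> t" for U h
  proof -
    \<comment> \<open>With \<open>\<epsilon> = h powr p\<close> the errors have exponents \<open>p \<theta> / 2\<close>, \<open>p (1 + \<theta>) / 2 - 1\<close> and \<open>1 - p / 2\<close>. For \<open>p = 3 / 2\<close> and
\<open>\<theta> > 1 / 2\<close> each of them is at least \<open>1 / 8\<close>.\<close>
    define \<epsilon> where "\<epsilon> = h powr (3 / 2)"
    define s where "s = t - \<epsilon>"
    have "\<epsilon> \<le> h powr 1" unfolding \<epsilon>_def using h by (intro powr_mono') auto
    then have e: "0 < \<epsilon>" "\<epsilon> \<le> h" using h by (auto simp: \<epsilon>_def)
    have s: "0 \<le> s" "s < t" "t - s = \<epsilon>" using e h by (auto simp: s_def)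
    obtain W where W: "W \<in> borel_measurable (F s)" "AE \<omega> in M. W \<omega> = Y s \<omega>" using Y_adapted[OF s(1)] by blast
    have h2: "0 < 2 * h" using h by simp
    have [measurable]: "W \<in> borel_measurable M" "B s \<in> borel_measurable M" "B t \<in> borel_measurable M"
      "box_average U h \<in> borel_measurable borel" "box_average U (2 * h) \<in> borel_measurable borel"
      using F_measurable_M[OF W(1) s(1)] B_measurable s box_average_measurable[OF U h(1)] box_average_measurable[OF U h2] by auto
    define \<psi> where "\<psi> y = box_average U h y - box_average U (2 * h) y" for y
    have [measurable]: "\<psi> \<in> borel_measurable borel" unfolding \<psi>_def by measurable
    have \<psi>1: "\<bar>\<psi> y\<bar> \<le> 1" for y
      using box_average_nonneg[OF U h(1), of y] box_average_le_one[OF U h(1), of y]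
        box_average_nonneg[OF U h2, of y] box_average_le_one[OF U h2, of y]
      by (simp add: \<psi>_def abs_le_iff)
    have \<psi>_lip: "\<bar>\<psi> y - \<psi> z\<bar> \<le> 2 / h * \<bar>y - z\<bar>" for y z
    proof -
      have "\<bar>\<psi> y - \<psi> z\<bar> \<le> \<bar>y - z\<bar> / h + \<bar>y - z\<bar> / (2 * h)"
        using box_average_lipschitz[OF U h(1), of y z] box_average_lipschitz[OF U h2, of y z]
        unfolding \<psi>_def by linarith
      also have "\<dots> \<le> \<bar>y - z\<bar> / h + \<bar>y - z\<bar> / h" using h by (intro add_left_mono divide_left_mono) auto
      finally show ?thesis by simp
    qed
    let ?f = "nondegenerate \<delta>"
    define Z where "Z \<omega> = W \<omega> + \<sigma> (W \<omega>) * (B t \<omega> - B s \<omega>)" for \<omega>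
    define R where "R \<omega> = Y t \<omega> - Y s \<omega> - \<sigma> (W \<omega>) * (B t \<omega> - B s \<omega>)" for \<omega>
    have [measurable]: "Z \<in> borel_measurable M" "R \<in> borel_measurable M" unfolding Z_def R_def by measurable
    have m1: "integrable M (\<lambda>\<omega>. (Y t \<omega> - Y s \<omega>)\<^sup>2)" "expectation (\<lambda>\<omega>. (Y t \<omega> - Y s \<omega>)\<^sup>2) \<le> C * \<epsilon>"
      using C(2)[of s t] s e C(1) by (auto intro!: integrable_of_square_moment)
    have m2: "integrable M (\<lambda>\<omega>. (R \<omega>)\<^sup>2)" "expectation (\<lambda>\<omega>. (R \<omega>)\<^sup>2) \<le> C * \<epsilon> powr (1 + \<theta>)"
      using C(3)[OF s(1,2) _ _ W] s e h C(1) unfolding R_def[symmetric] by (auto intro!: integrable_of_square_moment)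
    let ?b1 = "\<lambda>\<omega>. L / \<delta> * (\<epsilon> powr (\<theta> / 2) * (1 + (Y t \<omega> - Y s \<omega>)\<^sup>2 / \<epsilon>))"
    let ?b2 = "\<lambda>\<omega>. 2 / h * (\<epsilon> powr ((1 + \<theta>) / 2) * (1 + (R \<omega>)\<^sup>2 / \<epsilon> powr (1 + \<theta>)))"
    have int3: "integrable M (\<lambda>\<omega>. ?f (W \<omega>) * \<psi> (Z \<omega>))" "integrable M (\<lambda>\<omega>. ?f (Y t \<omega>) * \<psi> (Y t \<omega>))"
    proof -
      have "\<bar>?f y * \<psi> z\<bar> \<le> 1" for y z
        using mult_mono[of "\<bar>?f y\<bar>" 1 "\<bar>\<psi> z\<bar>" 1] nondegenerate_range[of \<delta> y] \<psi>1[of z] by (simp add: abs_mult)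
      then show "integrable M (\<lambda>\<omega>. ?f (W \<omega>) * \<psi> (Z \<omega>))" "integrable M (\<lambda>\<omega>. ?f (Y t \<omega>) * \<psi> (Y t \<omega>))"
        by (auto intro!: integrable_const_bound[where B = 1])
    qed
    have int1: "integrable M ?b1" and int2: "integrable M ?b2" using m1(1) m2(1) by auto
    have "expectation (\<lambda>\<omega>. ?f (Y t \<omega>) * \<psi> (Y t \<omega>)) \<le> expectation (\<lambda>\<omega>. ?b1 \<omega> + ?b2 \<omega> + ?f (W \<omega>) * \<psi> (Z \<omega>))"
    proof (rule integral_mono_AE)
      show "AE \<omega> in M. ?f (Y t \<omega>) * \<psi> (Y t \<omega>) \<le> ?b1 \<omega> + ?b2 \<omega> + ?f (W \<omega>) * \<psi> (Z \<omega>)"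
        using W(2)
      proof eventually_elim
        case (elim \<omega>)
        have "(?f (Y t \<omega>) - ?f (W \<omega>)) * \<psi> (Y t \<omega>) \<le> \<bar>?f (Y t \<omega>) - ?f (W \<omega>)\<bar> * \<bar>\<psi> (Y t \<omega>)\<bar>"
          unfolding abs_mult[symmetric] by (rule abs_ge_self)
        also have "\<dots> \<le> \<bar>?f (Y t \<omega>) - ?f (W \<omega>)\<bar> * 1" by (intro mult_left_mono \<psi>1) auto
        also have "\<dots> \<le> L / \<delta> * \<bar>Y t \<omega> - Y s \<omega>\<bar> powr \<theta>"
          using nondegenerate_holder[OF d, of "Y t \<omega>" "W \<omega>"] elim by simp
        also have "\<dots> \<le> ?b1 \<omega>"
          using e \<theta> L d by (intro mult_left_mono powr_le_scaled_square) auto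
        finally have 1: "(?f (Y t \<omega>) - ?f (W \<omega>)) * \<psi> (Y t \<omega>) \<le> ?b1 \<omega>" .
        have YZ: "Y t \<omega> - Z \<omega> = R \<omega>" using elim by (simp add: Z_def R_def)
        have "?f (W \<omega>) * (\<psi> (Y t \<omega>) - \<psi> (Z \<omega>)) \<le> \<bar>?f (W \<omega>)\<bar> * \<bar>\<psi> (Y t \<omega>) - \<psi> (Z \<omega>)\<bar>"
          unfolding abs_mult[symmetric] by (rule abs_ge_self)
        also have "\<dots> \<le> 1 * (2 / h * \<bar>R \<omega>\<bar>)"
          using nondegenerate_range[of \<delta> "W \<omega>"] \<psi>_lip[of "Y t \<omega>" "Z \<omega>"] unfolding YZ by (intro mult_mono) auto
        also have "\<dots> \<le> ?b2 \<omega>"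
        proof -
          have "\<bar>R \<omega>\<bar> powr 1 \<le> (\<epsilon> powr (1 + \<theta>)) powr (1 / 2) * (1 + (R \<omega>)\<^sup>2 / \<epsilon> powr (1 + \<theta>))"
            using e by (intro powr_le_scaled_square) auto
          then have "\<bar>R \<omega>\<bar> \<le> \<epsilon> powr ((1 + \<theta>) / 2) * (1 + (R \<omega>)\<^sup>2 / \<epsilon> powr (1 + \<theta>))"
            by (simp add: powr_powr)
          then show ?thesis using h by (simp add: divide_right_mono)
        qed
        finally have 2: "?f (W \<omega>) * (\<psi> (Y t \<omega>) - \<psi> (Z \<omega>)) \<le> ?b2 \<omega>" .
        have "?f (Y t \<omega>) * \<psi> (Y t \<omega>) = (?f (Y t \<omega>) - ?f (W \<omega>)) * \<psi> (Y t \<omega>) + ?f (W \<omega>) * (\<psi> (Y t \<omega>) - \<psi> (Z \<omega>)) + ?f (W \<omega>) * \<psi> (Z \<omega>)"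
          by (simp add: algebra_simps)
        then show ?case using 1 2 by linarith
      qed
    qed (use int1 int2 int3 in auto)
    also have "\<dots> = expectation ?b1 + expectation ?b2 + expectation (\<lambda>\<omega>. ?f (W \<omega>) * \<psi> (Z \<omega>))"
      using int1 int2 int3 by simp
    also have "expectation ?b1 \<le> L / \<delta> * (1 + C) * h powr (1 / 8)"
    proof -
      have "expectation ?b1 = L / \<delta> * \<epsilon> powr (\<theta> / 2) * (1 + expectation (\<lambda>\<omega>. (Y t \<omega> - Y s \<omega>)\<^sup>2) / \<epsilon>)"
        using m1(1) by (simp add: prob_space)
      also have "\<dots> \<le> L / \<delta> * \<epsilon> powr (\<theta> / 2) * (1 + C * \<epsilon> / \<epsilon>)"
        using m1(2) e L d by (intro mult_left_mono add_left_mono divide_right_mono) auto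
      also have "\<dots> = L / \<delta> * (1 + C) * h powr (3 / 2 * (\<theta> / 2))" using e by (simp add: \<epsilon>_def powr_powr)
      also have "\<dots> \<le> L / \<delta> * (1 + C) * h powr (1 / 8)"
        using L d C(1) h \<theta> by (intro mult_left_mono powr_mono') auto
      finally show ?thesis .
    qed
    also have "expectation ?b2 \<le> 2 * (1 + C) * h powr (1 / 8)"
    proof -
      have "expectation ?b2 = 2 / h * \<epsilon> powr ((1 + \<theta>) / 2) * (1 + expectation (\<lambda>\<omega>. (R \<omega>)\<^sup>2) / \<epsilon> powr (1 + \<theta>))"
        using m2(1) by (simp add: prob_space)
      also have "\<dots> \<le> 2 / h * \<epsilon> powr ((1 + \<theta>) / 2) * (1 + C * \<epsilon> powr (1 + \<theta>) / \<epsilon> powr (1 + \<theta>))"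
        using m2(2) e h by (intro mult_left_mono add_left_mono divide_right_mono) auto
      also have "\<dots> = 2 * (1 + C) * (h powr (3 / 2 * ((1 + \<theta>) / 2)) / h powr 1)" using e h by (simp add: \<epsilon>_def powr_powr)
      also have "h powr (3 / 2 * ((1 + \<theta>) / 2)) / h powr 1 = h powr (3 / 2 * ((1 + \<theta>) / 2) - 1)" by (rule powr_diff[symmetric])
      also have "2 * (1 + C) * \<dots> \<le> 2 * (1 + C) * h powr (1 / 8)"
        using C(1) h \<theta> by (intro mult_left_mono powr_mono') auto
      finally show ?thesis .
    qed
    also have "expectation (\<lambda>\<omega>. ?f (W \<omega>) * \<psi> (Z \<omega>)) \<le> 1 / \<delta> * h powr (1 / 8)"
    proof -
      have "expectation (\<lambda>\<omega>. ?f (W \<omega>) * \<psi> (Z \<omega>)) \<le> h / (\<delta> * sqrt (t - s))"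
        unfolding \<psi>_def Z_def by (rule gaussian_step_le[OF U h(1) d s(1,2) W(1)])
      also have "\<dots> = 1 / \<delta> * (h powr 1 / h powr (3 / 4))"
        using h(1) by (simp add: s(3) powr_half_sqrt[symmetric] \<epsilon>_def powr_powr)
      also have "h powr 1 / h powr (3 / 4) = h powr (1 - 3 / 4)" by (rule powr_diff[symmetric])
      also have "1 / \<delta> * \<dots> \<le> 1 / \<delta> * h powr (1 / 8)"
        using d h by (intro mult_left_mono powr_mono') auto
      finally show ?thesis .
    qed
    finally show ?thesis by (simp add: K_def \<psi>_def algebra_simps)
  qed
  moreover have "0 \<le> K" using C(1) L d by (simp add: K_def)
  ultimately show thesis using that by blast
qed

section \<open>Absolute continuity\<close>

text \<open>The expectations \<open>e n\<close> at scale \<open>H n = 2\<^sup>-\<^sup>n\<close> increase by at most \<open>K r\<^sup>n\<close> from one scale to the next, and start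
at scale \<open>H N\<close> below \<open>\<lambda> U / H N\<close>. Their limit dominates the expectation with the indicator of \<open>U\<close>, since box averages
at a point of the open set \<open>U\<close> are eventually equal to one.\<close>

lemma nondegenerate_null:
  assumes t: "0 < t" and d: "0 < \<delta>" and A: "A \<in> sets borel" "emeasure lborel A = 0"
  shows "AE \<omega> in M. nondegenerate \<delta> (Y t \<omega>) * indicator A (Y t \<omega>) = 0"
proof -
  have [measurable]: "A \<in> sets borel" by fact
  let ?f = "nondegenerate \<delta>"
  obtain K where K: "0 \<le> K" "\<And>U h. open U \<Longrightarrow> 0 < h \<Longrightarrow> h \<le> 1 \<Longrightarrow> h \<le> t \<Longrightarrow>
     expectation (\<lambda>\<omega>. ?f (Y t \<omega>) * (box_average U h (Y t \<omega>) - box_average U (2 * h) (Y t \<omega>))) \<le> K * h powr (1 / 8)"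
    using scale_step_le[OF t d] by blast
  define H where "H n = (1 / 2 :: real) ^ n" for n
  define r where "r = (1 / 2 :: real) powr (1 / 8)"
  have r: "0 < r" "r < 1" unfolding r_def using powr_less_mono2[of "1/8" "1/2" 1] by auto
  have H: "0 < H n" "H n \<le> 1" "2 * H (Suc n) = H n" "H n powr (1 / 8) = r ^ n" for n
  proof -
    show "0 < H n" "H n \<le> 1" "2 * H (Suc n) = H n" by (auto simp: H_def power_le_one)
    have "H n powr (1 / 8) = ((1 / 2) powr real n) powr (1 / 8)" by (simp add: H_def powr_realpow)
    also have "\<dots> = r powr real n" by (simp add: r_def powr_powr mult.commute)
    also have "\<dots> = r ^ n" using r by (simp add: powr_realpow)
    finally show "H n powr (1 / 8) = r ^ n" .
  qed
  have Hlim: "H \<longlonglongrightarrow> 0" unfolding H_def by (intro LIMSEQ_power_zero) auto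
  obtain N0 where N0: "\<And>n. N0 \<le> n \<Longrightarrow> H n < t"
    using order_tendstoD(2)[OF Hlim t] by (auto simp: eventually_sequentially)
  have f_int: "integrable M (\<lambda>\<omega>. ?f (Y t \<omega>) * g (Y t \<omega>))"
    if [measurable]: "g \<in> borel_measurable borel" and g: "\<And>y. 0 \<le> g y" "\<And>y. g y \<le> 1" for g
  proof (rule integrable_const_bound[where B = 1])
    show "AE \<omega> in M. norm (?f (Y t \<omega>) * g (Y t \<omega>)) \<le> 1"
      using g nondegenerate_range[of \<delta>] by (intro AE_I2) (auto simp: abs_mult intro!: mult_le_one)
  qed measurable
  have step: "expectation (\<lambda>\<omega>. ?f (Y t \<omega>) * indicator A (Y t \<omega>)) \<le> H N + K / (1 - r) * r ^ N" if N: "N0 \<le> N" for N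
  proof -
    \<comment> \<open>The measure of \<open>U\<close> is taken below \<open>(H N)\<^sup>2\<close> so that the box averages at scale \<open>H N\<close> are at most \<open>H N\<close>.\<close>
    have "0 < H N * H N" using H(1) by simp
    then obtain U where U: "open U" "A \<subseteq> U" "emeasure lborel (U - A) < ennreal (H N * H N)"
      using outer_regular_lborel[OF A(1), of "H N * H N"] by metis
    have [measurable]: "U \<in> sets borel" using U by simp
    have "emeasure lborel U = emeasure lborel (U - A)"
    proof -
      have "emeasure lborel U \<le> emeasure lborel (U - A) + emeasure lborel A"
        using U(2) by (intro order_trans[OF emeasure_mono emeasure_subadditive]) auto
      moreover have "emeasure lborel (U - A) \<le> emeasure lborel U" by (intro emeasure_mono) auto
      ultimately show ?thesis using A(2) by simp
    qed
    then have less: "emeasure lborel U < ennreal (H N * H N)" using U(3) by simp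
    then have Ufin: "U \<in> fmeasurable lborel" by (auto simp: fmeasurable_def less_trans[OF _ ennreal_less_top])
    have Um: "measure lborel U \<le> H N * H N" using less H(1)[of N] by (auto simp: measure_def intro!: enn2real_leI)
    have box[measurable]: "box_average U (H n) \<in> borel_measurable borel" for n
      by (rule box_average_measurable[OF U(1) H(1)])
    note rng = box_average_nonneg[OF U(1) H(1)] box_average_le_one[OF U(1) H(1)]
    define e where "e n = expectation (\<lambda>\<omega>. ?f (Y t \<omega>) * box_average U (H n) (Y t \<omega>))" for n
    have e_int: "integrable M (\<lambda>\<omega>. ?f (Y t \<omega>) * box_average U (H n) (Y t \<omega>))" for n
      by (rule f_int[OF box rng])
    have e_Suc: "e (Suc n) \<le> e n + K * r ^ n" if "N \<le> n" for n
    proof -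
      have "e (Suc n) - e n = expectation (\<lambda>\<omega>. ?f (Y t \<omega>) * (box_average U (H (Suc n)) (Y t \<omega>) - box_average U (2 * H (Suc n)) (Y t \<omega>)))"
        unfolding e_def H(3) by (simp add: right_diff_distrib e_int)
      also have "\<dots> \<le> K * r ^ Suc n"
        unfolding H(4)[of "Suc n", symmetric] using N0[of "Suc n"] that N
        by (intro K(2) U(1) H) auto
      also have "\<dots> \<le> K * r ^ n" using K(1) r by (intro mult_left_mono power_decreasing) auto
      finally show ?thesis by simp
    qed
    have e_tail: "e (N + k) \<le> e N + K / (1 - r) * r ^ N * (1 - r ^ k)" for k
    proof (induction k)
      case (Suc k)
      have "e (N + Suc k) \<le> e (N + k) + K * r ^ (N + k)" using e_Suc[of "N + k"] by simp
      also have "\<dots> \<le> e N + (K / (1 - r) * r ^ N * (1 - r ^ k) + K * r ^ (N + k))" using Suc by simp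
      also have "K * r ^ (N + k) = K / (1 - r) * r ^ N * (r ^ k * (1 - r))" using r by (simp add: power_add)
      also have "K / (1 - r) * r ^ N * (1 - r ^ k) + K / (1 - r) * r ^ N * (r ^ k * (1 - r)) = K / (1 - r) * r ^ N * (1 - r ^ Suc k)"
        by (simp only: distrib_left[symmetric]) (simp add: algebra_simps)
      finally show ?case .
    qed simp
    have eN: "e N \<le> H N"
    proof -
      have "e N \<le> expectation (\<lambda>\<omega>. H N)"
        unfolding e_def
      proof (rule integral_mono[OF e_int])
        fix \<omega>
        have "?f (Y t \<omega>) * box_average U (H N) (Y t \<omega>) \<le> 1 * (measure lborel U / H N)"
          using nondegenerate_range[of \<delta>] rng box_average_le_measure[OF U(1) H(1) Ufin] by (intro mult_mono) auto
        also have "\<dots> \<le> H N" using Um H(1)[of N] by (simp add: pos_divide_le_eq)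
        finally show "?f (Y t \<omega>) * box_average U (H N) (Y t \<omega>) \<le> H N" .
      qed simp
      then show ?thesis by (simp add: prob_space)
    qed
    have bound: "e n \<le> H N + K / (1 - r) * r ^ N" if "N \<le> n" for n
    proof -
      have "e n \<le> e N + K / (1 - r) * r ^ N * (1 - r ^ (n - N))" using e_tail[of "n - N"] that by simp
      also have "\<dots> \<le> H N + K / (1 - r) * r ^ N * 1"
        using eN K(1) r by (intro add_mono mult_left_mono) auto
      finally show ?thesis by simp
    qed
    let ?u = "\<lambda>n \<omega>. ?f (Y t \<omega>) * (indicator U (Y t \<omega>) * box_average U (H n) (Y t \<omega>))"
    have "(\<lambda>n. expectation (\<lambda>\<omega>. ?u n \<omega>))
        \<longlonglongrightarrow> expectation (\<lambda>\<omega>. ?f (Y t \<omega>) * indicator U (Y t \<omega>))"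
    proof (rule integral_dominated_convergence[where w = "\<lambda>_. 1"])
      show "AE \<omega> in M. (\<lambda>n. ?u n \<omega>) \<longlonglongrightarrow> ?f (Y t \<omega>) * indicator U (Y t \<omega>)"
      proof (rule AE_I2)
        fix \<omega>
        show "(\<lambda>n. ?u n \<omega>) \<longlonglongrightarrow> ?f (Y t \<omega>) * indicator U (Y t \<omega>)"
        proof (cases "Y t \<omega> \<in> U")
          case True
          have "eventually (\<lambda>n. ?u n \<omega> = ?f (Y t \<omega>) * indicator U (Y t \<omega>)) sequentially"
            using box_average_eventually_one[OF U(1) True Hlim H(1)] by eventually_elim simp
          then show ?thesis by (rule tendsto_eventually)
        qed simp
      qed
      show "AE \<omega> in M. norm (?u n \<omega>) \<le> 1" for n
        using rng nondegenerate_range[of \<delta>] by (intro AE_I2) (auto simp: abs_mult indicator_def intro!: mult_le_one)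
    qed auto
    moreover have "expectation (\<lambda>\<omega>. ?u n \<omega>) \<le> H N + K / (1 - r) * r ^ N" if "N \<le> n" for n
    proof -
      have "expectation (\<lambda>\<omega>. ?u n \<omega>) \<le> e n"
        unfolding e_def
      proof (rule integral_mono[OF _ e_int])
        show "integrable M (\<lambda>\<omega>. ?u n \<omega>)"
          using f_int[of "\<lambda>y. indicator U y * box_average U (H n) y"] rng by (auto simp: indicator_def)
        show "?u n \<omega> \<le> ?f (Y t \<omega>) * box_average U (H n) (Y t \<omega>)" for \<omega>
          using rng nondegenerate_range[of \<delta>] by (auto simp: indicator_def)
      qed
      with bound[OF that] show ?thesis by simp
    qed
    ultimately have "expectation (\<lambda>\<omega>. ?f (Y t \<omega>) * indicator U (Y t \<omega>)) \<le> H N + K / (1 - r) * r ^ N"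
      by (intro LIMSEQ_le_const2) auto
    moreover have "expectation (\<lambda>\<omega>. ?f (Y t \<omega>) * indicator A (Y t \<omega>)) \<le> expectation (\<lambda>\<omega>. ?f (Y t \<omega>) * indicator U (Y t \<omega>))"
    proof (rule integral_mono)
      show "integrable M (\<lambda>\<omega>. ?f (Y t \<omega>) * indicator A (Y t \<omega>))" "integrable M (\<lambda>\<omega>. ?f (Y t \<omega>) * indicator U (Y t \<omega>))"
        by (auto intro!: f_int)
      show "?f (Y t \<omega>) * indicator A (Y t \<omega>) \<le> ?f (Y t \<omega>) * indicator U (Y t \<omega>)" for \<omega>
        using U(2) nondegenerate_range[of \<delta>] by (intro mult_left_mono) (auto simp: indicator_def)
    qed
    ultimately show ?thesis by simp
  qed
  have "(\<lambda>N. H N + K / (1 - r) * r ^ N) \<longlonglongrightarrow> 0 + K / (1 - r) * 0"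
    using r by (intro tendsto_add Hlim tendsto_mult tendsto_const LIMSEQ_power_zero) auto
  then have "expectation (\<lambda>\<omega>. ?f (Y t \<omega>) * indicator A (Y t \<omega>)) \<le> 0 + K / (1 - r) * 0"
    using step by (intro LIMSEQ_le_const) auto
  moreover have "0 \<le> expectation (\<lambda>\<omega>. ?f (Y t \<omega>) * indicator A (Y t \<omega>))"
    using nondegenerate_range[of \<delta>] by (intro integral_nonneg_AE AE_I2) auto
  ultimately have "expectation (\<lambda>\<omega>. ?f (Y t \<omega>) * indicator A (Y t \<omega>)) = 0" by simp
  moreover have "integrable M (\<lambda>\<omega>. ?f (Y t \<omega>) * indicator A (Y t \<omega>))" by (auto intro!: f_int)
  ultimately show ?thesis
    using nondegenerate_range[of \<delta>] by (subst (asm) integral_nonneg_eq_0_iff_AE) auto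
qed

lemma null_set_not_hit:
  assumes t: "0 < t" and A: "A \<in> sets borel" "emeasure lborel A = 0"
  shows "AE \<omega> in M. \<not> (Y t \<omega> \<in> A \<and> \<sigma> (Y t \<omega>) \<noteq> 0)"
proof -
  have "AE \<omega> in M. \<forall>n :: nat. nondegenerate (1 / real (Suc n)) (Y t \<omega>) * indicator A (Y t \<omega>) = 0"
    using nondegenerate_null[OF t _ A] by (subst AE_all_countable) auto
  then show ?thesis
  proof eventually_elim
    case (elim \<omega>)
    show ?case
    proof
      assume *: "Y t \<omega> \<in> A \<and> \<sigma> (Y t \<omega>) \<noteq> 0"
      then obtain n where "inverse (real (Suc n)) < \<bar>\<sigma> (Y t \<omega>)\<bar> / 2" using reals_Archimedean[of "\<bar>\<sigma> (Y t \<omega>)\<bar> / 2"] by auto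
      then have "nondegenerate (1 / real (Suc n)) (Y t \<omega>) = 1"
        by (intro nondegenerate_eq_one) (auto simp: inverse_eq_divide simp del: of_nat_Suc)
      then show False using elim[rule_format, of n] * by simp
    qed
  qed
qed

end

section \<open>From the stochastic differential equation to the regular setting\<close>

text \<open>The initial value \<open>Y 0 = x\<close> is not part of the equation as such: it follows because every elementary
integral up to time zero vanishes, and so does their limit in probability.\<close>

lemma (in brownian_basis) ito_integral_at_0:
  assumes "has_ito_integral M F B H I"
  shows "AE \<omega> in M. I 0 \<omega> = 0"
proof -
  obtain m \<tau> \<xi> where simple: "\<And>n. simple_process F (m n) (\<tau> n) (\<xi> n)"
    and conv: "null_in_probability M (\<lambda>n \<omega>. ennreal \<bar>simple_integral B (m n) (\<tau> n) (\<xi> n) 0 \<omega> - I 0 \<omega>\<bar>)"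
    using assms unfolding has_ito_integral_def by blast
  have "simple_integral B (m n) (\<tau> n) (\<xi> n) 0 \<omega> = 0" for n \<omega>
  proof -
    have "0 \<le> \<tau> n i" if "i \<le> m n" for i
      using that simple[of n] by (induction i) (auto simp: simple_process_def intro: order_trans)
    then show ?thesis unfolding simple_integral_def by (intro sum.neutral) (simp add: min_absorb1)
  qed
  with null_in_probability_AE_subsequence[OF conv] have "AE \<omega> in M. (\<lambda>k :: nat. ennreal \<bar>I 0 \<omega>\<bar>) \<longlonglongrightarrow> 0" by simp
  then show ?thesis by eventually_elim (simp add: LIMSEQ_const_iff)
qed

lemma linear_growth_square_le:
  fixes y c a :: real
  assumes "\<bar>a\<bar> \<le> c * (1 + \<bar>y\<bar>)"
  shows "a\<^sup>2 \<le> 2 * c\<^sup>2 * (1 + y\<^sup>2)"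
proof -
  have "(1 + \<bar>y\<bar>)\<^sup>2 \<le> (1 + 1) * 1\<^sup>2 + (1 + 1 / 1) * \<bar>y\<bar>\<^sup>2" by (rule square_add_le_weighted) simp
  then have sq: "(1 + \<bar>y\<bar>)\<^sup>2 \<le> 2 * (1 + y\<^sup>2)" by simp
  have "a\<^sup>2 = \<bar>a\<bar>\<^sup>2" by simp
  also have "\<dots> \<le> (c * (1 + \<bar>y\<bar>))\<^sup>2" using assms by (intro power_mono) auto
  also have "\<dots> = c\<^sup>2 * (1 + \<bar>y\<bar>)\<^sup>2" by (simp add: power_mult_distrib)
  also have "\<dots> \<le> c\<^sup>2 * (2 * (1 + y\<^sup>2))" using sq by (intro mult_left_mono) auto
  finally show ?thesis by (simp only: ac_simps)
qed

lemma path_drift_integrable: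
  fixes y :: "real \<Rightarrow> real"
  assumes "continuous_on UNIV y" and [measurable]: "b \<in> borel_measurable borel"
    and growth: "\<And>z. \<bar>b z\<bar> \<le> c * (1 + \<bar>z\<bar>)"
  shows "set_integrable lborel {s..t} (\<lambda>u. b (y u))"
proof -
  have [measurable]: "y \<in> borel_measurable borel" using assms(1) by (rule borel_measurable_continuous_onI)
  have "bounded (y ` {s..t})"
    using assms(1) by (intro compact_imp_bounded compact_continuous_image) (auto intro: continuous_on_subset)
  then obtain R where R: "\<forall>u\<in>{s..t}. \<bar>y u\<bar> \<le> R" by (auto simp: bounded_iff)
  have "0 \<le> c" using growth[of 0] by simp
  then have "\<bar>b (y u)\<bar> \<le> c * (1 + R)" if "u \<in> {s..t}" for u
    using growth[of "y u"] R that by (intro order_trans[OF growth] mult_left_mono add_left_mono) auto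
  then show ?thesis
    unfolding set_integrable_def
    by (intro integrableI_bounded_set_indicator[where B = "c * (1 + R)"]) (auto simp: emeasure_lborel_Icc_eq)
qed

theorem theorem2p1:
  fixes M :: "'a measure" and F :: "real \<Rightarrow> 'a measure"
    and B X :: "real \<Rightarrow> 'a \<Rightarrow> real"
    and \<sigma> b :: "real \<Rightarrow> real" and x \<theta> :: real
  assumes "filtered_prob_space M F"
    and "brownian_motion M F B"
    and "1 / 2 < \<theta>" and "\<theta> \<le> 1"
    and "holder_continuous \<theta> \<sigma>"
    and "b \<in> borel_measurable borel" and "at_most_linear_growth b"
    and "continuous_sde_solution M F B x \<sigma> b X"
  shows "\<forall>t>0. has_density_on (distr M borel (X t)) {y. \<sigma> y \<noteq> 0}"
proof -
  interpret prob_space M using assms(1) by (simp add: filtered_prob_space_def)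
  interpret brownian_basis M F B using assms(1,2) by unfold_locales
  have [measurable]: "b \<in> borel_measurable borel" by fact
  obtain C where C: "\<And>y z. \<bar>\<sigma> y - \<sigma> z\<bar> \<le> C * \<bar>y - z\<bar> powr \<theta>" using assms(5) by (auto simp: holder_continuous_def)
  define L where "L = max C 1"
  have L: "0 < L" by (simp add: L_def)
  have holder: "\<bar>\<sigma> y - \<sigma> z\<bar> \<le> L * \<bar>y - z\<bar> powr \<theta>" for y z
    by (rule order_trans[OF C]) (simp add: L_def mult_right_mono)
  have [measurable]: "\<sigma> \<in> borel_measurable borel"
    using assms(3) by (intro borel_measurable_continuous_onI continuous_on_of_holder[OF holder]) auto
  obtain c where c: "\<And>y. \<bar>b y\<bar> \<le> c * (1 + \<bar>y\<bar>)" using assms(7) by (auto simp: at_most_linear_growth_def)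
  define R where "R = max c (\<bar>\<sigma> 0\<bar> + L)"
  have bR: "\<bar>b y\<bar> \<le> R * (1 + \<bar>y\<bar>)" for y
    by (rule order_trans[OF c]) (simp add: R_def mult_right_mono)
  have \<sigma>R: "\<bar>\<sigma> y\<bar> \<le> R * (1 + \<bar>y\<bar>)" for y
  proof -
    have "\<bar>\<sigma> y\<bar> \<le> \<bar>\<sigma> 0\<bar> + L * \<bar>y\<bar> powr \<theta>" using holder[of y 0] by simp
    also have "\<dots> \<le> \<bar>\<sigma> 0\<bar> * (1 + \<bar>y\<bar>) + L * (1 + \<bar>y\<bar>)"
      using L assms(3,4) by (intro add_mono mult_left_mono powr_le_add_one) (auto simp: distrib_left)
    also have "\<dots> = (\<bar>\<sigma> 0\<bar> + L) * (1 + \<bar>y\<bar>)" by (simp add: distrib_right)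
    also have "\<dots> \<le> R * (1 + \<bar>y\<bar>)" by (intro mult_right_mono) (auto simp: R_def)
    finally show ?thesis .
  qed
  have R: "0 < R" using L by (simp add: R_def less_max_iff_disj add_nonneg_pos)
  have adap: "\<And>t. 0 \<le> t \<Longrightarrow> X t \<in> borel_measurable (F t)"
    and cont: "AE \<omega> in M. continuous_on {0..} (\<lambda>t. X t \<omega>)"
    using assms(8) by (auto simp: continuous_sde_solution_def adapted_def continuous_paths_def)
  obtain I where I: "has_ito_integral M F B (\<lambda>s \<omega>. \<sigma> (X s \<omega>)) I"
    and sde: "AE \<omega> in M. \<forall>t\<ge>0. X t \<omega> = x + I t \<omega> + (LINT s:{0..t}|lborel. b (X s \<omega>))"
    using assms(8) by (auto simp: continuous_sde_solution_def)
  obtain N where N: "{\<omega> \<in> space M. \<not> continuous_on {0..} (\<lambda>t. X t \<omega>)} \<subseteq> N" "N \<in> null_sets M"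
    using cont by (auto elim!: AE_E)
  have [measurable]: "N \<in> sets M" using N(2) by auto
  \<comment> \<open>Discontinuous paths are replaced by a constant, and paths are extended to negative times by their
initial value.\<close>
  define Y where "Y u \<omega> = (if \<omega> \<in> N then 0 else X (max u 0) \<omega>)" for u \<omega>
  have Y_cont: "continuous_on UNIV (\<lambda>u. Y u \<omega>)" if "\<omega> \<in> space M" for \<omega>
  proof (cases "\<omega> \<in> N")
    case False
    then have "continuous_on {0..} (\<lambda>t. X t \<omega>)" using N(1) that by auto
    then have "continuous_on UNIV (\<lambda>u. X (max u 0) \<omega>)"
      by (rule continuous_on_compose2) (auto intro!: continuous_intros)
    then show ?thesis using False by (simp add: Y_def)
  qed (simp add: Y_def)
  have Y_meas: "Y u \<in> borel_measurable M" for u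
  proof -
    have [measurable]: "X (max u 0) \<in> borel_measurable M" by (rule F_measurable_M[OF adap]) auto
    show ?thesis unfolding Y_def by measurable
  qed
  have joint: "(\<lambda>(u, \<omega>). Y u \<omega>) \<in> borel_measurable (borel \<Otimes>\<^sub>M M)"
    by (rule continuous_paths_joint_measurable[OF Y_cont Y_meas])
  have XY: "AE \<omega> in M. \<forall>u\<ge>0. X u \<omega> = Y u \<omega>"
    using AE_not_in[OF N(2)] by eventually_elim (simp add: Y_def max_absorb1)
  have sdeY: "AE \<omega> in M. \<forall>t\<ge>0. Y t \<omega> = x + I t \<omega> + (LINT s:{0..t}|lborel. b (Y s \<omega>))"
    using sde XY
  proof eventually_elim
    case (elim \<omega>)
    have "(LINT s:{0..t}|lborel. b (X s \<omega>)) = (LINT s:{0..t}|lborel. b (Y s \<omega>))" for t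
      using elim(2) by (intro set_lebesgue_integral_cong) auto
    with elim show ?case by simp
  qed
  interpret regular_sde M F B Y \<sigma> b x \<theta> L "2 * R\<^sup>2"
  proof unfold_locales
    show "continuous_on UNIV (\<lambda>u. Y u \<omega>)" if "\<omega> \<in> space M" for \<omega> by (rule Y_cont[OF that])
    show "Y u \<in> borel_measurable M" for u by (rule Y_meas)
    show "\<exists>W\<in>borel_measurable (F u). AE \<omega> in M. W \<omega> = Y u \<omega>" if "0 \<le> u" for u
      using XY that by (intro bexI[of _ "X u"] adap) auto
    show "AE \<omega> in M. Y 0 \<omega> = x"
      using sdeY ito_integral_at_0[OF I]
    proof eventually_elim
      case (elim \<omega>)
      have "(LINT s:{0..0}|lborel. b (Y s \<omega>)) = 0"
        unfolding set_lebesgue_integral_def using AE_lborel_singleton[of "0 :: real"]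
        by (intro integral_eq_zero_AE) (auto elim!: eventually_mono)
      then show ?case using elim by simp
    qed
    show "1 / 2 < \<theta>" "\<theta> \<le> 1" "0 < L" "b \<in> borel_measurable borel" "0 < 2 * R\<^sup>2" using assms(3,4) L R by auto
    show "\<bar>\<sigma> y - \<sigma> z\<bar> \<le> L * \<bar>y - z\<bar> powr \<theta>" for y z by (rule holder)
    show "(\<sigma> y)\<^sup>2 \<le> 2 * R\<^sup>2 * (1 + y\<^sup>2)" "(b y)\<^sup>2 \<le> 2 * R\<^sup>2 * (1 + y\<^sup>2)" for y
      by (rule linear_growth_square_le[OF \<sigma>R], rule linear_growth_square_le[OF bR])
    fix s t c :: real and \<kappa> :: "'a \<Rightarrow> real" assume st: "0 \<le> s" "s < t" and \<kappa>: "\<kappa> \<in> borel_measurable (F s)" and c: "0 \<le> c"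
    let ?J = "\<lambda>\<omega>. Y t \<omega> - Y s \<omega> - (LINT u:{s..t}|lborel. b (Y u \<omega>))"
    have Ym [measurable (raw)]: "(\<lambda>p. Y (f p) (g p)) \<in> borel_measurable K"
      if "f \<in> borel_measurable K" "g \<in> measurable K M" for f g and K :: "'c measure"
      using measurable_compose[OF measurable_Pair joint, of f K g] that by simp
    have J: "?J \<in> borel_measurable M"
      unfolding set_lebesgue_integral_def by measurable
    have JI: "AE \<omega> in M. ?J \<omega> = I t \<omega> - I s \<omega>"
      using sdeY AE_space
    proof eventually_elim
      case (elim \<omega>)
      have int: "set_integrable lborel {p..q} (\<lambda>u. b (Y u \<omega>))" for p q
        by (rule path_drift_integrable[OF Y_cont[OF elim(2)] _ bR]) measurable
      have "{0..t} = {0..s} \<union> {s..t}" using st by auto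
      then have "(LINT u:{0..t}|lborel. b (Y u \<omega>)) = (LINT u:{0..s} \<union> {s..t}|lborel. b (Y u \<omega>))" by simp
      also have "\<dots> = (LINT u:{0..s}|lborel. b (Y u \<omega>)) + (LINT u:{s..t}|lborel. b (Y u \<omega>))"
      proof (rule set_integral_Un_AE)
        show "AE u in lborel. \<not> (u \<in> {0..s} \<and> u \<in> {s..t})"
          using AE_lborel_singleton[of s] by eventually_elim auto
      qed (auto intro: int)
      finally show ?case using elim(1) st by (auto simp: algebra_simps)
    qed
    have HH: "AE \<omega> in M. \<forall>u\<ge>0. \<sigma> (X u \<omega>) = \<sigma> (Y u \<omega>)" using XY by eventually_elim simp
    show "(\<integral>\<^sup>+\<omega>. ennreal ((?J \<omega> - \<kappa> \<omega> * (B t \<omega> - B s \<omega>))\<^sup>2)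
          * indicator {\<omega>. (\<integral>\<^sup>+u\<in>{s..t}. ennreal ((\<sigma> (Y u \<omega>) - \<kappa> \<omega>)\<^sup>2) \<partial>lborel) < ennreal c} \<omega> \<partial>M)
      \<le> (\<integral>\<^sup>+\<omega>. min (\<integral>\<^sup>+u\<in>{s..t}. ennreal ((\<sigma> (Y u \<omega>) - \<kappa> \<omega>)\<^sup>2) \<partial>lborel) (ennreal c) \<partial>M)"
      by (rule ito_killed_inequality[OF I st \<kappa> c _ HH J JI]) measurable
  qed
  show ?thesis
  proof (intro allI impI)
    fix t :: real assume t: "0 < t"
    have [measurable]: "X t \<in> borel_measurable M" using F_measurable_M[OF adap] t by simp
    have D: "{y. \<sigma> y \<noteq> 0} \<in> sets borel" by measurable
    show "has_density_on (distr M borel (X t)) {y. \<sigma> y \<noteq> 0}"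
    proof (subst has_density_on_iff[OF _ D], simp, intro ballI impI)
      fix A :: "real set" assume A: "A \<in> sets borel" "emeasure lborel A = 0"
      have "AE \<omega> in M. \<not> (X t \<omega> \<in> A \<and> \<sigma> (X t \<omega>) \<noteq> 0)"
        using null_set_not_hit[OF t A] XY by eventually_elim (use t in auto)
      then have "emeasure M {\<omega> \<in> space M. X t \<omega> \<in> A \<and> \<sigma> (X t \<omega>) \<noteq> 0} = 0" by (rule emeasure_eq_0_AE)
      moreover have "X t -` (A \<inter> {y. \<sigma> y \<noteq> 0}) \<inter> space M = {\<omega> \<in> space M. X t \<omega> \<in> A \<and> \<sigma> (X t \<omega>) \<noteq> 0}" by auto
      ultimately show "emeasure (distr M borel (X t)) (A \<inter> {y. \<sigma> y \<noteq> 0}) = 0"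
        using A D by (subst emeasure_distr) auto
    qed
  qed
qed

end
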